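(* Assume that the following holds: for every $m \in \mathbb{N}$ and every family $(C_n)_{n\in\mathbb{N}}$ of bounded depth $\mathrm{CC}[m]$-circuits such that $C_n$ computes the $n$-ary $\mathrm{AND}$, there is some $q>0$ such that $C_n$ is of size $2^{\Omega(n^q)}$. Then, for every finite nilpotent algebra $\mathbf{A}$ from a congruence modular variety, the problems $\mathsf{CSAT}(\mathbf{A})$ and $\mathsf{CEQV}(\mathbf{A})$ can be solved in quasipolynomial time $\mathcal{O}(2^{(\log n)^t})$, where $n$ is the size of the input and $t>0$ depends on $\mathbf{A}$.
   Context: **CC-circuits.** A $\mathrm{MOD}_m$-gate has unbounded fan-in and outputs $1$ if its inputs sum up to $0$ modulo $m$, and $0$ otherwise. A $\mathrm{CC}[m]$-circuit is a Boolean circuit all of whose gates (other than Boolean input gates and Boolean constants) are $\mathrm{MOD}_m$-gates; several parallel wires between two gates are allowed. A family $(C_n)$ has bounded depth if a constant bounds the depth of all $C_n$. The $n$-ary $\mathrm{AND}$ is the Boolean function with value $1$ exactly on $(1,\ldots,1)$. The size of a circuit is its number of gates. **Algebras.** An algebra $\mathbf{A}=(A,(f_i^{\mathbf{A}})_{i\in I})$ is a set $A$ (universe) with finitary basic operations $f_i^{\mathbf{A}}:A^{k_i}\to A$; its signature is $(k_i)_{i\in I}$. It is finite if $A$ and $I$ are finite. Two algebras on the same universe are polynomially equivalent if they have the same polynomial operations (compositions of basic operations and constants from the universe). A circuit over $\mathbf{A}$ is an $A$-valued circuit with a unique output gate, whose gates are labelled by basic operations of $\mathbf{A}$ (or are input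 gates or constants from $A$). **Nilpotent algebras.** An algebra $\mathbf{A}=(A,(f^{\mathbf{A}})_{f\in I})$ from a congruence modular variety is $1$-nilpotent (Abelian) if it is polynomially equivalent to a module. It is $n$-nilpotent if there are algebras $\mathbf{L}=(L,(f^{\mathbf{L}})_{f\in I})$, $\mathbf{U}=(U,(f^{\mathbf{U}})_{f\in I})$ in the same signature such that $\mathbf{L}$ is Abelian, $\mathbf{U}$ is $(n-1)$-nilpotent, $A=L\times U$ (up to isomorphism), and every basic operation has the form $f^{\mathbf{A}}((l_1,u_1),\ldots,(l_k,u_k))=(f^{\mathbf{L}}(l_1,\ldots,l_k)+\hat f(u_1,\ldots,u_k),\,f^{\mathbf{U}}(u_1,\ldots,u_k))$ for some function $\hat f:U^k\to L$, where $+$ is the addition of the module polynomially equivalent to $\mathbf{L}$. Nilpotent means $n$-nilpotent for some $n$. **Decision problems (for a fixed finite algebra $\mathbf{A}$).** Input for both: two circuits $C,C'$ over $\mathbf{A}$ with input gates $x_1,\ldots,x_n$. $\mathsf{CSAT}(\mathbf{A})$: is there a tuple $\bar a\in A^n$ with $C(\bar a)=C'(\bar a)$? $\mathsf{CEQV}(\mathbf{A})$: is $C(\bar a)=C'(\bar a)$ for all $\bar a\in A^n$? *)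

theory Defs
  imports Complex_Main "HOL-Algebra.Module" "HOL-Library.Landau_Symbols"
begin

section \<open>Circuits\<close>

text \<open>A circuit is a topologically sorted directed acyclic graph. Its nodes are numbered: the nodes
  below \<open>inputs C\<close> are the input gates, and entry \<open>j\<close> of \<open>gates C\<close> is node
  \<open>inputs C + j\<close>, given by its label and the list of its predecessors. A predecessor may
  occur several times in this list (parallel wires). Constants are gates without predecessors.\<close>

record 'g circuit =
  inputs :: nat
  gates :: "('g \<times> nat list) list"
  output_node :: nat

definition num_gates :: "'g circuit \<Rightarrow> nat" where
  "num_gates C = inputs C + length (gates C)"

definition wf_circuit :: "('g \<Rightarrow> nat \<Rightarrow> bool) \<Rightarrow> 'g circuit \<Rightarrow> bool" where
  "wf_circuit fan_in_ok C \<longleftrightarrow>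
     (\<forall>j < length (gates C). case gates C ! j of (g, ps) \<Rightarrow>
        fan_in_ok g (length ps) \<and> (\<forall>p \<in> set ps. p < inputs C + j)) \<and>
     output_node C < num_gates C"

text \<open>The list of the values of all nodes, in the order of their numbers.\<close>

definition node_values :: "('g \<Rightarrow> 'v list \<Rightarrow> 'v) \<Rightarrow> 'g circuit \<Rightarrow> 'v list \<Rightarrow> 'v list" where
  "node_values sem C xs =
     foldl (\<lambda>vs (g, ps). vs @ [sem g (map (\<lambda>p. vs ! p) ps)]) xs (gates C)"

definition circuit_value :: "('g \<Rightarrow> 'v list \<Rightarrow> 'v) \<Rightarrow> 'g circuit \<Rightarrow> 'v list \<Rightarrow> 'v" where
  "circuit_value sem C xs = node_values sem C xs ! output_node C"

text \<open>The depth is the number of wires on a longest path. It is computed by evaluating the circuit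
  over the natural numbers, where each node gets the length of a longest path ending in it.\<close>

definition circuit_depth :: "'g circuit \<Rightarrow> nat" where
  "circuit_depth C =
     Max (set (node_values (\<lambda>_ ds. if ds = [] then 0 else Suc (Max (set ds)))
                 C (replicate (inputs C) 0)))"

section \<open>CC-circuits\<close>

datatype cc_gate = MOD_gate | Bool_const bool

fun cc_sem :: "nat \<Rightarrow> cc_gate \<Rightarrow> bool list \<Rightarrow> bool" where
  "cc_sem m MOD_gate bs \<longleftrightarrow> (\<Sum>b\<leftarrow>bs. of_bool b :: nat) mod m = 0"
| "cc_sem m (Bool_const b) bs \<longleftrightarrow> b"

fun cc_fan_in_ok :: "cc_gate \<Rightarrow> nat \<Rightarrow> bool" where
  "cc_fan_in_ok MOD_gate k \<longleftrightarrow> True"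
| "cc_fan_in_ok (Bool_const b) k \<longleftrightarrow> k = 0"

abbreviation cc_circuit :: "cc_gate circuit \<Rightarrow> bool" where
  "cc_circuit \<equiv> wf_circuit cc_fan_in_ok"

definition computes_AND :: "nat \<Rightarrow> nat \<Rightarrow> cc_gate circuit \<Rightarrow> bool" where
  "computes_AND m n C \<longleftrightarrow> inputs C = n \<and>
     (\<forall>bs. length bs = n \<longrightarrow> (circuit_value (cc_sem m) C bs \<longleftrightarrow> (\<forall>b \<in> set bs. b)))"

section \<open>Algebras, polynomial operations and congruence modular varieties\<close>

text \<open>The basic operation \<open>oper A i\<close> is applied to argument lists of length \<open>arity A i\<close>.\<close>

record ('a, 'i) ualg =
  universe :: "'a set"
  index :: "'i set"
  arity :: "'i \<Rightarrow> nat"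
  oper :: "'i \<Rightarrow> 'a list \<Rightarrow> 'a"

definition tuples :: "nat \<Rightarrow> 'a set \<Rightarrow> 'a list set" where
  "tuples n S = {xs. length xs = n \<and> set xs \<subseteq> S}"

definition is_algebra :: "('a, 'i) ualg \<Rightarrow> bool" where
  "is_algebra A \<longleftrightarrow>
     (\<forall>i \<in> index A. \<forall>xs \<in> tuples (arity A i) (universe A). oper A i xs \<in> universe A)"

definition finite_algebra :: "('a, 'i) ualg \<Rightarrow> bool" where
  "finite_algebra A \<longleftrightarrow> is_algebra A \<and> finite (universe A) \<and> finite (index A)"

definition same_signature :: "('a, 'i) ualg \<Rightarrow> ('b, 'i) ualg \<Rightarrow> bool" where
  "same_signature A B \<longleftrightarrow> index A = index B \<and> (\<forall>i \<in> index A. arity A i = arity B i)"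

inductive_set compositions :: "('a, 'i) ualg \<Rightarrow> nat \<Rightarrow> ('a list \<Rightarrow> 'a) set"
  for A :: "('a, 'i) ualg" and n :: nat where
  proj: "j < n \<Longrightarrow> (\<lambda>xs. xs ! j) \<in> compositions A n"
| const: "c \<in> universe A \<Longrightarrow> (\<lambda>xs. c) \<in> compositions A n"
| comp: "i \<in> index A \<Longrightarrow> length ps = arity A i \<Longrightarrow> \<forall>p \<in> set ps. p \<in> compositions A n
    \<Longrightarrow> (\<lambda>xs. oper A i (map (\<lambda>p. p xs) ps)) \<in> compositions A n"

text \<open>Operations are compared on tuples over the universe only.\<close>

definition polynomial_operations :: "('a, 'i) ualg \<Rightarrow> nat \<Rightarrow> ('a list \<Rightarrow> 'a) set" where
  "polynomial_operations A n = (\<lambda>p. restrict p (tuples n (universe A))) ` compositions A n"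

definition polynomially_equivalent :: "('a, 'i) ualg \<Rightarrow> ('a, 'j) ualg \<Rightarrow> bool" where
  "polynomially_equivalent A B \<longleftrightarrow> universe A = universe B \<and>
     (\<forall>n. polynomial_operations A n = polynomial_operations B n)"

definition congruence :: "('a, 'i) ualg \<Rightarrow> ('a \<times> 'a) set \<Rightarrow> bool" where
  "congruence A \<theta> \<longleftrightarrow> equiv (universe A) \<theta> \<and>
     (\<forall>i \<in> index A. \<forall>xs \<in> tuples (arity A i) (universe A). \<forall>ys \<in> tuples (arity A i) (universe A).
        (\<forall>j < arity A i. (xs ! j, ys ! j) \<in> \<theta>) \<longrightarrow> (oper A i xs, oper A i ys) \<in> \<theta>)"

definition congruence_join ::
  "('a, 'i) ualg \<Rightarrow> ('a \<times> 'a) set \<Rightarrow> ('a \<times> 'a) set \<Rightarrow> ('a \<times> 'a) set" where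
  "congruence_join A \<alpha> \<beta> = \<Inter> {\<theta>. congruence A \<theta> \<and> \<alpha> \<union> \<beta> \<subseteq> \<theta>}"

definition congruence_modular :: "('a, 'i) ualg \<Rightarrow> bool" where
  "congruence_modular A \<longleftrightarrow>
     (\<forall>\<alpha> \<beta> \<gamma>. congruence A \<alpha> \<longrightarrow> congruence A \<beta> \<longrightarrow> congruence A \<gamma> \<longrightarrow> \<alpha> \<subseteq> \<gamma> \<longrightarrow>
        congruence_join A \<alpha> \<beta> \<inter> \<gamma> = congruence_join A \<alpha> (\<beta> \<inter> \<gamma>))"

datatype 'i uterm = Var nat | App 'i "'i uterm list"

fun wf_uterm :: "('a, 'i) ualg \<Rightarrow> 'i uterm \<Rightarrow> bool" where
  "wf_uterm A (Var v) \<longleftrightarrow> True"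
| "wf_uterm A (App i ts) \<longleftrightarrow>
     i \<in> index A \<and> length ts = arity A i \<and> (\<forall>t \<in> set ts. wf_uterm A t)"

fun eval_uterm :: "('a, 'i) ualg \<Rightarrow> (nat \<Rightarrow> 'a) \<Rightarrow> 'i uterm \<Rightarrow> 'a" where
  "eval_uterm A \<nu> (Var v) = \<nu> v"
| "eval_uterm A \<nu> (App i ts) = oper A i (map (eval_uterm A \<nu>) ts)"

definition satisfies_identities ::
  "('a, 'i) ualg \<Rightarrow> ('i uterm \<times> 'i uterm) set \<Rightarrow> bool" where
  "satisfies_identities A \<Sigma> \<longleftrightarrow>
     (\<forall>(s, t) \<in> \<Sigma>. \<forall>\<nu>. range \<nu> \<subseteq> universe A \<longrightarrow> eval_uterm A \<nu> s = eval_uterm A \<nu> t)"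

text \<open>A variety is the class of all models of a set \<open>\<Sigma>\<close> of identities. One cannot quantify over
  the types of the models, so modularity is only required for the models whose universe is a set of
  natural numbers. If the signature is countable, this means that all models are congruence modular:
  a failure of the modular law in a model involves finitely many elements (two chains
  through the congruences), and it persists in the countable subalgebra they generate.\<close>

definition in_congruence_modular_variety :: "('a, 'i) ualg \<Rightarrow> bool" where
  "in_congruence_modular_variety A \<longleftrightarrow>
     (\<exists>\<Sigma>. (\<forall>(s, t) \<in> \<Sigma>. wf_uterm A s \<and> wf_uterm A t) \<and> satisfies_identities A \<Sigma> \<and>
        (\<forall>B :: (nat, 'i) ualg. is_algebra B \<and> same_signature A B \<and> satisfies_identities B \<Sigma>
           \<longrightarrow> congruence_modular B))"

section \<open>Modules and nilpotent algebras\<close>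

text \<open>The locale \<open>module\<close> of HOL-Algebra is restricted to commutative rings; here the ring is
  arbitrary (with unit).\<close>

definition left_module :: "('r, 'x) ring_scheme \<Rightarrow> ('r, 'a, 'y) module_scheme \<Rightarrow> bool" where
  "left_module R M \<longleftrightarrow> ring R \<and> abelian_group M \<and>
     (\<forall>r \<in> carrier R. \<forall>x \<in> carrier M. r \<odot>\<^bsub>M\<^esub> x \<in> carrier M) \<and>
     (\<forall>r \<in> carrier R. \<forall>s \<in> carrier R. \<forall>x \<in> carrier M.
        (r \<oplus>\<^bsub>R\<^esub> s) \<odot>\<^bsub>M\<^esub> x = (r \<odot>\<^bsub>M\<^esub> x) \<oplus>\<^bsub>M\<^esub> (s \<odot>\<^bsub>M\<^esub> x)) \<and>
     (\<forall>r \<in> carrier R. \<forall>x \<in> carrier M. \<forall>y \<in> carrier M.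
        r \<odot>\<^bsub>M\<^esub> (x \<oplus>\<^bsub>M\<^esub> y) = (r \<odot>\<^bsub>M\<^esub> x) \<oplus>\<^bsub>M\<^esub> (r \<odot>\<^bsub>M\<^esub> y)) \<and>
     (\<forall>r \<in> carrier R. \<forall>s \<in> carrier R. \<forall>x \<in> carrier M.
        (r \<otimes>\<^bsub>R\<^esub> s) \<odot>\<^bsub>M\<^esub> x = r \<odot>\<^bsub>M\<^esub> (s \<odot>\<^bsub>M\<^esub> x)) \<and>
     (\<forall>x \<in> carrier M. \<one>\<^bsub>R\<^esub> \<odot>\<^bsub>M\<^esub> x = x)"

datatype 'r module_op = Zero_op | Neg_op | Add_op | Scalar_op 'r

fun module_arity :: "'r module_op \<Rightarrow> nat" where
  "module_arity Zero_op = 0"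
| "module_arity Neg_op = 1"
| "module_arity Add_op = 2"
| "module_arity (Scalar_op r) = 1"

fun module_oper :: "('r, 'a, 'y) module_scheme \<Rightarrow> 'r module_op \<Rightarrow> 'a list \<Rightarrow> 'a" where
  "module_oper M Zero_op xs = \<zero>\<^bsub>M\<^esub>"
| "module_oper M Neg_op xs = \<ominus>\<^bsub>M\<^esub> (xs ! 0)"
| "module_oper M Add_op xs = xs ! 0 \<oplus>\<^bsub>M\<^esub> xs ! 1"
| "module_oper M (Scalar_op r) xs = r \<odot>\<^bsub>M\<^esub> (xs ! 0)"

definition module_algebra ::
  "('r, 'x) ring_scheme \<Rightarrow> ('r, 'a, 'y) module_scheme \<Rightarrow> ('a, 'r module_op) ualg" where
  "module_algebra R M =
     \<lparr> universe = carrier M, index = {Zero_op, Neg_op, Add_op} \<union> Scalar_op ` carrier R,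
       arity = module_arity, oper = module_oper M \<rparr>"

text \<open>Ring elements are taken from the type \<open>'a \<Rightarrow> 'a\<close>. This is no loss of generality:
  any ring acting on \<open>M\<close> can be replaced by its image in the endomorphism ring of \<open>M\<close>
  without changing the operations of the module.\<close>

definition module_for ::
  "('a, 'i) ualg \<Rightarrow> ('a \<Rightarrow> 'a) ring \<Rightarrow> ('a \<Rightarrow> 'a, 'a) module \<Rightarrow> bool" where
  "module_for A R M \<longleftrightarrow> left_module R M \<and> polynomially_equivalent A (module_algebra R M)"

definition abelian_algebra :: "('a, 'i) ualg \<Rightarrow> bool" where
  "abelian_algebra A \<longleftrightarrow> is_algebra A \<and> (\<exists>R M. module_for A R M)"

text \<open>The isomorphism of \<open>A\<close> with the algebra on \<open>L \<times> U\<close> is the bijection \<open>e\<close>. The algebras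
  \<open>L\<close> and \<open>U\<close> may live in the same type as \<open>A\<close>: their universes are nonempty, so both
  embed into that of \<open>A\<close>.\<close>

inductive nilpotent_of_class :: "nat \<Rightarrow> ('a, 'i) ualg \<Rightarrow> bool" where
  abelian: "abelian_algebra A \<Longrightarrow> nilpotent_of_class 1 A"
| extension:
  "\<lbrakk> is_algebra A; is_algebra (L :: ('a, 'i) ualg); same_signature A L; same_signature A U;
     module_for L R M; nilpotent_of_class n U;
     bij_betw e (universe L \<times> universe U) (universe A);
     \<forall>i \<in> index A. \<forall>us \<in> tuples (arity A i) (universe U). fhat i us \<in> universe L;
     \<forall>i \<in> index A. \<forall>ls \<in> tuples (arity A i) (universe L). \<forall>us \<in> tuples (arity A i) (universe U).
       oper A i (map e (zip ls us)) = e (oper L i ls \<oplus>\<^bsub>M\<^esub> fhat i us, oper U i us) \<rbrakk>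
   \<Longrightarrow> nilpotent_of_class (Suc n) A"

definition nilpotent_algebra :: "('a, 'i) ualg \<Rightarrow> bool" where
  "nilpotent_algebra A \<longleftrightarrow> (\<exists>n \<ge> 1. nilpotent_of_class n A)"

section \<open>Circuits over an algebra and their decision problems\<close>

datatype ('a, 'i) alg_gate = Basic 'i | Elem 'a

fun alg_sem :: "('a, 'i) ualg \<Rightarrow> ('a, 'i) alg_gate \<Rightarrow> 'a list \<Rightarrow> 'a" where
  "alg_sem A (Basic i) xs = oper A i xs"
| "alg_sem A (Elem a) xs = a"

fun alg_fan_in_ok :: "('a, 'i) ualg \<Rightarrow> ('a, 'i) alg_gate \<Rightarrow> nat \<Rightarrow> bool" where
  "alg_fan_in_ok A (Basic i) k \<longleftrightarrow> i \<in> index A \<and> k = arity A i"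
| "alg_fan_in_ok A (Elem a) k \<longleftrightarrow> a \<in> universe A \<and> k = 0"

type_synonym ('a, 'i) circuit_pair = "('a, 'i) alg_gate circuit \<times> ('a, 'i) alg_gate circuit"

definition circuit_pairs :: "('a, 'i) ualg \<Rightarrow> ('a, 'i) circuit_pair set" where
  "circuit_pairs A = {(C, C'). wf_circuit (alg_fan_in_ok A) C \<and> wf_circuit (alg_fan_in_ok A) C' \<and>
     inputs C = inputs C'}"

definition CSAT :: "('a, 'i) ualg \<Rightarrow> ('a, 'i) circuit_pair set" where
  "CSAT A = {(C, C') \<in> circuit_pairs A. \<exists>xs \<in> tuples (inputs C) (universe A).
     circuit_value (alg_sem A) C xs = circuit_value (alg_sem A) C' xs}"

definition CEQV :: "('a, 'i) ualg \<Rightarrow> ('a, 'i) circuit_pair set" where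
  "CEQV A = {(C, C') \<in> circuit_pairs A. \<forall>xs \<in> tuples (inputs C) (universe A).
     circuit_value (alg_sem A) C xs = circuit_value (alg_sem A) C' xs}"

text \<open>Instances are encoded as words: one letter for each input gate, then each further gate as its
  label followed by the node numbers of its predecessors in binary (least significant bit first,
  each preceded by a comma), then the output node. For a fixed finite algebra the labels are
  letters of a finite alphabet.\<close>

datatype ('a, 'i) letter =
  Bit bool | Comma | Output_mark | End_mark | Input_mark | Label "('a, 'i) alg_gate"

fun binary :: "nat \<Rightarrow> bool list" where
  "binary n = (if n = 0 then [] else odd n # binary (n div 2))"

declare binary.simps [simp del]

definition encode_circuit :: "('a, 'i) alg_gate circuit \<Rightarrow> ('a, 'i) letter list" where
  "encode_circuit C =
     replicate (inputs C) Input_mark @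
     concat (map (\<lambda>(g, ps). Label g # concat (map (\<lambda>p. Comma # map Bit (binary p)) ps)) (gates C)) @
     Output_mark # map Bit (binary (output_node C))"

definition encode_pair :: "('a, 'i) circuit_pair \<Rightarrow> ('a, 'i) letter list" where
  "encode_pair = (\<lambda>(C, C'). encode_circuit C @ End_mark # encode_circuit C')"

section \<open>Deterministic multi-tape Turing machines\<close>

datatype 's symbol = Blank | Letter 's | Aux nat

datatype move = Move_left | Move_none | Move_right

text \<open>\<open>transition M q ss\<close> is the next state together with, for each tape, the symbol written
  and the head movement, where \<open>ss\<close> lists the symbols currently read.\<close>

record 's tm =
  num_tapes :: nat
  symbols :: "'s symbol set"
  states :: "nat set"
  start_state :: nat
  accept_state :: nat
  reject_state :: nat
  transition :: "nat \<Rightarrow> 's symbol list \<Rightarrow> nat \<times> ('s symbol \<times> move) list"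

definition turing_machine :: "'s tm \<Rightarrow> bool" where
  "turing_machine M \<longleftrightarrow>
     num_tapes M \<ge> 1 \<and> finite (symbols M) \<and> Blank \<in> symbols M \<and> finite (states M) \<and>
     start_state M \<in> states M \<and> accept_state M \<in> states M \<and> reject_state M \<in> states M \<and>
     accept_state M \<noteq> reject_state M \<and>
     (\<forall>q \<in> states M. \<forall>ss \<in> tuples (num_tapes M) (symbols M).
        fst (transition M q ss) \<in> states M \<and>
        length (snd (transition M q ss)) = num_tapes M \<and> fst ` set (snd (transition M q ss)) \<subseteq> symbols M)"

text \<open>A tape is infinite in both directions and comes with the position of its head.\<close>

type_synonym 's tape = "(int \<Rightarrow> 's symbol) \<times> int"

fun move_head :: "move \<Rightarrow> int \<Rightarrow> int" where
  "move_head Move_left h = h - 1"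
| "move_head Move_none h = h"
| "move_head Move_right h = h + 1"

definition read_tape :: "'s tape \<Rightarrow> 's symbol" where
  "read_tape = (\<lambda>(f, h). f h)"

definition update_tape :: "'s symbol \<times> move \<Rightarrow> 's tape \<Rightarrow> 's tape" where
  "update_tape = (\<lambda>(s, d) (f, h). (f(h := s), move_head d h))"

definition tm_step :: "'s tm \<Rightarrow> nat \<times> 's tape list \<Rightarrow> nat \<times> 's tape list" where
  "tm_step M = (\<lambda>(q, ts).
     if q = accept_state M \<or> q = reject_state M then (q, ts)
     else let (q', as) = transition M q (map read_tape ts) in (q', map2 update_tape as ts))"

definition input_tape :: "'s list \<Rightarrow> 's tape" where
  "input_tape w = ((\<lambda>p. if 0 \<le> p \<and> p < int (length w) then Letter (w ! nat p) else Blank), 0)"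

definition tm_init :: "'s tm \<Rightarrow> 's list \<Rightarrow> nat \<times> 's tape list" where
  "tm_init M w = (start_state M, input_tape w # replicate (num_tapes M - 1) ((\<lambda>_. Blank), 0))"

text \<open>\<open>X\<close> is the set of all instances of a decision problem and \<open>Y\<close> the set of its
  yes-instances. The running time is measured in the length of the encoded instance.\<close>

definition decides_within ::
  "'s tm \<Rightarrow> ('x \<Rightarrow> 's list) \<Rightarrow> 'x set \<Rightarrow> 'x set \<Rightarrow> (nat \<Rightarrow> real) \<Rightarrow> bool" where
  "decides_within M enc X Y T \<longleftrightarrow> turing_machine M \<and>
     (\<forall>x \<in> X. Letter ` set (enc x) \<subseteq> symbols M \<and>
        (\<exists>k. real k \<le> T (length (enc x)) \<and>
           fst ((tm_step M ^^ k) (tm_init M (enc x))) =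
             (if x \<in> Y then accept_state M else reject_state M)))"

definition solvable_in_time ::
  "('x \<Rightarrow> 's list) \<Rightarrow> 'x set \<Rightarrow> 'x set \<Rightarrow> (nat \<Rightarrow> real) \<Rightarrow> bool" where
  "solvable_in_time enc X Y g \<longleftrightarrow> (\<exists>M T. decides_within M enc X Y T \<and> T \<in> O(g))"

end

(* Let f be "C = C'" or "C \<noteq> C'" for two circuits C, C' over A, and let x be a tuple satisfying f with
   as few entries different from a fixed element z as possible, say k of them. Switching each of
   these entries between z and its value in x, f becomes the AND of k bits. Circuits over a nilpotent
   algebra can be simulated by CC[m]-circuits of bounded depth and linear size: by the decomposition
   A = L x U, the L-part of the value of a gate is a sum, over all gates h, of endomorphic images of terms that
   depend on the U-parts of the arguments of h only, and a sum in a finite module is determined by the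
   multiplicities of its summands modulo the exponent. So the assumed lower bound makes k
   polylogarithmic in the size of the circuits, and it suffices to evaluate them at all tuples with
   at most k entries different from z. A multi-tape machine whose tapes are used as stacks does this in
   quasipolynomial time. *)

theory Submission
  imports Defs "HOL-Algebra.Multiplicative_Group"
begin

section \<open>Evaluation of circuits\<close>

text \<open>The freedom to choose the modulus \<open>m\<close> shapes the simulation. A
  \<open>MOD_gate\<close> with fewer than \<open>m\<close> wires is a NOR, so for large
  \<open>m\<close> every function of boundedly many computed bits costs constant depth and size. If
  \<open>e\<close> divides \<open>m\<close>, repeating all wires \<open>m div e\<close> times turns
  counting modulo \<open>m\<close> into counting modulo \<open>e\<close>, as sums in a module of
  order \<open>e\<close> require. Both conditions pass to multiples, so a single \<open>m\<close>
  serves all levels of the nilpotency chain. The obstacle to linear size is that one gate may reach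
  another along exponentially many paths; the additive maps along these paths add up to one map. The
  lower bound speaks of families, while each instance yields a single circuit; it is therefore
  applied to the smallest AND circuits of the given depth. A Boolean \<open>b\<close> lets one
  search serve both problems: it looks for a tuple where \<open>(C = C') = b\<close>, and CEQV is
  decided by the failure of the search for \<open>b = False\<close>. The exponent \<open>r\<close>
  is built into the machine, which computes the bound on the support from the length of its
  input.\<close>

abbreviation eval_gates :: "('g \<Rightarrow> 'v list \<Rightarrow> 'v) \<Rightarrow> ('g \<times> nat list) list \<Rightarrow> 'v list \<Rightarrow> 'v list" where
  "eval_gates sem gs xs \<equiv> foldl (\<lambda>vs (g, ps). vs @ [sem g (map (\<lambda>p. vs ! p) ps)]) xs gs"

lemma length_eval_gates [simp]: "length (eval_gates sem gs xs) = length xs + length gs"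
  by (induction gs rule: rev_induct) (auto split: prod.splits)

lemma eval_gates_prefix: "j < length xs \<Longrightarrow> eval_gates sem gs xs ! j = xs ! j"
  by (induction gs rule: rev_induct) (auto split: prod.splits simp: nth_append)

lemma eval_gates_append_nth:
  "j < length xs + length gs \<Longrightarrow> eval_gates sem (gs @ hs) xs ! j = eval_gates sem gs xs ! j"
  using eval_gates_prefix[of j "eval_gates sem gs xs" sem hs] by simp

text \<open>Appending never changes earlier entries, so the recursive evaluation becomes a system of
  equations on the final list of values. Both the simulation and the correctness proof of the
  machine's evaluator use circuits in this form.\<close>

lemma eval_gates_nth:
  assumes "j < length gs" "gs ! j = (g, ps)" "\<forall>p \<in> set ps. p < length xs + j"
  shows "eval_gates sem gs xs ! (length xs + j) = sem g (map (\<lambda>p. eval_gates sem gs xs ! p) ps)"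
proof -
  have gs: "gs = take j gs @ (g, ps) # drop (Suc j) gs"
    using id_take_nth_drop[OF assms(1)] assms(2) by simp
  let ?a = "take j gs" and ?b = "drop (Suc j) gs"
  let ?v = "eval_gates sem ?a xs"
  have la: "length ?a = j" using assms(1) by simp
  have "eval_gates sem gs xs ! (length xs + j) = eval_gates sem (?a @ [(g, ps)]) xs ! (length xs + j)"
    using eval_gates_append_nth[of "length xs + j" xs "?a @ [(g, ps)]" sem ?b] la
    by (subst gs) simp
  also have "\<dots> = sem g (map (\<lambda>p. ?v ! p) ps)"
    using la by (simp add: nth_append)
  also have "map (\<lambda>p. ?v ! p) ps = map (\<lambda>p. eval_gates sem gs xs ! p) ps"
  proof (rule map_cong[OF refl])
    fix p assume "p \<in> set ps"
    then have "p < length xs + length ?a" using assms(3) la by auto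
    from eval_gates_append_nth[OF this, of sem "(g, ps) # ?b"]
    show "?v ! p = eval_gates sem gs xs ! p" by (subst (2) gs) simp
  qed
  finally show ?thesis .
qed

text \<open>Gates that refer to old nodes only do not see each other, so a layer is evaluated in
  parallel.\<close>

lemma eval_gates_layer:
  assumes "\<forall>(g, ps) \<in> set hs. \<forall>p \<in> set ps. p < length vs"
  shows "eval_gates sem hs vs = vs @ map (\<lambda>(g, ps). sem g (map (\<lambda>p. vs ! p) ps)) hs"
  using assms
proof (induction hs rule: rev_induct)
  case (snoc h hs)
  obtain g ps where h: "h = (g, ps)" by (cases h)
  have "eval_gates sem hs vs = vs @ map (\<lambda>(g, ps). sem g (map (\<lambda>p. vs ! p) ps)) hs"
    using snoc by auto
  moreover have "map (\<lambda>p. (vs @ zs) ! p) ps = map (\<lambda>p. vs ! p) ps" for zs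
    using snoc.prems h by (intro map_cong) (auto simp: nth_append)
  ultimately show ?case by (simp add: h del: map_eq_conv)
qed simp

section \<open>Building CC-circuits layer by layer\<close>

definition depth_sem :: "'g \<Rightarrow> nat list \<Rightarrow> nat" where
  "depth_sem = (\<lambda>_ ds. if ds = [] then 0 else Suc (Max (set ds)))"

text \<open>A gate list without an output node, to be extended on the right. The depth bound covers
  every node, so that any node may become an operand of the next layer.\<close>

definition cc_ok :: "nat \<Rightarrow> nat \<Rightarrow> (cc_gate \<times> nat list) list \<Rightarrow> bool" where
  "cc_ok n d gs \<longleftrightarrow>
     (\<forall>j < length gs. case gs ! j of (g, ps) \<Rightarrow> cc_fan_in_ok g (length ps) \<and> (\<forall>p \<in> set ps. p < n + j)) \<and>
     (\<forall>x \<in> set (eval_gates depth_sem gs (replicate n 0)). x \<le> d)"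

text \<open>One node serves all inputs of length \<open>n\<close>; strings of other lengths are
  ignored.\<close>

definition cc_has :: "nat \<Rightarrow> nat \<Rightarrow> (cc_gate \<times> nat list) list \<Rightarrow> (bool list \<Rightarrow> bool) \<Rightarrow> bool" where
  "cc_has n m gs f \<longleftrightarrow>
     (\<exists>j < n + length gs. \<forall>bs. length bs = n \<longrightarrow> eval_gates (cc_sem m) gs bs ! j = f bs)"

lemma cc_has_append: "cc_has n m gs f \<Longrightarrow> cc_has n m (gs @ hs) f"
  unfolding cc_has_def
proof (elim exE conjE)
  fix j assume j: "j < n + length gs" "\<forall>bs. length bs = n \<longrightarrow> eval_gates (cc_sem m) gs bs ! j = f bs"
  show "\<exists>j < n + length (gs @ hs). \<forall>bs. length bs = n \<longrightarrow> eval_gates (cc_sem m) (gs @ hs) bs ! j = f bs"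
    using j eval_gates_append_nth[of j _ gs "cc_sem m" hs] by (intro exI[of _ j]) auto
qed

lemma cc_has_cong: "cc_has n m gs f \<Longrightarrow> (\<And>bs. length bs = n \<Longrightarrow> f bs = g bs) \<Longrightarrow> cc_has n m gs g"
  unfolding cc_has_def by (elim exE conjE, rule exI, rule conjI, assumption) simp

text \<open>The functions under a gate form a list, because a repeated entry is a parallel wire and
  counts in the sum.\<close>

lemma cc_layer_list:
  assumes ok: "cc_ok n d gs" and has: "\<And>fs f. fs \<in> set Fs \<Longrightarrow> f \<in> set fs \<Longrightarrow> cc_has n m gs f"
  shows "\<exists>hs. length hs = length Fs \<and> cc_ok n (Suc d) (gs @ hs) \<and>
     (\<forall>fs \<in> set Fs. cc_has n m (gs @ hs) (\<lambda>bs. (\<Sum>f\<leftarrow>fs. of_bool (f bs) :: nat) mod m = 0))"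
proof -
  define node where "node f = (SOME j. j < n + length gs \<and>
      (\<forall>bs. length bs = n \<longrightarrow> eval_gates (cc_sem m) gs bs ! j = f bs))" for f
  have node: "node f < n + length gs"
      "length bs = n \<Longrightarrow> eval_gates (cc_sem m) gs bs ! node f = f bs"
    if "fs \<in> set Fs" "f \<in> set fs" for fs f bs
  proof -
    have "\<exists>j. j < n + length gs \<and> (\<forall>bs. length bs = n \<longrightarrow> eval_gates (cc_sem m) gs bs ! j = f bs)"
      using has[OF that] unfolding cc_has_def by auto
    from someI_ex[OF this] show "node f < n + length gs"
      "length bs = n \<Longrightarrow> eval_gates (cc_sem m) gs bs ! node f = f bs"
      unfolding node_def[symmetric] by auto
  qed
  define hs where "hs = map (\<lambda>fs. (MOD_gate, map node fs)) Fs"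
  have refs: "\<forall>(g, ps) \<in> set hs. \<forall>p \<in> set ps. p < n + length gs"
    using node(1) by (auto simp: hs_def)
  have "length hs = length Fs" by (simp add: hs_def)
  moreover have "cc_ok n (Suc d) (gs @ hs)"
    unfolding cc_ok_def
  proof (intro conjI allI impI ballI)
    fix j assume j: "j < length (gs @ hs)"
    show "case (gs @ hs) ! j of (g, ps) \<Rightarrow> cc_fan_in_ok g (length ps) \<and> (\<forall>p\<in>set ps. p < n + j)"
    proof (cases "j < length gs")
      case True
      then show ?thesis using ok by (auto simp: cc_ok_def nth_append)
    next
      case False
      then obtain k where k: "j = length gs + k" "k < length Fs"
        using j by (metis \<open>length hs = length Fs\<close> le_Suc_ex length_append linorder_not_less nat_add_left_cancel_less)
      then show ?thesis using node(1)[OF nth_mem] by (fastforce simp: hs_def nth_append)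
    qed
  next
    fix x assume x: "x \<in> set (eval_gates depth_sem (gs @ hs) (replicate n 0))"
    let ?v = "eval_gates depth_sem gs (replicate n 0)"
    have le: "y \<le> d" if "y \<in> set ?v" for y using ok that by (auto simp: cc_ok_def)
    have "eval_gates depth_sem (gs @ hs) (replicate n 0)
        = ?v @ map (\<lambda>(g, ps). depth_sem g (map (\<lambda>p. ?v ! p) ps)) hs"
      unfolding foldl_append by (rule eval_gates_layer) (use refs in simp)
    with x have "x \<in> set ?v \<or> (\<exists>(g, ps) \<in> set hs. x = depth_sem g (map (\<lambda>p. ?v ! p) ps))"
      by auto
    then show "x \<le> Suc d"
    proof
      assume "x \<in> set ?v" then show ?thesis using le by fastforce
    next
      assume "\<exists>(g, ps) \<in> set hs. x = depth_sem g (map (\<lambda>p. ?v ! p) ps)"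
      then obtain g ps where h: "(g, ps) \<in> set hs" "x = depth_sem g (map (\<lambda>p. ?v ! p) ps)" by auto
      have "\<forall>p \<in> set ps. ?v ! p \<le> d"
        using refs h(1) le[OF nth_mem] by fastforce
      then show ?thesis using h(2) by (auto simp: depth_sem_def)
    qed
  qed
  moreover have "cc_has n m (gs @ hs) (\<lambda>bs. (\<Sum>f\<leftarrow>fs. of_bool (f bs) :: nat) mod m = 0)"
    if fs: "fs \<in> set Fs" for fs
  proof -
    obtain k where k: "k < length Fs" "fs = Fs ! k" using fs by (metis in_set_conv_nth)
    show ?thesis unfolding cc_has_def
    proof (intro exI[of _ "n + length gs + k"] conjI allI impI)
      show "n + length gs + k < n + length (gs @ hs)" using k by (simp add: hs_def)
      fix bs :: "bool list" assume n: "length bs = n"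
      let ?v = "eval_gates (cc_sem m) gs bs"
      have "eval_gates (cc_sem m) (gs @ hs) bs
        = ?v @ map (\<lambda>(g, ps). cc_sem m g (map (\<lambda>p. ?v ! p) ps)) hs"
        unfolding foldl_append by (rule eval_gates_layer) (use refs n in simp)
      then have "eval_gates (cc_sem m) (gs @ hs) bs ! (n + length gs + k)
         = cc_sem m MOD_gate (map (\<lambda>p. ?v ! p) (map node fs))"
        using k n by (simp add: nth_append hs_def del: cc_sem.simps map_map)
      also have "map (\<lambda>p. ?v ! p) (map node fs) = map (\<lambda>f. f bs) fs"
        using node(2)[OF fs _ n] by simp
      finally show "eval_gates (cc_sem m) (gs @ hs) bs ! (n + length gs + k)
          = ((\<Sum>f\<leftarrow>fs. of_bool (f bs) :: nat) mod m = 0)"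
        by (simp add: comp_def)
    qed
  qed
  ultimately show ?thesis by blast
qed

text \<open>From lists to a finite set of functions: one gate for each member of \<open>G\<close>,
  which yields the size bound \<open>card G\<close>.\<close>

lemma cc_layer:
  assumes ok: "cc_ok n d gs" and fin: "finite G"
    and G: "\<And>g. g \<in> G \<Longrightarrow> \<exists>fs. (\<forall>f \<in> set fs. cc_has n m gs f) \<and>
       (\<forall>bs. length bs = n \<longrightarrow> g bs = ((\<Sum>f\<leftarrow>fs. of_bool (f bs) :: nat) mod m = 0))"
  shows "\<exists>hs. length hs \<le> card G \<and> cc_ok n (Suc d) (gs @ hs) \<and> (\<forall>g \<in> G. cc_has n m (gs @ hs) g)"
proof -
  obtain gl where gl: "set gl = G" "length gl = card G"
    using finite_distinct_list[OF fin] distinct_card by metis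
  obtain F where F: "\<And>g. g \<in> G \<Longrightarrow> (\<forall>f \<in> set (F g). cc_has n m gs f) \<and>
       (\<forall>bs. length bs = n \<longrightarrow> g bs = ((\<Sum>f\<leftarrow>F g. of_bool (f bs) :: nat) mod m = 0))"
    using G by metis
  obtain hs where hs: "length hs = length (map F gl)" "cc_ok n (Suc d) (gs @ hs)"
     "\<forall>fs \<in> set (map F gl). cc_has n m (gs @ hs) (\<lambda>bs. (\<Sum>f\<leftarrow>fs. of_bool (f bs) :: nat) mod m = 0)"
    using cc_layer_list[OF ok, of "map F gl" m] F gl(1) by auto
  show ?thesis
  proof (intro exI[of _ hs] conjI ballI)
    show "length hs \<le> card G" using hs(1) gl(2) by simp
    show "cc_ok n (Suc d) (gs @ hs)" by fact
    fix g assume g: "g \<in> G"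
    show "cc_has n m (gs @ hs) g"
      by (rule cc_has_cong[of n m _ "\<lambda>bs. (\<Sum>f\<leftarrow>F g. of_bool (f bs) :: nat) mod m = 0"])
        (use hs(3) F[OF g] gl(1) g in auto)
  qed
qed

section \<open>Functions of boundedly many bits\<close>

lemma sum_list_of_bool_eq_0: "(\<Sum>x\<leftarrow>xs. of_bool (P x) :: nat) = 0 \<longleftrightarrow> (\<forall>x \<in> set xs. \<not> P x)"
  by (induction xs) auto

lemma sum_list_of_bool_le: "(\<Sum>x\<leftarrow>xs. of_bool (P x) :: nat) \<le> length xs"
  by (induction xs) (auto intro: le_SucI)

text \<open>Fewer than \<open>m\<close> bits cannot sum up to a positive multiple of
  \<open>m\<close>, so the gate outputs 1 only if all of them are 0.\<close>

lemma mod_gate_nor: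
  assumes "length fs < m"
  shows "(\<Sum>f\<leftarrow>fs. of_bool (f bs) :: nat) mod m = 0 \<longleftrightarrow> (\<forall>f \<in> set fs. \<not> f bs)"
  using assms sum_list_of_bool_le[of "\<lambda>f. f bs" fs] by (simp add: sum_list_of_bool_eq_0)

text \<open>Dependence is stated semantically, so no Boolean formula has to be exhibited; the normal
  form is recovered from the patterns that occur.\<close>

definition determined_by :: "nat \<Rightarrow> (bool list \<Rightarrow> 'v) set \<Rightarrow> (bool list \<Rightarrow> 'w) \<Rightarrow> bool" where
  "determined_by n F g \<longleftrightarrow>
     (\<forall>bs bs'. length bs = n \<longrightarrow> length bs' = n \<longrightarrow> (\<forall>f \<in> F. f bs = f bs') \<longrightarrow> g bs = g bs')"

text \<open>A Boolean function of at most \<open>k\<close> functions computed already is added in disjunctive normal form.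
  Since \<open>m > 2 ^ k\<close>, a single \<open>MOD\<^sub>m\<close>-gate is a NOR of all conjunctions, and likewise of all literals.\<close>

lemma cc_add_determined:
  assumes ok: "cc_ok n d gs" and fin: "finite G" and m: "2 ^ k < m"
    and G: "\<And>g. g \<in> G \<Longrightarrow>
      \<exists>fs. length fs \<le> k \<and> (\<forall>f \<in> set fs. cc_has n m gs f) \<and> determined_by n (set fs) g"
  shows "\<exists>hs. length hs \<le> (k + 2 ^ Suc k + 2) * card G \<and> cc_ok n (d + 4) (gs @ hs) \<and>
     (\<forall>g \<in> G. cc_has n m (gs @ hs) g)"
proof -
  obtain F where F: "\<And>g. g \<in> G \<Longrightarrow> length (F g) \<le> k"
     "\<And>g f. g \<in> G \<Longrightarrow> f \<in> set (F g) \<Longrightarrow> cc_has n m gs f"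
     "\<And>g. g \<in> G \<Longrightarrow> determined_by n (set (F g)) g"
    using G by metis
  have "k < 2 ^ k" "1 \<le> (2 :: nat) ^ k" by simp_all
  then have km: "k < m" "1 < m" using m by linarith+
  \<comment> \<open>The accepted patterns: \<open>g\<close> factors through the values of
    \<open>F g\<close> because it is determined by them.\<close>
  define pat where "pat g = {\<alpha>. \<exists>bs. length bs = n \<and> g bs \<and> \<alpha> = map (\<lambda>f. f bs) (F g)}" for g
  have pat: "g bs \<longleftrightarrow> map (\<lambda>f. f bs) (F g) \<in> pat g" if "g \<in> G" "length bs = n" for g bs
    using F(3)[OF that(1)] that(2) unfolding pat_def determined_by_def mem_Collect_eq map_eq_conv by blast
  have pat_sub: "pat g \<subseteq> {\<alpha>. set \<alpha> \<subseteq> UNIV \<and> length \<alpha> = length (F g)}" for g by (auto simp: pat_def)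
  have fin_pat: "finite (pat g)" for g
    by (rule finite_subset[OF pat_sub]) (rule finite_lists_length_eq, simp)
  have card_pat: "card (pat g) \<le> 2 ^ k" if "g \<in> G" for g
  proof -
    have "card (pat g) \<le> card {\<alpha> :: bool list. set \<alpha> \<subseteq> UNIV \<and> length \<alpha> = length (F g)}"
      by (rule card_mono[OF _ pat_sub]) (rule finite_lists_length_eq, simp)
    also have "\<dots> = 2 ^ length (F g)" by (subst card_lists_length_eq) auto
    also have "\<dots> \<le> 2 ^ k" using F(1)[OF that] by simp
    finally show ?thesis .
  qed
  \<comment> \<open>A conjunction is the NOR of the negations of its literals. So layer 1 provides
    negations, layer 2 tests for one pattern, layer 3 is a NOR over the accepted patterns, which is
    the negation of \<open>g\<close>, and layer 4 negates once more.\<close>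
  define G1 where "G1 = (\<Union>g\<in>G. (\<lambda>f bs. \<not> f bs) ` set (F g))"
  have c1: "card G1 \<le> k * card G"
  proof -
    have "card G1 \<le> (\<Sum>g\<in>G. card ((\<lambda>f bs. \<not> f bs) ` set (F g)))"
      unfolding G1_def by (rule card_UN_le[OF fin])
    also have "\<dots> \<le> (\<Sum>g\<in>G. k)"
      by (intro sum_mono order_trans[OF card_image_le] order_trans[OF card_length]) (auto simp: F(1))
    finally show ?thesis by (simp add: mult.commute)
  qed
  have "\<exists>hs. length hs \<le> card G1 \<and> cc_ok n (Suc d) (gs @ hs) \<and> (\<forall>g \<in> G1. cc_has n m (gs @ hs) g)"
  proof (rule cc_layer[OF ok])
    show "finite G1" using fin by (auto simp: G1_def)
    fix h assume "h \<in> G1"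
    then obtain g f where gf: "g \<in> G" "f \<in> set (F g)" "h = (\<lambda>bs. \<not> f bs)" by (auto simp: G1_def)
    show "\<exists>fs. (\<forall>f\<in>set fs. cc_has n m gs f) \<and>
              (\<forall>bs. length bs = n \<longrightarrow> h bs = ((\<Sum>f\<leftarrow>fs. of_bool (f bs) :: nat) mod m = 0))"
      using gf F(2) km by (intro exI[of _ "[f]"]) auto
  qed
  then obtain h1 where h1: "length h1 \<le> card G1" "cc_ok n (Suc d) (gs @ h1)"
     "\<And>g. g \<in> G1 \<Longrightarrow> cc_has n m (gs @ h1) g" by auto
  define G2 where "G2 = (\<Union>g\<in>G. (\<lambda>\<alpha> bs. map (\<lambda>f. f bs) (F g) = \<alpha>) ` pat g)"
  have c2: "card G2 \<le> 2 ^ k * card G"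
  proof -
    have "card G2 \<le> (\<Sum>g\<in>G. card ((\<lambda>\<alpha> bs. map (\<lambda>f. f bs) (F g) = \<alpha>) ` pat g))"
      unfolding G2_def by (rule card_UN_le[OF fin])
    also have "\<dots> \<le> (\<Sum>g\<in>G. 2 ^ k)"
      by (intro sum_mono order_trans[OF card_image_le]) (auto simp: card_pat fin_pat)
    finally show ?thesis by (simp add: mult.commute)
  qed
  have "\<exists>hs. length hs \<le> card G2 \<and> cc_ok n (Suc (Suc d)) ((gs @ h1) @ hs) \<and>
     (\<forall>g \<in> G2. cc_has n m ((gs @ h1) @ hs) g)"
  proof (rule cc_layer[OF h1(2)])
    show "finite G2" using fin fin_pat by (auto simp: G2_def)
    fix h assume "h \<in> G2"
    then obtain g \<alpha> where ga: "g \<in> G" "\<alpha> \<in> pat g" "h = (\<lambda>bs. map (\<lambda>f. f bs) (F g) = \<alpha>)" by (auto simp: G2_def)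
    have len: "length \<alpha> = length (F g)" using ga(2) by (auto simp: pat_def)
    \<comment> \<open>Where the pattern has a 1, the negated function is wired; the NOR of these
      wires is 1 exactly on the pattern.\<close>
    define fs where "fs = map (\<lambda>i. if \<alpha> ! i then (\<lambda>bs. \<not> (F g ! i) bs) else F g ! i) [0..<length (F g)]"
    have "cc_has n m (gs @ h1) f" if "f \<in> set fs" for f
      using that ga(1) F(2)[OF ga(1)] h1(3) by (fastforce simp: fs_def G1_def intro: cc_has_append split: if_splits)
    moreover have "h bs = ((\<Sum>f\<leftarrow>fs. of_bool (f bs) :: nat) mod m = 0)" for bs
    proof -
      have "length fs < m" using F(1)[OF ga(1)] km by (simp add: fs_def)
      then have "((\<Sum>f\<leftarrow>fs. of_bool (f bs) :: nat) mod m = 0) \<longleftrightarrow> (\<forall>f \<in> set fs. \<not> f bs)"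
        by (rule mod_gate_nor)
      also have "\<dots> \<longleftrightarrow> (\<forall>i < length (F g). (F g ! i) bs = \<alpha> ! i)"
        by (auto simp: fs_def)
      also have "\<dots> \<longleftrightarrow> h bs" using len by (auto simp: ga(3) list_eq_iff_nth_eq)
      finally show ?thesis by simp
    qed
    ultimately show "\<exists>fs. (\<forall>f\<in>set fs. cc_has n m (gs @ h1) f) \<and>
              (\<forall>bs. length bs = n \<longrightarrow> h bs = ((\<Sum>f\<leftarrow>fs. of_bool (f bs) :: nat) mod m = 0))"
      by (intro exI[of _ fs] conjI) simp_all
  qed
  then obtain h2 where h2: "length h2 \<le> card G2" "cc_ok n (Suc (Suc d)) (gs @ h1 @ h2)"
     "\<And>g. g \<in> G2 \<Longrightarrow> cc_has n m (gs @ h1 @ h2) g" by auto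
  define G3 where "G3 = (\<lambda>g bs. \<not> g bs) ` G"
  have "\<exists>hs. length hs \<le> card G3 \<and> cc_ok n (Suc (Suc (Suc d))) ((gs @ h1 @ h2) @ hs) \<and>
     (\<forall>g \<in> G3. cc_has n m ((gs @ h1 @ h2) @ hs) g)"
  proof (rule cc_layer[OF h2(2)])
    show "finite G3" using fin by (auto simp: G3_def)
    fix h assume "h \<in> G3"
    then obtain g where g: "g \<in> G" "h = (\<lambda>bs. \<not> g bs)" by (auto simp: G3_def)
    obtain al where al: "set al = pat g" "distinct al" using finite_distinct_list[OF fin_pat] by metis
    define fs where "fs = map (\<lambda>\<alpha> bs. map (\<lambda>f. f bs) (F g) = \<alpha>) al"
    have lal: "length fs < m" using card_pat[OF g(1)] m al distinct_card[OF al(2)] by (simp add: fs_def)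
    have "cc_has n m (gs @ h1 @ h2) f" if "f \<in> set fs" for f
      using that h2(3) g(1) al(1) by (auto simp: fs_def G2_def)
    moreover have "h bs = ((\<Sum>f\<leftarrow>fs. of_bool (f bs) :: nat) mod m = 0)" if "length bs = n" for bs
      unfolding mod_gate_nor[OF lal] using pat[OF g(1) that] by (auto simp: fs_def al(1) g(2))
    ultimately show "\<exists>fs. (\<forall>f\<in>set fs. cc_has n m (gs @ h1 @ h2) f) \<and>
              (\<forall>bs. length bs = n \<longrightarrow> h bs = ((\<Sum>f\<leftarrow>fs. of_bool (f bs) :: nat) mod m = 0))"
      by (intro exI[of _ fs] conjI) simp_all
  qed
  then obtain h3 where h3: "length h3 \<le> card G3" "cc_ok n (Suc (Suc (Suc d))) (gs @ h1 @ h2 @ h3)"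
     "\<And>g. g \<in> G3 \<Longrightarrow> cc_has n m (gs @ h1 @ h2 @ h3) g" by auto
  have "\<exists>hs. length hs \<le> card G \<and> cc_ok n (Suc (Suc (Suc (Suc d)))) ((gs @ h1 @ h2 @ h3) @ hs) \<and>
     (\<forall>g \<in> G. cc_has n m ((gs @ h1 @ h2 @ h3) @ hs) g)"
  proof (rule cc_layer[OF h3(2) fin])
    fix g assume g: "g \<in> G"
    show "\<exists>fs. (\<forall>f\<in>set fs. cc_has n m (gs @ h1 @ h2 @ h3) f) \<and>
              (\<forall>bs. length bs = n \<longrightarrow> g bs = ((\<Sum>f\<leftarrow>fs. of_bool (f bs) :: nat) mod m = 0))"
      using g h3(3) km by (intro exI[of _ "[\<lambda>bs. \<not> g bs]"]) (auto simp: G3_def image_iff)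
  qed
  then obtain h4 where h4: "length h4 \<le> card G" "cc_ok n (d + 4) (gs @ h1 @ h2 @ h3 @ h4)"
     "\<And>g. g \<in> G \<Longrightarrow> cc_has n m (gs @ h1 @ h2 @ h3 @ h4) g" by (auto simp: numeral_eq_Suc)
  have c3: "card G3 \<le> card G" unfolding G3_def by (rule card_image_le[OF fin])
  have "length (h1 @ h2 @ h3 @ h4) \<le> k * card G + 2 ^ k * card G + card G + card G"
    using h1(1) h2(1) h3(1) h4(1) c1 c2 c3 by simp
  also have "\<dots> \<le> (k + 2 ^ Suc k + 2) * card G" by (simp add: algebra_simps)
  finally show ?thesis using h4 by blast
qed

text \<open>One-hot coding: each value in \<open>V\<close> has a node testing for it. As
  \<open>\<phi>\<close> stays in \<open>V\<close>, exactly one of these tests succeeds at every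
  input of length \<open>n\<close>.\<close>

definition available :: "nat \<Rightarrow> nat \<Rightarrow> (cc_gate \<times> nat list) list \<Rightarrow> 'v set \<Rightarrow> (bool list \<Rightarrow> 'v) \<Rightarrow> bool" where
  "available n m gs V \<phi> \<longleftrightarrow> (\<forall>a \<in> V. cc_has n m gs (\<lambda>bs. \<phi> bs = a)) \<and> (\<forall>bs. length bs = n \<longrightarrow> \<phi> bs \<in> V)"

lemma available_append: "available n m gs V \<phi> \<Longrightarrow> available n m (gs @ hs) V \<phi>"
  unfolding available_def by (meson cc_has_append)

lemma length_concat_le: "(\<And>xs. xs \<in> set xss \<Longrightarrow> length xs \<le> v) \<Longrightarrow> length (concat xss) \<le> length xss * v"
  by (induction xss) (auto simp: add_le_mono)

text \<open>A function into a set of at most \<open>v\<close> values is available as at most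
  \<open>v\<close> bits, so \<open>k\<close> such functions amount to at most \<open>k * v\<close>
  bits, and each indicator of a new function is a Boolean function of these.\<close>

lemma cc_add_determined_values:
  fixes \<psi> :: "'j \<Rightarrow> bool list \<Rightarrow> 'w"
  assumes ok: "cc_ok n d gs" and fin: "finite J" "finite W" and m: "2 ^ (k * v) < m"
    and J: "\<And>j. j \<in> J \<Longrightarrow> \<exists>\<phi>s :: ('v set \<times> (bool list \<Rightarrow> 'v)) list. length \<phi>s \<le> k \<and>
      (\<forall>(V, \<phi>) \<in> set \<phi>s. finite V \<and> card V \<le> v \<and> available n m gs V \<phi>) \<and>
      determined_by n (snd ` set \<phi>s) (\<psi> j)"
    and W: "\<And>j bs. j \<in> J \<Longrightarrow> length bs = n \<Longrightarrow> \<psi> j bs \<in> W"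
  shows "\<exists>hs. length hs \<le> (k * v + 2 ^ Suc (k * v) + 2) * card W * card J \<and>
     cc_ok n (d + 4) (gs @ hs) \<and> (\<forall>j \<in> J. available n m (gs @ hs) W (\<psi> j))"
proof -
  define G where "G = (\<lambda>(j, w) bs. \<psi> j bs = w) ` (J \<times> W)"
  have "\<exists>hs. length hs \<le> (k * v + 2 ^ Suc (k * v) + 2) * card G \<and>
      cc_ok n (d + 4) (gs @ hs) \<and> (\<forall>g \<in> G. cc_has n m (gs @ hs) g)"
  proof (rule cc_add_determined[OF ok _ m])
    show "finite G" using fin by (auto simp: G_def)
    fix g assume "g \<in> G"
    then obtain j w where g: "j \<in> J" "w \<in> W" "g = (\<lambda>bs. \<psi> j bs = w)" by (auto simp: G_def)
    obtain \<phi>s :: "('v set \<times> (bool list \<Rightarrow> 'v)) list" where p: "length \<phi>s \<le> k" "determined_by n (snd ` set \<phi>s) (\<psi> j)"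
      "\<And>V \<phi>. (V, \<phi>) \<in> set \<phi>s \<Longrightarrow> finite V \<and> card V \<le> v \<and> available n m gs V \<phi>"
      using J[OF g(1)] by (auto simp: Ball_def)
    obtain vl :: "'v set \<Rightarrow> 'v list" where vl: "\<And>V. finite V \<Longrightarrow> set (vl V) = V \<and> length (vl V) = card V"
      using finite_distinct_list distinct_card by metis
    define fs where "fs = concat (map (\<lambda>(V, \<phi>). map (\<lambda>a bs. \<phi> bs = a) (vl V)) \<phi>s)"
    have "length fs \<le> length (map (\<lambda>(V, \<phi>). map (\<lambda>a bs. \<phi> bs = a) (vl V)) \<phi>s) * v"
      unfolding fs_def
    proof (rule length_concat_le)
      fix xs assume "xs \<in> set (map (\<lambda>(V, \<phi>). map (\<lambda>a bs. \<phi> bs = a) (vl V)) \<phi>s)"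
      then obtain V \<phi> where "(V, \<phi>) \<in> set \<phi>s" "xs = map (\<lambda>a bs. \<phi> bs = a) (vl V)" by auto
      then show "length xs \<le> v" using p(3) vl by simp
    qed
    also have "\<dots> \<le> k * v" using p(1) by simp
    finally have "length fs \<le> k * v" .
    moreover have "\<forall>f\<in>set fs. cc_has n m gs f"
    proof
      fix f assume "f \<in> set fs"
      then obtain V \<phi> a where f: "(V, \<phi>) \<in> set \<phi>s" "a \<in> set (vl V)" "f = (\<lambda>bs. \<phi> bs = a)"
        by (auto simp: fs_def)
      then show "cc_has n m gs f" using p(3)[OF f(1)] vl[of V] by (auto simp: available_def)
    qed
    moreover have "determined_by n (set fs) g"
      unfolding determined_by_def
    proof (intro allI impI)
      fix bs bs' assume b: "length bs = n" "length bs' = n" "\<forall>f\<in>set fs. f bs = f bs'"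
      have "\<phi> bs = \<phi> bs'" if \<phi>: "\<phi> \<in> snd ` set \<phi>s" for \<phi>
      proof -
        obtain V where V: "(V, \<phi>) \<in> set \<phi>s" using \<phi> by auto
        \<comment> \<open>The test for the value \<open>\<phi> bs\<close> is among the functions and
          succeeds at \<open>bs\<close>, hence also at \<open>bs'\<close>.\<close>
        have "\<phi> bs \<in> set (vl V)" using p(3)[OF V] b(1) vl[of V] by (auto simp: available_def)
        then have "(\<lambda>bs'. \<phi> bs' = \<phi> bs) \<in> set fs" using V by (force simp: fs_def)
        from b(3)[rule_format, OF this] show ?thesis by simp
      qed
      with p(2) b(1,2) have "\<psi> j bs = \<psi> j bs'" unfolding determined_by_def by blast
      then show "g bs = g bs'" by (simp add: g(3))
    qed
    ultimately show "\<exists>fs. length fs \<le> k * v \<and> (\<forall>f\<in>set fs. cc_has n m gs f) \<and> determined_by n (set fs) g"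
      by (intro exI[of _ fs] conjI)
  qed
  then obtain hs where hs: "length hs \<le> (k * v + 2 ^ Suc (k * v) + 2) * card G"
      "cc_ok n (d + 4) (gs @ hs)" "\<forall>g \<in> G. cc_has n m (gs @ hs) g" by auto
  have "card G \<le> card W * card J"
    unfolding G_def using card_image_le[of "J \<times> W" "\<lambda>(j, w) bs. \<psi> j bs = w"] fin
    by (simp add: card_cartesian_product mult.commute)
  then have "length hs \<le> (k * v + 2 ^ Suc (k * v) + 2) * (card W * card J)"
    by (rule order_trans[OF hs(1) mult_le_mono2])
  moreover have "available n m (gs @ hs) W (\<psi> j)" if "j \<in> J" for j
    using hs(3) W that unfolding available_def G_def by fast
  ultimately show ?thesis using hs(2) by (intro exI[of _ hs]) (simp add: algebra_simps)
qed

section \<open>Polynomial operations of modules\<close>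

text \<open>Scalar multiplications, negation, the identity and the zero map are of this kind, and so
  are compositions and pointwise sums of such maps. They take the place of ring elements from here
  on.\<close>

definition add_map :: "('r, 'a, 'y) module_scheme \<Rightarrow> ('a \<Rightarrow> 'a) \<Rightarrow> bool" where
  "add_map M r \<longleftrightarrow> r \<in> carrier M \<rightarrow> carrier M \<and>
     (\<forall>x \<in> carrier M. \<forall>y \<in> carrier M. r (x \<oplus>\<^bsub>M\<^esub> y) = r x \<oplus>\<^bsub>M\<^esub> r y)"

lemma add_mapD:
  assumes "add_map M r"
  shows "x \<in> carrier M \<Longrightarrow> r x \<in> carrier M"
    and "x \<in> carrier M \<Longrightarrow> y \<in> carrier M \<Longrightarrow> r (x \<oplus>\<^bsub>M\<^esub> y) = r x \<oplus>\<^bsub>M\<^esub> r y"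
  using assms by (auto simp: add_map_def)

lemma add_map_comp: "add_map M r \<Longrightarrow> add_map M s \<Longrightarrow> add_map M (\<lambda>x. r (s x))"
  by (auto simp: add_map_def Pi_iff)

lemma add_map_zero:
  assumes "abelian_group M" "add_map M r"
  shows "r \<zero>\<^bsub>M\<^esub> = \<zero>\<^bsub>M\<^esub>"
proof -
  interpret abelian_group M by fact
  have r: "r \<zero>\<^bsub>M\<^esub> \<in> carrier M" using add_mapD(1)[OF assms(2)] by simp
  have "r \<zero>\<^bsub>M\<^esub> \<oplus>\<^bsub>M\<^esub> r \<zero>\<^bsub>M\<^esub> = r \<zero>\<^bsub>M\<^esub>"
    using add_mapD(2)[OF assms(2), of "\<zero>\<^bsub>M\<^esub>" "\<zero>\<^bsub>M\<^esub>"] by simp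
  then show ?thesis using r by (metis add.r_cancel_one')
qed

lemma add_map_finsum:
  assumes M: "abelian_group M" and r: "add_map M r" and "finite T" and f: "f \<in> T \<rightarrow> carrier M"
  shows "r (finsum M f T) = finsum M (\<lambda>t. r (f t)) T"
proof -
  interpret abelian_group M by fact
  show ?thesis using \<open>finite T\<close> f
  proof (induction T rule: finite_induct)
    case empty
    then show ?case using add_map_zero[OF M r] by simp
  next
    case (insert t T)
    have f: "f \<in> T \<rightarrow> carrier M" "f t \<in> carrier M" using insert.prems by auto
    have rf: "(\<lambda>t. r (f t)) \<in> T \<rightarrow> carrier M" "r (f t) \<in> carrier M"
      using f add_mapD(1)[OF r] by auto
    have "r (finsum M f (insert t T)) = r (f t \<oplus>\<^bsub>M\<^esub> finsum M f T)"
      using insert.hyps f by (simp add: finsum_insert)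
    also have "\<dots> = r (f t) \<oplus>\<^bsub>M\<^esub> r (finsum M f T)"
      using f by (intro add_mapD(2)[OF r]) auto
    also have "r (finsum M f T) = finsum M (\<lambda>t. r (f t)) T" using insert.IH f by simp
    also have "r (f t) \<oplus>\<^bsub>M\<^esub> \<dots> = finsum M (\<lambda>t. r (f t)) (insert t T)"
      using finsum_insert[OF insert.hyps rf] by simp
    finally show ?case .
  qed
qed

text \<open>The normal form of a polynomial operation of a module: a constant plus one additive map
  for each argument.\<close>

definition affine :: "('r, 'a, 'y) module_scheme \<Rightarrow> nat \<Rightarrow> ('a list \<Rightarrow> 'a) \<Rightarrow> bool" where
  "affine M k p \<longleftrightarrow> (\<exists>c \<in> carrier M. \<exists>r. (\<forall>t < k. add_map M (r t)) \<and>
     (\<forall>xs \<in> tuples k (carrier M). p xs = c \<oplus>\<^bsub>M\<^esub> (\<Oplus>\<^bsub>M\<^esub>t \<in> {..<k}. r t (xs ! t))))"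

lemma tuples_nth: "xs \<in> tuples k S \<Longrightarrow> t < k \<Longrightarrow> xs ! t \<in> S"
  by (auto simp: tuples_def)

lemma affine_add_map:
  assumes M: "abelian_group M" and p: "affine M k p" and h: "add_map M h"
  shows "affine M k (\<lambda>xs. h (p xs))"
proof -
  interpret abelian_group M by fact
  obtain c r where c: "c \<in> carrier M" and r: "\<And>t. t < k \<Longrightarrow> add_map M (r t)"
    and p: "\<And>xs. xs \<in> tuples k (carrier M) \<Longrightarrow> p xs = c \<oplus>\<^bsub>M\<^esub> (\<Oplus>\<^bsub>M\<^esub>t \<in> {..<k}. r t (xs ! t))"
    using p unfolding affine_def by auto
  have "h (p xs) = h c \<oplus>\<^bsub>M\<^esub> (\<Oplus>\<^bsub>M\<^esub>t \<in> {..<k}. h (r t (xs ! t)))"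
    if xs: "xs \<in> tuples k (carrier M)" for xs
  proof -
    have f: "(\<lambda>t. r t (xs ! t)) \<in> {..<k} \<rightarrow> carrier M"
      using xs r by (auto intro: add_mapD tuples_nth)
    have "h (p xs) = h c \<oplus>\<^bsub>M\<^esub> h (\<Oplus>\<^bsub>M\<^esub>t \<in> {..<k}. r t (xs ! t))"
      unfolding p[OF xs] using c f by (intro add_mapD(2)[OF h]) auto
    then show ?thesis using add_map_finsum[OF M h _ f] by simp
  qed
  then show ?thesis unfolding affine_def
    using add_map_comp[OF h r] add_mapD(1)[OF h c]
    by (intro bexI[of _ "h c"] exI[of _ "\<lambda>t x. h (r t x)"]) auto
qed

lemma affine_add:
  assumes M: "abelian_group M" and p: "affine M k p" and q: "affine M k q"
  shows "affine M k (\<lambda>xs. p xs \<oplus>\<^bsub>M\<^esub> q xs)"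
proof -
  interpret abelian_group M by fact
  obtain c r where c: "c \<in> carrier M" and r: "\<And>t. t < k \<Longrightarrow> add_map M (r t)"
    and p: "\<And>xs. xs \<in> tuples k (carrier M) \<Longrightarrow> p xs = c \<oplus>\<^bsub>M\<^esub> (\<Oplus>\<^bsub>M\<^esub>t \<in> {..<k}. r t (xs ! t))"
    using p unfolding affine_def by auto
  obtain c' r' where c': "c' \<in> carrier M" and r': "\<And>t. t < k \<Longrightarrow> add_map M (r' t)"
    and q: "\<And>xs. xs \<in> tuples k (carrier M) \<Longrightarrow> q xs = c' \<oplus>\<^bsub>M\<^esub> (\<Oplus>\<^bsub>M\<^esub>t \<in> {..<k}. r' t (xs ! t))"
    using q unfolding affine_def by auto
  have "add_map M (\<lambda>x. r t x \<oplus>\<^bsub>M\<^esub> r' t x)" if "t < k" for t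
    using add_mapD[OF r[OF that]] add_mapD[OF r'[OF that]]
    by (auto simp: add_map_def a_ac)
  moreover have "p xs \<oplus>\<^bsub>M\<^esub> q xs = (c \<oplus>\<^bsub>M\<^esub> c') \<oplus>\<^bsub>M\<^esub> (\<Oplus>\<^bsub>M\<^esub>t \<in> {..<k}. r t (xs ! t) \<oplus>\<^bsub>M\<^esub> r' t (xs ! t))"
    if xs: "xs \<in> tuples k (carrier M)" for xs
  proof -
    have f: "(\<lambda>t. r t (xs ! t)) \<in> {..<k} \<rightarrow> carrier M" "(\<lambda>t. r' t (xs ! t)) \<in> {..<k} \<rightarrow> carrier M"
      using xs r r' by (auto intro: add_mapD tuples_nth)
    show ?thesis unfolding p[OF xs] q[OF xs] finsum_addf[OF f]
      using c c' finsum_closed[OF f(1)] finsum_closed[OF f(2)] by (simp add: a_ac)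
  qed
  ultimately show ?thesis unfolding affine_def using c c'
    by (intro bexI[of _ "c \<oplus>\<^bsub>M\<^esub> c'"] exI[of _ "\<lambda>t x. r t x \<oplus>\<^bsub>M\<^esub> r' t x"]) auto
qed

lemma affine_const:
  assumes M: "abelian_group M" and c: "c \<in> carrier M"
  shows "affine M k (\<lambda>xs. c)"
proof -
  interpret abelian_group M by fact
  show ?thesis unfolding affine_def using c
    by (intro bexI[of _ c] exI[of _ "\<lambda>t x. \<zero>\<^bsub>M\<^esub>"]) (auto simp: add_map_def)
qed

lemma affine_proj:
  assumes M: "abelian_group M" and j: "j < k"
  shows "affine M k (\<lambda>xs. xs ! j)"
proof -
  interpret abelian_group M by fact
  have "xs ! j = \<zero>\<^bsub>M\<^esub> \<oplus>\<^bsub>M\<^esub> (\<Oplus>\<^bsub>M\<^esub>t \<in> {..<k}. if j = t then xs ! t else \<zero>\<^bsub>M\<^esub>)"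
    if xs: "xs \<in> tuples k (carrier M)" for xs
    using finsum_singleton[of j "{..<k}" "\<lambda>t. xs ! t"] j xs tuples_nth[OF xs]
    by (auto simp: Pi_iff)
  then show ?thesis unfolding affine_def
    by (intro bexI[of _ "\<zero>\<^bsub>M\<^esub>"] exI[of _ "\<lambda>t x. if j = t then x else \<zero>\<^bsub>M\<^esub>"])
      (auto simp: add_map_def)
qed

text \<open>Affine operations contain the projections and constants and are closed under sums and
  under additive maps, which covers all module operations.\<close>

lemma module_polynomial_affine:
  assumes M: "left_module R M" and p: "p \<in> compositions (module_algebra R M) k"
  shows "affine M k p"
proof -
  have G: "abelian_group M" using M by (simp add: left_module_def)
  interpret abelian_group M by fact
  have U: "universe (module_algebra R M) = carrier M" by (simp add: module_algebra_def)
  show ?thesis using p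
  proof (induction rule: compositions.induct)
    case (proj j)
    then show ?case by (rule affine_proj[OF G])
  next
    case (const c)
    then show ?case using affine_const[OF G] by (simp add: U)
  next
    case (comp i ps)
    have aff: "affine M k q" if "q \<in> set ps" for q using comp.IH that by auto
    have len: "length ps = module_arity i" using comp.hyps by (simp add: module_algebra_def)
    have op: "oper (module_algebra R M) = module_oper M" by (simp add: module_algebra_def)
    show ?case
    proof (cases i)
      case Zero_op
      then show ?thesis using affine_const[OF G] by (simp add: op)
    next
      case Neg_op
      then obtain q where ps: "ps = [q]" using len by (auto simp: length_Suc_conv)
      have "add_map M (\<lambda>x. \<ominus>\<^bsub>M\<^esub> x)" by (auto simp: add_map_def minus_add)
      from affine_add_map[OF G aff this, of q] show ?thesis using Neg_op by (simp add: op ps)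
    next
      case Add_op
      then obtain q q' where ps: "ps = [q, q']" using len by (auto simp: length_Suc_conv numeral_eq_Suc)
      from affine_add[OF G aff aff, of q q'] show ?thesis using Add_op by (simp add: op ps)
    next
      case (Scalar_op r)
      then obtain q where ps: "ps = [q]" using len by (auto simp: length_Suc_conv)
      have "r \<in> carrier R" using comp.hyps(1) Scalar_op by (auto simp: module_algebra_def)
      then have "add_map M (\<lambda>x. r \<odot>\<^bsub>M\<^esub> x)" using M by (auto simp: add_map_def left_module_def)
      from affine_add_map[OF G aff this, of q] show ?thesis using Scalar_op by (simp add: op ps)
    qed
  qed
qed

text \<open>Here polynomial equivalence turns the basic operations of an Abelian algebra into affine
  maps.\<close>

lemma module_for_affine:
  assumes L: "module_for L R M" and i: "i \<in> index L"
  shows "affine M (arity L i) (oper L i)"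
proof -
  have M: "left_module R M" and eq: "polynomially_equivalent L (module_algebra R M)"
    using L by (auto simp: module_for_def)
  have U: "universe L = carrier M" using eq by (simp add: polynomially_equivalent_def module_algebra_def)
  let ?k = "arity L i"
  \<comment> \<open>Polynomial operations are given by compositions, so the basic operation is
    applied to the projections.\<close>
  let ?p = "\<lambda>xs. oper L i (map (\<lambda>p. p xs) (map (\<lambda>j xs. xs ! j) [0..<?k]))"
  have "?p \<in> compositions L ?k"
    by (rule compositions.comp) (auto simp: i intro: compositions.proj)
  then have "restrict ?p (tuples ?k (universe L)) \<in> polynomial_operations L ?k"
    unfolding polynomial_operations_def by (rule imageI)
  then have "restrict ?p (tuples ?k (universe L)) \<in> polynomial_operations (module_algebra R M) ?k"
    using eq unfolding polynomially_equivalent_def by metis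
  then obtain q where q: "q \<in> compositions (module_algebra R M) ?k"
      "restrict ?p (tuples ?k (carrier M)) = restrict q (tuples ?k (carrier M))"
    unfolding polynomial_operations_def U by (auto simp: module_algebra_def)
  have "oper L i xs = q xs" if xs: "xs \<in> tuples ?k (carrier M)" for xs
  proof -
    have "map (\<lambda>p. p xs) (map (\<lambda>j xs. xs ! j) [0..<?k]) = xs"
      using xs by (auto simp: tuples_def comp_def intro: nth_equalityI)
    then show ?thesis using fun_cong[OF q(2), of xs] xs by simp
  qed
  then show ?thesis using module_polynomial_affine[OF M q(1)] unfolding affine_def by simp
qed

section \<open>Sums in a finite module\<close>

text \<open>The functions which arise by propagating the contributions \<open>w h\<close> of the nodes \<open>h < S\<close> through
  additive maps.\<close>

definition weighted_sum :: "('r, 'a, 'y) module_scheme \<Rightarrow> nat \<Rightarrow> nat \<Rightarrow> (nat \<Rightarrow> bool list \<Rightarrow> 'a) \<Rightarrow>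
    (bool list \<Rightarrow> 'a) \<Rightarrow> bool" where
  "weighted_sum M n S w \<phi> \<longleftrightarrow> (\<exists>\<rho>. (\<forall>h < S. \<rho> h \<in> carrier M \<rightarrow> carrier M) \<and>
     (\<forall>bs. length bs = n \<longrightarrow> \<phi> bs = (\<Oplus>\<^bsub>M\<^esub>h \<in> {..<S}. \<rho> h (w h bs))))"

context
  fixes M :: "('r, 'a, 'y) module_scheme" and n S :: nat and w :: "nat \<Rightarrow> bool list \<Rightarrow> 'a"
  assumes M: "abelian_group M"
    and w: "\<And>h bs. h < S \<Longrightarrow> length bs = n \<Longrightarrow> w h bs \<in> carrier M"
begin

interpretation abelian_group M by (rule M)

lemma weighted_sum_closed: "weighted_sum M n S w \<phi> \<Longrightarrow> length bs = n \<Longrightarrow> \<phi> bs \<in> carrier M"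
  unfolding weighted_sum_def using w by (auto intro!: finsum_closed simp: Pi_iff)

lemma weighted_sum_cong:
  "weighted_sum M n S w \<phi> \<Longrightarrow> (\<And>bs. length bs = n \<Longrightarrow> \<psi> bs = \<phi> bs) \<Longrightarrow> weighted_sum M n S w \<psi>"
  unfolding weighted_sum_def by simp

lemma weighted_sum_zero: "weighted_sum M n S w (\<lambda>bs. \<zero>\<^bsub>M\<^esub>)"
  unfolding weighted_sum_def by (intro exI[of _ "\<lambda>h x. \<zero>\<^bsub>M\<^esub>"]) auto

lemma weighted_sum_single:
  assumes j: "j < S"
  shows "weighted_sum M n S w (w j)"
  unfolding weighted_sum_def
proof (intro exI[of _ "\<lambda>h x. if j = h then x else \<zero>\<^bsub>M\<^esub>"] conjI allI impI)
  fix bs :: "bool list" assume n: "length bs = n"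
  show "w j bs = (\<Oplus>\<^bsub>M\<^esub>h \<in> {..<S}. if j = h then w h bs else \<zero>\<^bsub>M\<^esub>)"
    using finsum_singleton[of j "{..<S}" "\<lambda>h. w h bs"] j w n by (auto simp: Pi_iff)
qed auto

lemma weighted_sum_add:
  assumes "weighted_sum M n S w \<phi>" "weighted_sum M n S w \<psi>"
  shows "weighted_sum M n S w (\<lambda>bs. \<phi> bs \<oplus>\<^bsub>M\<^esub> \<psi> bs)"
proof -
  obtain \<rho> \<sigma> where \<rho>: "\<And>h. h < S \<Longrightarrow> \<rho> h \<in> carrier M \<rightarrow> carrier M"
      "\<And>bs. length bs = n \<Longrightarrow> \<phi> bs = (\<Oplus>\<^bsub>M\<^esub>h \<in> {..<S}. \<rho> h (w h bs))"
    and \<sigma>: "\<And>h. h < S \<Longrightarrow> \<sigma> h \<in> carrier M \<rightarrow> carrier M"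
      "\<And>bs. length bs = n \<Longrightarrow> \<psi> bs = (\<Oplus>\<^bsub>M\<^esub>h \<in> {..<S}. \<sigma> h (w h bs))"
    using assms unfolding weighted_sum_def by auto
  have "\<phi> bs \<oplus>\<^bsub>M\<^esub> \<psi> bs = (\<Oplus>\<^bsub>M\<^esub>h \<in> {..<S}. \<rho> h (w h bs) \<oplus>\<^bsub>M\<^esub> \<sigma> h (w h bs))"
    if "length bs = n" for bs
    unfolding \<rho>(2)[OF that] \<sigma>(2)[OF that]
    by (rule finsum_addf[symmetric]) (use \<rho>(1) \<sigma>(1) w that in \<open>auto simp: Pi_iff\<close>)
  then show ?thesis unfolding weighted_sum_def using \<rho>(1) \<sigma>(1)
    by (intro exI[of _ "\<lambda>h x. \<rho> h x \<oplus>\<^bsub>M\<^esub> \<sigma> h x"]) (auto simp: Pi_iff)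
qed

lemma weighted_sum_add_map:
  assumes "weighted_sum M n S w \<phi>" "add_map M r"
  shows "weighted_sum M n S w (\<lambda>bs. r (\<phi> bs))"
proof -
  obtain \<rho> where \<rho>: "\<And>h. h < S \<Longrightarrow> \<rho> h \<in> carrier M \<rightarrow> carrier M"
      "\<And>bs. length bs = n \<Longrightarrow> \<phi> bs = (\<Oplus>\<^bsub>M\<^esub>h \<in> {..<S}. \<rho> h (w h bs))"
    using assms unfolding weighted_sum_def by auto
  have "r (\<phi> bs) = (\<Oplus>\<^bsub>M\<^esub>h \<in> {..<S}. r (\<rho> h (w h bs)))" if "length bs = n" for bs
    unfolding \<rho>(2)[OF that]
    by (rule add_map_finsum[OF M assms(2)]) (use \<rho>(1) w that in \<open>auto simp: Pi_iff\<close>)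
  then show ?thesis unfolding weighted_sum_def using \<rho>(1) add_mapD(1)[OF assms(2)]
    by (intro exI[of _ "\<lambda>h x. r (\<rho> h x)"]) (auto simp: Pi_iff)
qed

lemma weighted_sum_finsum:
  assumes "\<And>t. t < (k :: nat) \<Longrightarrow> weighted_sum M n S w (\<phi> t)"
  shows "weighted_sum M n S w (\<lambda>bs. \<Oplus>\<^bsub>M\<^esub>t \<in> {..<k}. \<phi> t bs)"
  using assms
proof (induction k)
  case 0
  then show ?case using weighted_sum_zero by simp
next
  case (Suc k)
  have "weighted_sum M n S w (\<lambda>bs. \<phi> k bs \<oplus>\<^bsub>M\<^esub> (\<Oplus>\<^bsub>M\<^esub>t \<in> {..<k}. \<phi> t bs))"
    using Suc by (intro weighted_sum_add) auto
  then show ?case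
  proof (rule weighted_sum_cong)
    fix bs :: "bool list" assume n: "length bs = n"
    show "(\<Oplus>\<^bsub>M\<^esub>t \<in> {..<Suc k}. \<phi> t bs) = \<phi> k bs \<oplus>\<^bsub>M\<^esub> (\<Oplus>\<^bsub>M\<^esub>t \<in> {..<k}. \<phi> t bs)"
      unfolding lessThan_Suc
      by (rule finsum_insert) (use Suc.prems weighted_sum_closed n in auto)
  qed
qed

text \<open>Summands are sorted by their value: what matters is how often each element occurs, and
  by \<open>multiple_mod\<close> only modulo a number that annihilates it.\<close>

lemma finsum_by_multiplicity:
  assumes fin: "finite (carrier M)" and "finite T" and y: "y \<in> T \<rightarrow> carrier M"
  shows "finsum M y T = (\<Oplus>\<^bsub>M\<^esub>x \<in> carrier M. [card {h \<in> T. y h = x}] \<cdot>\<^bsub>M\<^esub> x)"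
  using \<open>finite T\<close> y
proof (induction T rule: finite_induct)
  case empty
  then show ?case by (simp add: add.nat_pow_0)
next
  case (insert t T)
  have yt: "y t \<in> carrier M" "y \<in> T \<rightarrow> carrier M" using insert.prems by auto
  have "(\<Oplus>\<^bsub>M\<^esub>x \<in> carrier M. [card {h \<in> insert t T. y h = x}] \<cdot>\<^bsub>M\<^esub> x)
      = (\<Oplus>\<^bsub>M\<^esub>x \<in> carrier M. (if y t = x then x else \<zero>\<^bsub>M\<^esub>) \<oplus>\<^bsub>M\<^esub> [card {h \<in> T. y h = x}] \<cdot>\<^bsub>M\<^esub> x)"
  proof (rule finsum_cong')
    fix x assume x: "x \<in> carrier M"
    have "{h \<in> insert t T. y h = x} = (if y t = x then insert t {h \<in> T. y h = x} else {h \<in> T. y h = x})"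
      by auto
    then have "card {h \<in> insert t T. y h = x} = (if y t = x then Suc (card {h \<in> T. y h = x}) else card {h \<in> T. y h = x})"
      using insert.hyps by auto
    then show "[card {h \<in> insert t T. y h = x}] \<cdot>\<^bsub>M\<^esub> x
       = (if y t = x then x else \<zero>\<^bsub>M\<^esub>) \<oplus>\<^bsub>M\<^esub> [card {h \<in> T. y h = x}] \<cdot>\<^bsub>M\<^esub> x"
      using x by (simp add: a_comm)
  qed (auto simp: Pi_iff)
  also have "\<dots> = (\<Oplus>\<^bsub>M\<^esub>x \<in> carrier M. if y t = x then x else \<zero>\<^bsub>M\<^esub>) \<oplus>\<^bsub>M\<^esub>
      (\<Oplus>\<^bsub>M\<^esub>x \<in> carrier M. [card {h \<in> T. y h = x}] \<cdot>\<^bsub>M\<^esub> x)"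
    by (rule finsum_addf) auto
  also have "(\<Oplus>\<^bsub>M\<^esub>x \<in> carrier M. if y t = x then x else \<zero>\<^bsub>M\<^esub>) = y t"
    by (rule finsum_singleton) (use yt fin in auto)
  also have "(\<Oplus>\<^bsub>M\<^esub>x \<in> carrier M. [card {h \<in> T. y h = x}] \<cdot>\<^bsub>M\<^esub> x) = finsum M y T"
    using insert.IH yt by simp
  finally show ?case using insert yt by (simp add: finsum_insert)
qed

lemma multiple_mod:
  assumes m: "[m] \<cdot>\<^bsub>M\<^esub> x = \<zero>\<^bsub>M\<^esub>" and x: "x \<in> carrier M" and ab: "(a :: nat) mod m = b mod m"
  shows "[a] \<cdot>\<^bsub>M\<^esub> x = [b] \<cdot>\<^bsub>M\<^esub> x"
proof -
  have "[c] \<cdot>\<^bsub>M\<^esub> x = [(c mod m)] \<cdot>\<^bsub>M\<^esub> x" for c :: nat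
  proof -
    have "[c] \<cdot>\<^bsub>M\<^esub> x = [(c div m * m + c mod m)] \<cdot>\<^bsub>M\<^esub> x" by simp
    also have "\<dots> = [(c div m * m)] \<cdot>\<^bsub>M\<^esub> x \<oplus>\<^bsub>M\<^esub> [(c mod m)] \<cdot>\<^bsub>M\<^esub> x"
      by (rule add.nat_pow_mult[OF x, symmetric])
    also have "[(c div m * m)] \<cdot>\<^bsub>M\<^esub> x = [(c div m)] \<cdot>\<^bsub>M\<^esub> ([m] \<cdot>\<^bsub>M\<^esub> x)"
      using add.nat_pow_pow[OF x, of "c div m" m] by (simp add: mult.commute)
    also have "\<dots> = \<zero>\<^bsub>M\<^esub>" unfolding m by (rule add.nat_pow_one)
    finally show ?thesis using x by simp
  qed
  then show ?thesis using ab by metis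
qed

end

section \<open>Simulation of circuits over nilpotent algebras\<close>

text \<open>Of the bits testing \<open>y\<close> for the members of \<open>vl\<close> exactly one is
  1. A predicate of \<open>y\<close> is therefore a sum of such bits and can be wired into a MOD
  gate without a gate of its own.\<close>

lemma sum_list_indicator:
  assumes "distinct vl" "y \<in> set vl"
  shows "(\<Sum>v\<leftarrow>filter P vl. of_bool (y = v) :: nat) = of_bool (P y)"
  using assms
proof (induction vl)
  case (Cons a vl)
  have "(\<Sum>v\<leftarrow>filter P vl. of_bool (y = v) :: nat) = 0" if "y \<notin> set vl"
    using that by (auto simp: sum_list_of_bool_eq_0)
  then show ?case using Cons by auto
qed simp

lemma sum_list_of_bool_card:
  "(\<Sum>h\<leftarrow>[0..<S]. of_bool (Q h) :: nat) = card {h \<in> {..<S}. Q h}"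
proof (induction S)
  case (Suc S)
  have "{h \<in> {..<Suc S}. Q h} = (if Q S then insert S {h \<in> {..<S}. Q h} else {h \<in> {..<S}. Q h})"
    by (auto simp: less_Suc_eq)
  then show ?case using Suc by simp
qed simp

lemma sum_list_map_concat: "(\<Sum>x\<leftarrow>concat xss. g x) = (\<Sum>xs\<leftarrow>xss. \<Sum>x\<leftarrow>xs. g x)"
  for g :: "'a \<Rightarrow> 'b :: comm_monoid_add"
  by (induction xss) auto

lemma sum_list_concat_replicate:
  "(\<Sum>f\<leftarrow>concat (replicate q xs). g f :: nat) = q * (\<Sum>f\<leftarrow>xs. g f)"
  by (induction q) auto

text \<open>A MOD gate recognises residue 0 only; \<open>e - c\<close> additional ones shift residue
  \<open>c\<close> to 0.\<close>

lemma add_complement_mod_eq_0_iff: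
  assumes "(c :: nat) < e"
  shows "(a + (e - c)) mod e = 0 \<longleftrightarrow> a mod e = c"
proof -
  have "(a + (e - c)) mod e = (a mod e + (e - c)) mod e" by (simp add: mod_add_left_eq)
  also have "\<dots> = 0 \<longleftrightarrow> a mod e + (e - c) = e"
  proof
    assume "(a mod e + (e - c)) mod e = 0"
    then obtain k where k: "a mod e + (e - c) = e * k" by (auto elim!: dvdE simp: mod_eq_0_iff_dvd)
    have "a mod e < e" using assms by simp
    then have "0 < e * k" "e * k < e * 2" using k assms by linarith+
    then have "k = 1" by simp
    then show "a mod e + (e - c) = e" using k by simp
  qed simp
  also have "\<dots> \<longleftrightarrow> a mod e = c" using assms by auto
  finally show ?thesis .
qed

text \<open>The number of summands is unbounded, so a normal form in the summands is out of reach.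
  Counting modulo \<open>e\<close> how often each element occurs leaves only
  \<open>card (carrier M) * e\<close> tests, and these determine the sum. Depth 6 is 1 for a
  constant, 1 for counting and 4 for the final Boolean function.\<close>

lemma cc_add_weighted_sums:
  fixes M :: "('r, 'a, 'y) module_scheme"
  assumes M: "abelian_group M" and fin: "finite (carrier M)"
    and e: "e \<ge> 1" "\<And>x. x \<in> carrier M \<Longrightarrow> [e] \<cdot>\<^bsub>M\<^esub> x = \<zero>\<^bsub>M\<^esub>"
    and m: "e dvd m" "2 ^ (card (carrier M) * e) < m"
    and ok: "cc_ok n d gs" and J: "finite J"
    and w: "\<And>h. h < S \<Longrightarrow> available n m gs (carrier M) (w h)"
    and \<phi>: "\<And>j. j \<in> J \<Longrightarrow> weighted_sum M n S w (\<phi> j)"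
  defines "k \<equiv> card (carrier M) * e"
  shows "\<exists>hs. length hs \<le> 1 + (k + (k + 2 ^ Suc k + 2) * card (carrier M)) * card J \<and>
    cc_ok n (d + 6) (gs @ hs) \<and> (\<forall>j \<in> J. available n m (gs @ hs) (carrier M) (\<phi> j))"
proof -
  have wc: "w h bs \<in> carrier M" if "h < S" "length bs = n" for h bs
    using w that by (auto simp: available_def)
  interpret abelian_group M by fact
  obtain vl where vl: "set vl = carrier M" "distinct vl" using finite_distinct_list[OF fin] by metis
  have lvl: "length vl = card (carrier M)" using vl distinct_card by metis
  obtain \<rho> where \<rho>: "\<And>j h. j \<in> J \<Longrightarrow> h < S \<Longrightarrow> \<rho> j h \<in> carrier M \<rightarrow> carrier M"
     "\<And>j bs. j \<in> J \<Longrightarrow> length bs = n \<Longrightarrow> \<phi> j bs = (\<Oplus>\<^bsub>M\<^esub>h \<in> {..<S}. \<rho> j h (w h bs))"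
    using \<phi> unfolding weighted_sum_def by metis
  define N where "N j x bs = card {h \<in> {..<S}. \<rho> j h (w h bs) = x}" for j x bs
  \<comment> \<open>Wires from the tests \<open>w h bs = v\<close> for all \<open>v\<close> with
    \<open>\<rho> j h v = x\<close>. For each \<open>h\<close> at most one carries a 1, and one does
    exactly if the summand of \<open>h\<close> equals \<open>x\<close>.\<close>
  define cl where "cl j x = concat (map (\<lambda>h. map (\<lambda>v bs. w h bs = v) (filter (\<lambda>v. \<rho> j h v = x) vl)) [0..<S])" for j x
  have cl: "(\<Sum>f\<leftarrow>cl j x. of_bool (f bs) :: nat) = N j x bs" if "length bs = n" for j x bs
  proof -
    have "(\<Sum>f\<leftarrow>cl j x. of_bool (f bs) :: nat)
        = (\<Sum>h\<leftarrow>[0..<S]. \<Sum>v\<leftarrow>filter (\<lambda>v. \<rho> j h v = x) vl. of_bool (w h bs = v))"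
      by (simp add: cl_def sum_list_map_concat comp_def)
    also have "\<dots> = (\<Sum>h\<leftarrow>[0..<S]. of_bool (\<rho> j h (w h bs) = x))"
      by (intro arg_cong[of _ _ sum_list] map_cong refl sum_list_indicator)
        (use vl wc that in auto)
    finally show ?thesis unfolding N_def sum_list_of_bool_card .
  qed
  define cnt where "cnt j x r bs \<longleftrightarrow> (N j x bs + (e - r)) mod e = 0" for j x r bs
  \<comment> \<open>A gate without inputs has sum 0, so it is the constant 1.\<close>
  have "\<exists>hs. length hs \<le> card {\<lambda>_ :: bool list. True} \<and> cc_ok n (Suc d) (gs @ hs) \<and>
      (\<forall>g \<in> {\<lambda>_. True}. cc_has n m (gs @ hs) g)"
    by (rule cc_layer[OF ok]) (auto intro: exI[of _ "[]"])
  then obtain h1 where h1: "length h1 \<le> 1" "cc_ok n (Suc d) (gs @ h1)" "cc_has n m (gs @ h1) (\<lambda>_. True)"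
    by auto
  define G where "G = (\<lambda>(j, x, r) bs. cnt j x r bs) ` (J \<times> carrier M \<times> {..<e})"
  have G_mem: "cnt j x r \<in> G" if "j \<in> J" "x \<in> carrier M" "r < e" for j x r
    unfolding G_def by (rule image_eqI[of _ _ "(j, x, r)"]) (use that in auto)
  have cG: "card G \<le> k * card J"
    unfolding G_def k_def
    by (rule order_trans[OF card_image_le]) (use J fin in \<open>auto simp: card_cartesian_product\<close>)
  have "\<exists>hs. length hs \<le> card G \<and> cc_ok n (Suc (Suc d)) ((gs @ h1) @ hs) \<and>
      (\<forall>g \<in> G. cc_has n m ((gs @ h1) @ hs) g)"
  proof (rule cc_layer[OF h1(2)])
    show "finite G" using J fin by (auto simp: G_def)
    fix g assume "g \<in> G"
    then obtain j x r where g: "j \<in> J" "x \<in> carrier M" "r < e" "g = cnt j x r" by (auto simp: G_def)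
    \<comment> \<open>The repetition multiplies the sum by \<open>m div e\<close>, so the test
      modulo \<open>m = (m div e) * e\<close> becomes a test modulo \<open>e\<close>.\<close>
    define fs where "fs = concat (replicate (m div e) (cl j x @ replicate (e - r) (\<lambda>_. True)))"
    show "\<exists>fs. (\<forall>f\<in>set fs. cc_has n m (gs @ h1) f) \<and>
            (\<forall>bs. length bs = n \<longrightarrow> g bs = ((\<Sum>f\<leftarrow>fs. of_bool (f bs) :: nat) mod m = 0))"
    proof (intro exI[of _ fs] conjI ballI allI impI)
      fix f assume "f \<in> set fs"
      then have "f \<in> set (cl j x) \<or> f = (\<lambda>_. True)" by (auto simp: fs_def split: if_splits)
      then show "cc_has n m (gs @ h1) f"
        using h1(3) w vl cc_has_append[of n m gs _ h1] by (auto simp: cl_def available_def)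
    next
      fix bs :: "bool list" assume n: "length bs = n"
      have "(\<Sum>f\<leftarrow>fs. of_bool (f bs) :: nat) = (m div e) * (N j x bs + (e - r))"
        unfolding fs_def sum_list_concat_replicate using cl[OF n] by (simp add: sum_list_replicate)
      moreover have "m > 0" using m(2) by linarith
      then have "m = (m div e) * e" "m div e > 0"
        using m(1) e(1) by (simp_all add: div_greater_zero_iff dvd_imp_le)
      ultimately have "(\<Sum>f\<leftarrow>fs. of_bool (f bs) :: nat) mod m = 0 \<longleftrightarrow> (N j x bs + (e - r)) mod e = 0"
        by (metis mod_mult_mult1 mult_eq_0_iff neq0_conv)
      then show "g bs = ((\<Sum>f\<leftarrow>fs. of_bool (f bs) :: nat) mod m = 0)"
        by (simp add: g(4) cnt_def)
    qed
  qed
  then obtain h2 where h2: "length h2 \<le> card G" "cc_ok n (Suc (Suc d)) (gs @ h1 @ h2)"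
     "\<And>g. g \<in> G \<Longrightarrow> cc_has n m (gs @ h1 @ h2) g" by auto
  define H where "H = (\<lambda>(j, x) bs. \<phi> j bs = x) ` (J \<times> carrier M)"
  have cH: "card H \<le> card (carrier M) * card J"
    unfolding H_def
    by (rule order_trans[OF card_image_le]) (use J fin in \<open>auto simp: card_cartesian_product\<close>)
  have "\<exists>hs. length hs \<le> (k + 2 ^ Suc k + 2) * card H \<and> cc_ok n (Suc (Suc d) + 4) ((gs @ h1 @ h2) @ hs) \<and>
      (\<forall>g \<in> H. cc_has n m ((gs @ h1 @ h2) @ hs) g)"
  proof (rule cc_add_determined[OF h2(2)])
    show "finite H" using J fin by (auto simp: H_def)
    show "2 ^ k < m" using m(2) by (simp add: k_def)
    fix g assume "g \<in> H"
    then obtain j x0 where g: "j \<in> J" "g = (\<lambda>bs. \<phi> j bs = x0)" by (auto simp: H_def)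
    \<comment> \<open>The residue tests for all elements, at most \<open>k\<close> in number; they
      determine every multiplicity modulo \<open>e\<close>, hence the sum.\<close>
    define fs where "fs = concat (map (\<lambda>x. map (\<lambda>r. cnt j x r) [0..<e]) vl)"
    have "length fs \<le> k"
      using lvl by (simp add: fs_def length_concat comp_def sum_list_triv k_def)
    moreover have "\<forall>f\<in>set fs. cc_has n m (gs @ h1 @ h2) f"
      using g(1) vl by (auto simp: fs_def intro!: h2(3) G_mem)
    moreover have "determined_by n (set fs) g"
      unfolding determined_by_def
    proof (intro allI impI)
      fix bs bs' assume b: "length bs = n" "length bs' = n" "\<forall>f\<in>set fs. f bs = f bs'"
      have "N j x bs mod e = N j x bs' mod e" if x: "x \<in> carrier M" for x
      proof -
        have "N j x bs mod e < e" using e(1) by simp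
        then have "cnt j x (N j x bs mod e) \<in> set fs" using x vl unfolding fs_def by fastforce
        with b(3) have eq: "cnt j x (N j x bs mod e) bs = cnt j x (N j x bs mod e) bs'" by blast
        have red: "(a + (e - b mod e)) mod e = 0 \<longleftrightarrow> a mod e = b mod e" for a b :: nat
          using add_complement_mod_eq_0_iff[of "b mod e" e a] e(1) by simp
        show ?thesis using eq red[of "N j x bs" "N j x bs"] red[of "N j x bs'" "N j x bs"]
          by (simp add: cnt_def)
      qed
      then have mult: "[N j x bs] \<cdot>\<^bsub>M\<^esub> x = [N j x bs'] \<cdot>\<^bsub>M\<^esub> x" if "x \<in> carrier M" for x
        using multiple_mod[OF M _ e(2)] wc that by blast
      have "\<phi> j b = (\<Oplus>\<^bsub>M\<^esub>x \<in> carrier M. [N j x b] \<cdot>\<^bsub>M\<^esub> x)" if "length b = n" for b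
        unfolding N_def \<rho>(2)[OF g(1) that]
        by (rule finsum_by_multiplicity[OF M _ fin]) (use \<rho>(1)[OF g(1)] wc that in \<open>auto simp: Pi_iff\<close>)
      moreover have "(\<Oplus>\<^bsub>M\<^esub>x \<in> carrier M. [N j x bs] \<cdot>\<^bsub>M\<^esub> x) = (\<Oplus>\<^bsub>M\<^esub>x \<in> carrier M. [N j x bs'] \<cdot>\<^bsub>M\<^esub> x)"
        by (rule finsum_cong') (use mult in auto)
      ultimately have "\<phi> j bs = \<phi> j bs'" using b(1,2) by simp
      then show "g bs = g bs'" by (simp add: g(2))
    qed
    ultimately show "\<exists>fs. length fs \<le> k \<and> (\<forall>f\<in>set fs. cc_has n m (gs @ h1 @ h2) f) \<and> determined_by n (set fs) g"
      by (intro exI[of _ fs] conjI)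
  qed
  then obtain h3 where h3: "length h3 \<le> (k + 2 ^ Suc k + 2) * card H"
     "cc_ok n (d + 6) (gs @ h1 @ h2 @ h3)" "\<And>g. g \<in> H \<Longrightarrow> cc_has n m (gs @ h1 @ h2 @ h3) g"
    by (auto simp: numeral_eq_Suc)
  have "length h3 \<le> (k + 2 ^ Suc k + 2) * (card (carrier M) * card J)"
    by (rule order_trans[OF h3(1) mult_le_mono2[OF cH]])
  then have "length (h1 @ h2 @ h3) \<le> 1 + (k * card J + (k + 2 ^ Suc k + 2) * (card (carrier M) * card J))"
    using h1(1) h2(1) cG by simp
  then have "length (h1 @ h2 @ h3) \<le> 1 + (k + (k + 2 ^ Suc k + 2) * card (carrier M)) * card J"
    by (simp add: algebra_simps)
  moreover have "available n m (gs @ h1 @ h2 @ h3) (carrier M) (\<phi> j)" if j: "j \<in> J" for j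
  proof -
    have "\<phi> j bs \<in> carrier M" if "length bs = n" for bs
      by (rule weighted_sum_closed[OF M _ \<phi>[OF j] that]) (rule wc)
    then show ?thesis using h3(3) j by (auto simp: available_def H_def)
  qed
  ultimately show ?thesis using h3(2) by blast
qed

text \<open>The number of gates that \<open>cc_add_determined\<close> spends on each function.\<close>

definition dnf_size :: "nat \<Rightarrow> nat" where
  "dnf_size k = k + 2 ^ Suc k + 2"

section \<open>Systems of equations over a module\<close>

lemma card_multiple_eq_zero:
  assumes "abelian_group M" "x \<in> carrier M"
  shows "[card (carrier M)] \<cdot>\<^bsub>M\<^esub> x = \<zero>\<^bsub>M\<^esub>"
proof -
  interpret abelian_group M by fact
  show ?thesis using add.pow_order_eq_1[OF assms(2)] by (simp add: order_def)
qed

text \<open>Solving the equations along the numbering expresses each \<open>l j\<close> as a sum of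
  contributions of single nodes, pushed through additive maps. The paths between two nodes may be
  exponentially many, but the maps along them add up to one map, so a single weighted sum per node
  suffices. The order \<open>c\<close> of the module serves as the modulus \<open>e\<close>. Depth
  10 is 4 for the contributions and 6 for the sums.\<close>

lemma cc_add_module_layer:
  fixes L :: "('a, 'i) ualg"
  assumes L: "module_for L R M" and fin: "finite (universe L)"
  defines "c \<equiv> card (universe L)"
  assumes m: "c dvd m" "2 ^ (c * c) < m" and ok: "cc_ok n d gs"
    and sys: "\<And>j. j < S \<Longrightarrow> available n m gs (universe L) (l j) \<or>
      (\<exists>i \<in> index L. \<exists>ps w. length ps = arity L i \<and> (\<forall>p \<in> set ps. p < j) \<and>
         available n m gs (universe L) w \<and>
         (\<forall>bs. length bs = n \<longrightarrow> l j bs = oper L i (map (\<lambda>p. l p bs) ps) \<oplus>\<^bsub>M\<^esub> w bs))"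
  shows "\<exists>hs. length hs \<le> (1 + c * c + dnf_size c * c + dnf_size (c * c) * c) * Suc S \<and>
     cc_ok n (d + 10) (gs @ hs) \<and> (\<forall>j < S. available n m (gs @ hs) (universe L) (l j))"
proof -
  have G: "abelian_group M" using L by (simp add: module_for_def left_module_def)
  interpret abelian_group M by fact
  have U: "universe L = carrier M"
    using L by (simp add: module_for_def polynomially_equivalent_def module_algebra_def)
  have "c > 0" using fin zero_closed by (auto simp: c_def U card_gt_0_iff)
  obtain C r where C: "\<And>i. i \<in> index L \<Longrightarrow> C i \<in> carrier M"
    and r: "\<And>i t. i \<in> index L \<Longrightarrow> t < arity L i \<Longrightarrow> add_map M (r i t)"
    and op: "\<And>i xs. i \<in> index L \<Longrightarrow> xs \<in> tuples (arity L i) (carrier M) \<Longrightarrow>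
        oper L i xs = C i \<oplus>\<^bsub>M\<^esub> (\<Oplus>\<^bsub>M\<^esub>t \<in> {..<arity L i}. r i t (xs ! t))"
  proof -
    define Q where "Q i c r \<longleftrightarrow> c \<in> carrier M \<and> (\<forall>t < arity L i. add_map M (r t)) \<and>
       (\<forall>xs \<in> tuples (arity L i) (carrier M).
          oper L i xs = c \<oplus>\<^bsub>M\<^esub> (\<Oplus>\<^bsub>M\<^esub>t \<in> {..<arity L i}. r t (xs ! t)))" for i c r
    have "\<exists>c r. Q i c r" if "i \<in> index L" for i
      using module_for_affine[OF L that] unfolding affine_def Q_def by blast
    then obtain C r where "\<And>i. i \<in> index L \<Longrightarrow> Q i (C i) (r i)" by metis
    then show thesis using that[of C r] unfolding Q_def by blast
  qed
  define inp where "inp j \<longleftrightarrow> available n m gs (carrier M) (l j)" for j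
  define eqn where "eqn j i ps w \<longleftrightarrow> i \<in> index L \<and> length ps = arity L i \<and> (\<forall>p \<in> set ps. p < j) \<and>
       available n m gs (carrier M) w \<and>
         (\<forall>bs. length bs = n \<longrightarrow> l j bs = oper L i (map (\<lambda>p. l p bs) ps) \<oplus>\<^bsub>M\<^esub> w bs)" for j i ps w
  have "\<exists>i ps w. eqn j i ps w" if "j < S" "\<not> inp j" for j
    using sys[OF that(1)] that(2) unfolding U inp_def eqn_def by blast
  then obtain I P w0 where eqn: "\<And>j. j < S \<Longrightarrow> \<not> inp j \<Longrightarrow> eqn j (I j) (P j) (w0 j)"
    by metis
  have ip: "I j \<in> index L" "length (P j) = arity L (I j)" "\<And>p. p \<in> set (P j) \<Longrightarrow> p < j"
    and w0: "available n m gs (carrier M) (w0 j)"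
    and l: "\<And>bs. length bs = n \<Longrightarrow> l j bs = oper L (I j) (map (\<lambda>p. l p bs) (P j)) \<oplus>\<^bsub>M\<^esub> w0 j bs"
    if "j < S" "\<not> inp j" for j
    using eqn[OF that] unfolding eqn_def by blast+
  \<comment> \<open>What node \<open>j\<close> adds on its own: its value if that is given,
    otherwise the constant term of its operation together with the perturbation
    \<open>w0 j\<close>.\<close>
  define w where "w j = (if inp j then l j else (\<lambda>bs. C (I j) \<oplus>\<^bsub>M\<^esub> w0 j bs))" for j
  have w_closed: "w j bs \<in> carrier M" if "j < S" "length bs = n" for j bs
    using that w0[of j] ip(1)[of j] C by (auto simp: w_def inp_def available_def)
  have "\<exists>hs. length hs \<le> (1 * c + 2 ^ Suc (1 * c) + 2) * card (carrier M) * card {..<S} \<and>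
      cc_ok n (d + 4) (gs @ hs) \<and> (\<forall>j \<in> {..<S}. available n m (gs @ hs) (carrier M) (w j))"
  proof (rule cc_add_determined_values[OF ok])
    have "c \<le> c * c" using \<open>c > 0\<close> by simp
    then have "(2 :: nat) ^ (1 * c) \<le> 2 ^ (c * c)" by (intro power_increasing) auto
    then show "2 ^ (1 * c) < m" using m(2) by linarith
    fix j assume j: "j \<in> {..<S}"
    show "\<exists>\<phi>s :: ('a set \<times> (bool list \<Rightarrow> 'a)) list. length \<phi>s \<le> 1 \<and>
         (\<forall>(V, \<phi>) \<in> set \<phi>s. finite V \<and> card V \<le> c \<and> available n m gs V \<phi>) \<and>
         determined_by n (snd ` set \<phi>s) (w j)"
      using w0[of j] j fin
      by (intro exI[of _ "[(carrier M, if inp j then l j else w0 j)]"])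
        (auto simp: inp_def c_def U w_def determined_by_def)
  qed (use fin w_closed in \<open>auto simp: U\<close>)
  then obtain h1 where h1: "length h1 \<le> dnf_size c * c * S" "cc_ok n (d + 4) (gs @ h1)"
     "\<And>j. j < S \<Longrightarrow> available n m (gs @ h1) (carrier M) (w j)"
    by (auto simp: dnf_size_def c_def U)
  \<comment> \<open>Induction along the numbering; the additive maps of the operation are applied to
    the sums obtained for the predecessors.\<close>
  have ws: "weighted_sum M n S w (l j)" if "j < S" for j
    using that
  proof (induction j rule: less_induct)
    case (less j)
    show ?case
    proof (cases "inp j")
      case True
      then have "w j = l j" by (simp add: w_def)
      moreover have "weighted_sum M n S w (w j)"
        by (rule weighted_sum_single[OF G _ less.prems]) (rule w_closed)
      ultimately show ?thesis by simp
    next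
      case False
      note s = ip[OF less.prems False] and w0 = w0[OF less.prems False] and l = l[OF less.prems False]
      let ?i = "I j" and ?ps = "P j"
      have IH: "weighted_sum M n S w (l (?ps ! t))" if "t < arity L ?i" for t
      proof (rule less.IH)
        show "?ps ! t < j" using s that by simp
        then show "?ps ! t < S" using less.prems by simp
      qed
      have W: "weighted_sum M n S w (w j)"
        by (rule weighted_sum_single[OF G _ less.prems]) (rule w_closed)
      have A: "weighted_sum M n S w (\<lambda>bs. r ?i t (l (?ps ! t) bs))" if "t < arity L ?i" for t
        by (rule weighted_sum_add_map[OF G _ IH[OF that] r[OF s(1) that]]) (rule w_closed)
      have F: "weighted_sum M n S w (\<lambda>bs. \<Oplus>\<^bsub>M\<^esub>t \<in> {..<arity L ?i}. r ?i t (l (?ps ! t) bs))"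
        by (rule weighted_sum_finsum[OF G], rule w_closed, assumption, assumption, rule A)
      have "weighted_sum M n S w (\<lambda>bs. w j bs \<oplus>\<^bsub>M\<^esub> (\<Oplus>\<^bsub>M\<^esub>t \<in> {..<arity L ?i}. r ?i t (l (?ps ! t) bs)))"
        by (rule weighted_sum_add[OF G _ W F]) (rule w_closed)
      then show ?thesis
      proof (rule weighted_sum_cong[OF G, rotated])
        fix bs :: "bool list" assume n: "length bs = n"
        have lc: "l (?ps ! t) bs \<in> carrier M" if "t < arity L ?i" for t
          by (rule weighted_sum_closed[OF G _ IH[OF that] n]) (rule w_closed)
        have tup: "map (\<lambda>p. l p bs) ?ps \<in> tuples (arity L ?i) (carrier M)"
          using lc s by (auto simp: tuples_def in_set_conv_nth)
        have rc: "(\<lambda>t. r ?i t (l (?ps ! t) bs)) \<in> {..<arity L ?i} \<rightarrow> carrier M"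
          using r lc s by (auto intro: add_mapD)
        have w0c: "w0 j bs \<in> carrier M" using w0 n by (auto simp: available_def)
        have "l j bs = (C ?i \<oplus>\<^bsub>M\<^esub> (\<Oplus>\<^bsub>M\<^esub>t \<in> {..<arity L ?i}. r ?i t (map (\<lambda>p. l p bs) ?ps ! t))) \<oplus>\<^bsub>M\<^esub> w0 j bs"
          using l[OF n] op[OF s(1) tup] by simp
        also have "(\<Oplus>\<^bsub>M\<^esub>t \<in> {..<arity L ?i}. r ?i t (map (\<lambda>p. l p bs) ?ps ! t))
            = (\<Oplus>\<^bsub>M\<^esub>t \<in> {..<arity L ?i}. r ?i t (l (?ps ! t) bs))"
          by (rule finsum_cong') (use s rc in auto)
        finally show "l j bs = w j bs \<oplus>\<^bsub>M\<^esub> (\<Oplus>\<^bsub>M\<^esub>t \<in> {..<arity L ?i}. r ?i t (l (?ps ! t) bs))"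
          using False C s w0c finsum_closed[OF rc] by (simp add: w_def a_ac)
      qed (rule w_closed)
    qed
  qed
  have "\<exists>hs. length hs \<le> 1 + (card (carrier M) * c + (card (carrier M) * c + 2 ^ Suc (card (carrier M) * c) + 2) * card (carrier M)) * card {..<S} \<and>
      cc_ok n (d + 4 + 6) ((gs @ h1) @ hs) \<and> (\<forall>j \<in> {..<S}. available n m ((gs @ h1) @ hs) (carrier M) (l j))"
  proof (rule cc_add_weighted_sums[where S = S and w = w, OF G])
    show "2 ^ (card (carrier M) * c) < m" using m(2) by (simp add: c_def U)
    show "[c] \<cdot>\<^bsub>M\<^esub> x = \<zero>\<^bsub>M\<^esub>" if "x \<in> carrier M" for x
      using card_multiple_eq_zero[OF G that] by (simp add: c_def U)
  qed (use fin \<open>c > 0\<close> m(1) h1 ws in \<open>auto simp: U\<close>)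
  then obtain h2 where h2: "length h2 \<le> 1 + (c * c + dnf_size (c * c) * c) * S" "cc_ok n (d + 10) (gs @ h1 @ h2)"
     "\<And>j. j < S \<Longrightarrow> available n m (gs @ h1 @ h2) (carrier M) (l j)"
    by (auto simp: dnf_size_def c_def U add.commute[of d])
  have "length (h1 @ h2) \<le> (1 + c * c + dnf_size c * c + dnf_size (c * c) * c) * Suc S"
    using h1(1) h2(1) by (simp add: algebra_simps)
  then show ?thesis using h2 U by metis
qed

text \<open>Systems of equations are solved here rather than circuits translated, since the
  \<open>U\<close>-components of a system over an algebra on \<open>L \<times> U\<close> form such a
  system over \<open>U\<close>. The constants \<open>d\<close> and \<open>c\<close> are uniform in
  the system and in the gates already present: constant depth, linear size.\<close>

definition simulable :: "('a, 'i) ualg \<Rightarrow> nat \<Rightarrow> bool" where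
  "simulable A m \<longleftrightarrow> (\<exists>d c. \<forall>n S v d0 gs. cc_ok n d0 gs \<longrightarrow>
     (\<forall>j < S. available n m gs (universe A) (v j) \<or>
        (\<exists>i \<in> index A. \<exists>ps. length ps = arity A i \<and> (\<forall>p \<in> set ps. p < j) \<and>
           (\<forall>bs. length bs = n \<longrightarrow> v j bs = oper A i (map (\<lambda>p. v p bs) ps)))) \<longrightarrow>
     (\<exists>hs. length hs \<le> c * Suc S \<and> cc_ok n (d0 + d) (gs @ hs) \<and>
        (\<forall>j < S. available n m (gs @ hs) (universe A) (v j))))"

section \<open>Induction on the nilpotency class\<close>

lemma module_for_universe:
  assumes "module_for A R M"
  shows "abelian_group M" "universe A = carrier M" "universe A \<noteq> {}"
proof -
  show M: "abelian_group M" and U: "universe A = carrier M"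
    using assms by (auto simp: module_for_def left_module_def polynomially_equivalent_def module_algebra_def)
  interpret abelian_group M by fact
  show "universe A \<noteq> {}" using zero_closed U by blast
qed

lemma nilpotent_universe_nonempty: "nilpotent_of_class c A \<Longrightarrow> universe A \<noteq> {}"
proof (induction rule: nilpotent_of_class.induct)
  case (abelian A)
  then show ?case using module_for_universe(3) unfolding abelian_algebra_def by blast
next
  case (extension A L U R M n e fhat)
  then show ?case using module_for_universe(3)[of L R M] by (auto simp: bij_betw_def)
qed

lemma nilpotent_is_algebra: "nilpotent_of_class c A \<Longrightarrow> is_algebra A"
  by (induction rule: nilpotent_of_class.induct) (auto simp: abelian_algebra_def)

lemma power_less_multiple:
  assumes "2 ^ Suc K * q dvd m" "m \<ge> 1" "k \<le> K"
  shows "2 ^ k < (m :: nat)"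
proof -
  have "(2 :: nat) ^ k < 2 ^ Suc K" using assms(3) by (intro power_strict_increasing) auto
  also have "\<dots> \<le> m" using assms(1,2) by (metis dvd_imp_le dvd_mult_left less_le_trans zero_less_one)
  finally show ?thesis .
qed

lemma gate_system_closed:
  assumes A: "is_algebra A" and sys: "\<And>j. j < S \<Longrightarrow> available n m gs (universe A) (v j) \<or>
        (\<exists>i \<in> index A. \<exists>ps. length ps = arity A i \<and> (\<forall>p \<in> set ps. p < j) \<and>
           (\<forall>bs. length bs = n \<longrightarrow> v j bs = oper A i (map (\<lambda>p. v p bs) ps)))"
    and j: "(j :: nat) < S" and n: "length bs = n"
  shows "v j bs \<in> universe A"
  using j
proof (induction j rule: less_induct)
  case (less j)
  from sys[OF less.prems] show ?case
  proof
    assume "available n m gs (universe A) (v j)"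
    then show ?thesis using n by (auto simp: available_def)
  next
    assume "\<exists>i \<in> index A. \<exists>ps. length ps = arity A i \<and> (\<forall>p \<in> set ps. p < j) \<and>
           (\<forall>bs. length bs = n \<longrightarrow> v j bs = oper A i (map (\<lambda>p. v p bs) ps))"
    then obtain i ps where ip: "i \<in> index A" "length ps = arity A i" "\<And>p. p \<in> set ps \<Longrightarrow> p < j"
        "v j bs = oper A i (map (\<lambda>p. v p bs) ps)" using n by blast
    have "v p bs \<in> universe A" if "p \<in> set ps" for p
      using ip(3)[OF that] less by auto
    then have "map (\<lambda>p. v p bs) ps \<in> tuples (arity A i) (universe A)"
      using ip(2) by (auto simp: tuples_def)
    then show ?thesis using A ip(1,4) by (auto simp: is_algebra_def)
  qed
qed

text \<open>A module layer without perturbation: \<open>w\<close> is the constant zero, which is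
  made available beforehand.\<close>

lemma abelian_simulable:
  assumes A: "is_algebra A" and L: "module_for A R M" and fin: "finite (universe A)"
    and m: "card (universe A) dvd m" "2 ^ (card (universe A) * card (universe A)) < m"
  shows "simulable A m"
proof -
  define c where "c = card (universe A)"
  have "abelian_group M" and U: "universe A = carrier M"
    using module_for_universe[OF L] by auto
  interpret abelian_group M by fact
  have c0: "c > 0" using fin zero_closed by (auto simp: c_def U card_gt_0_iff)
  have m1: "1 < m" using m(2) one_le_power[of "2 :: nat" "card (universe A) * card (universe A)"] by linarith
  define D where "D = 1 + c * c + dnf_size c * c + dnf_size (c * c) * c"
  have "\<exists>hs. length hs \<le> (dnf_size 0 * c + D) * Suc S \<and> cc_ok n (d0 + 14) (gs @ hs) \<and>
        (\<forall>j < S. available n m (gs @ hs) (universe A) (v j))"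
    if ok: "cc_ok n d0 gs" and sys: "\<forall>j < S. available n m gs (universe A) (v j) \<or>
        (\<exists>i \<in> index A. \<exists>ps. length ps = arity A i \<and> (\<forall>p \<in> set ps. p < j) \<and>
           (\<forall>bs. length bs = n \<longrightarrow> v j bs = oper A i (map (\<lambda>p. v p bs) ps)))"
    for n S v d0 gs
  proof -
    have vc: "v j bs \<in> universe A" if "j < S" "length bs = n" for j bs
      using gate_system_closed[OF A _ that] sys by blast
    have "\<exists>hs. length hs \<le> (0 * 0 + 2 ^ Suc (0 * 0) + 2) * card (universe A) * card {()} \<and>
      cc_ok n (d0 + 4) (gs @ hs) \<and> (\<forall>j \<in> {()}. available n m (gs @ hs) (universe A) (\<lambda>bs. \<zero>\<^bsub>M\<^esub>))"
      by (rule cc_add_determined_values[OF ok])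
        (use fin m1 in \<open>auto simp: U determined_by_def intro: exI[of _ "[]"]\<close>)
    then obtain h1 where h1: "length h1 \<le> dnf_size 0 * c" "cc_ok n (d0 + 4) (gs @ h1)"
       "available n m (gs @ h1) (universe A) (\<lambda>bs. \<zero>\<^bsub>M\<^esub>)"
      by (auto simp: dnf_size_def c_def)
    have "\<exists>hs. length hs \<le> D * Suc S \<and> cc_ok n (d0 + 4 + 10) ((gs @ h1) @ hs) \<and>
        (\<forall>j < S. available n m ((gs @ h1) @ hs) (universe A) (v j))"
      unfolding D_def c_def
    proof (rule cc_add_module_layer[OF L fin m h1(2)])
      fix j assume j: "j < S"
      show "available n m (gs @ h1) (universe A) (v j) \<or>
        (\<exists>i\<in>index A. \<exists>ps w. length ps = arity A i \<and> (\<forall>p\<in>set ps. p < j) \<and>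
            available n m (gs @ h1) (universe A) w \<and>
            (\<forall>bs. length bs = n \<longrightarrow> v j bs = oper A i (map (\<lambda>p. v p bs) ps) \<oplus>\<^bsub>M\<^esub> w bs))"
      proof (cases "available n m gs (universe A) (v j)")
        case True
        then show ?thesis by (simp add: available_append)
      next
        case False
        with sys j obtain i ps where ip: "i \<in> index A" "length ps = arity A i" "\<forall>p \<in> set ps. p < j"
           "\<And>bs. length bs = n \<Longrightarrow> v j bs = oper A i (map (\<lambda>p. v p bs) ps)" by metis
        have "v j bs = oper A i (map (\<lambda>p. v p bs) ps) \<oplus>\<^bsub>M\<^esub> \<zero>\<^bsub>M\<^esub>" if "length bs = n" for bs
          using ip(4)[OF that] vc[OF j that] by (simp add: U)
        then show ?thesis using ip h1(3) by blast
      qed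
    qed
    then obtain h2 where h2: "length h2 \<le> D * Suc S" "cc_ok n (d0 + 14) (gs @ h1 @ h2)"
        "\<forall>j < S. available n m (gs @ h1 @ h2) (universe A) (v j)"
      by (auto simp: add.commute)
    have "length (h1 @ h2) \<le> (dnf_size 0 * c + D) * Suc S" using h1(1) h2(1) by (simp add: algebra_simps)
    then show ?thesis using h2 by blast
  qed
  then show ?thesis unfolding simulable_def by blast
qed

text \<open>Once the \<open>U\<close>-components are available, each \<open>fhat\<close> term is a
  function of at most \<open>K\<close> available values, and the \<open>L\<close>-components form a
  system over a module with these terms as perturbations. The depth is 4 + 4 for splitting the given
  values, \<open>dU\<close>, 4 for \<open>fhat\<close>, 10 for the module layer, and 4 for putting
  the components together.\<close>

lemma extension_simulable:
  fixes A L U :: "('a, 'i) ualg"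
  assumes A: "is_algebra A" and sig: "same_signature A L" "same_signature A U"
    and L: "module_for L R M" and U: "simulable U m"
    and bij: "bij_betw e (universe L \<times> universe U) (universe A)"
    and fhat: "\<forall>i \<in> index A. \<forall>us \<in> tuples (arity A i) (universe U). fhat i us \<in> universe L"
    and op: "\<forall>i \<in> index A. \<forall>ls \<in> tuples (arity A i) (universe L). \<forall>us \<in> tuples (arity A i) (universe U).
       oper A i (map e (zip ls us)) = e (oper L i ls \<oplus>\<^bsub>M\<^esub> fhat i us, oper U i us)"
    and algs: "is_algebra L" "is_algebra U"
    and fin: "finite (universe A)" "finite (universe L)" "finite (universe U)"
    and ar: "\<And>i. i \<in> index A \<Longrightarrow> arity A i \<le> K"
    and m: "card (universe L) dvd m" "2 ^ (card (universe L) * card (universe L)) < m"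
      "2 ^ card (universe A) < m" "2 ^ (K * card (universe U)) < m"
      "2 ^ (2 * (card (universe L) + card (universe U))) < m"
  shows "simulable A m"
proof -
  define a l u where "a = card (universe A)" and "l = card (universe L)" and "u = card (universe U)"
  obtain dU cU where IH: "\<And>n S v d0 gs. cc_ok n d0 gs \<Longrightarrow>
     (\<forall>j < S. available n m gs (universe U) (v j) \<or>
        (\<exists>i \<in> index U. \<exists>ps. length ps = arity U i \<and> (\<forall>p \<in> set ps. p < j) \<and>
           (\<forall>bs. length bs = n \<longrightarrow> v j bs = oper U i (map (\<lambda>p. v p bs) ps)))) \<Longrightarrow>
     (\<exists>hs. length hs \<le> cU * Suc S \<and> cc_ok n (d0 + dU) (gs @ hs) \<and>
        (\<forall>j < S. available n m (gs @ hs) (universe U) (v j)))"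
    using U unfolding simulable_def by metis
  define D where "D = 1 + l * l + dnf_size l * l + dnf_size (l * l) * l"
  \<comment> \<open>One summand for each of the six stages \<open>h1\<close> to \<open>h6\<close>;
    \<open>dnf_size b * v\<close> pays for \<open>v\<close> indicators that are functions of
    \<open>b\<close> bits.\<close>
  define E where "E = dnf_size a * l + dnf_size a * u + cU + dnf_size (K * u) * l + D
      + dnf_size (2 * (l + u)) * a"
  have "\<exists>hs. length hs \<le> E * Suc S \<and> cc_ok n (d0 + (26 + dU)) (gs @ hs) \<and>
        (\<forall>j < S. available n m (gs @ hs) (universe A) (v j))"
    if ok: "cc_ok n d0 gs" and sys: "\<forall>j < S. available n m gs (universe A) (v j) \<or>
        (\<exists>i \<in> index A. \<exists>ps. length ps = arity A i \<and> (\<forall>p \<in> set ps. p < j) \<and>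
           (\<forall>bs. length bs = n \<longrightarrow> v j bs = oper A i (map (\<lambda>p. v p bs) ps)))"
    for n S v d0 gs
  proof -
    have vc: "v j bs \<in> universe A" if "j < S" "length bs = n" for j bs
      using gate_system_closed[OF A _ that] sys by blast
    define inp where "inp = {j. j < S \<and> available n m gs (universe A) (v j)}"
    have inp: "finite inp" "card inp \<le> S"
      using card_mono[of "{..<S}" inp] by (auto simp: inp_def)
    define eqn where "eqn j i ps \<longleftrightarrow> i \<in> index A \<and> length ps = arity A i \<and> (\<forall>p \<in> set ps. p < j) \<and>
       (\<forall>bs. length bs = n \<longrightarrow> v j bs = oper A i (map (\<lambda>p. v p bs) ps))" for j i ps
    have "\<exists>i ps. eqn j i ps" if "j < S" "j \<notin> inp" for j
      using sys that unfolding inp_def eqn_def by blast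
    then obtain I P where eqn: "\<And>j. j < S \<Longrightarrow> j \<notin> inp \<Longrightarrow> eqn j (I j) (P j)" by metis
    have ip: "I j \<in> index A" "length (P j) = arity A (I j)" "\<And>p. p \<in> set (P j) \<Longrightarrow> p < j"
      and veq: "\<And>bs. length bs = n \<Longrightarrow> v j bs = oper A (I j) (map (\<lambda>p. v p bs) (P j))"
      if "j < S" "j \<notin> inp" for j
      using eqn[OF that] unfolding eqn_def by blast+
    define b where "b = inv_into (universe L \<times> universe U) e"
    define vl vu where "vl j bs = fst (b (v j bs))" and "vu j bs = snd (b (v j bs))" for j bs
    have bb: "b x \<in> universe L \<times> universe U" "e (b x) = x" if "x \<in> universe A" for x
    proof -
      have "x \<in> e ` (universe L \<times> universe U)" using bij that by (simp add: bij_betw_def)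
      then show "b x \<in> universe L \<times> universe U" "e (b x) = x"
        unfolding b_def by (rule inv_into_into, rule f_inv_into_f)
    qed
    have be: "b (e y) = y" if "y \<in> universe L \<times> universe U" for y
      using bij that by (auto simp: b_def bij_betw_def intro: inv_into_f_f)
    have vlu: "vl j bs \<in> universe L" "vu j bs \<in> universe U" "v j bs = e (vl j bs, vu j bs)"
      if "j < S" "length bs = n" for j bs
      using bb[OF vc[OF that]] by (auto simp: vl_def vu_def mem_Times_iff)
    define w where "w j bs = fhat (I j) (map (\<lambda>p. vu p bs) (P j))" for j bs
    have eqs: "vl j bs = oper L (I j) (map (\<lambda>p. vl p bs) (P j)) \<oplus>\<^bsub>M\<^esub> w j bs"
        "vu j bs = oper U (I j) (map (\<lambda>p. vu p bs) (P j))" "w j bs \<in> universe L"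
      if j: "j < S" "j \<notin> inp" and n: "length bs = n" for j bs
    proof -
      have lt: "p < S" if "p \<in> set (P j)" for p using ip(3)[OF j that] j by simp
      let ?ls = "map (\<lambda>p. vl p bs) (P j)" and ?us = "map (\<lambda>p. vu p bs) (P j)"
      have ls: "?ls \<in> tuples (arity A (I j)) (universe L)" and us: "?us \<in> tuples (arity A (I j)) (universe U)"
        using lt vlu(1,2)[OF _ n] ip(2)[OF j] by (auto simp: tuples_def)
      have "map (\<lambda>p. v p bs) (P j) = map e (zip ?ls ?us)"
        using vlu(3)[OF lt n] by (simp add: zip_map_map zip_same_conv_map)
      then have "v j bs = e (oper L (I j) ?ls \<oplus>\<^bsub>M\<^esub> w j bs, oper U (I j) ?us)"
        using op ip(1)[OF j] ls us veq[OF j n] by (simp add: w_def)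
      moreover have wj: "w j bs \<in> universe L" using fhat ip(1)[OF j] us by (simp add: w_def)
      moreover have "oper L (I j) ?ls \<in> universe L" "oper U (I j) ?us \<in> universe U"
        using algs sig ip(1)[OF j] ls us by (auto simp: is_algebra_def same_signature_def)
      moreover have "x \<oplus>\<^bsub>M\<^esub> y \<in> universe L" if "x \<in> universe L" "y \<in> universe L" for x y
        using that module_for_universe(1,2)[OF L] by (simp add: abelian_group.axioms(1) abelian_monoid.a_closed)
      ultimately have "b (v j bs) = (oper L (I j) ?ls \<oplus>\<^bsub>M\<^esub> w j bs, oper U (I j) ?us)"
        by (simp add: be)
      then show "vl j bs = oper L (I j) ?ls \<oplus>\<^bsub>M\<^esub> w j bs" "vu j bs = oper U (I j) ?us"
        "w j bs \<in> universe L" using wj by (auto simp: vl_def vu_def)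
    qed
    have "\<exists>hs. length hs \<le> (1 * a + 2 ^ Suc (1 * a) + 2) * card (universe L) * card inp \<and>
      cc_ok n (d0 + 4) (gs @ hs) \<and> (\<forall>j \<in> inp. available n m (gs @ hs) (universe L) (vl j))"
    proof (rule cc_add_determined_values[OF ok])
      fix j assume "j \<in> inp"
      then show "\<exists>\<phi>s :: ('a set \<times> (bool list \<Rightarrow> 'a)) list. length \<phi>s \<le> 1 \<and>
         (\<forall>(V, \<phi>) \<in> set \<phi>s. finite V \<and> card V \<le> a \<and> available n m gs V \<phi>) \<and>
         determined_by n (snd ` set \<phi>s) (vl j)"
        using fin by (intro exI[of _ "[(universe A, v j)]"]) (auto simp: inp_def a_def vl_def determined_by_def)
    qed (use inp fin m vlu in \<open>auto simp: inp_def a_def\<close>)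
    then obtain h1 where h1: "length h1 \<le> dnf_size a * l * card inp" "cc_ok n (d0 + 4) (gs @ h1)"
       "\<And>j. j \<in> inp \<Longrightarrow> available n m (gs @ h1) (universe L) (vl j)"
      by (auto simp: dnf_size_def l_def)
    have "\<exists>hs. length hs \<le> (1 * a + 2 ^ Suc (1 * a) + 2) * card (universe U) * card inp \<and>
      cc_ok n (d0 + 4 + 4) ((gs @ h1) @ hs) \<and> (\<forall>j \<in> inp. available n m ((gs @ h1) @ hs) (universe U) (vu j))"
    proof (rule cc_add_determined_values[OF h1(2)])
      fix j assume "j \<in> inp"
      then show "\<exists>\<phi>s :: ('a set \<times> (bool list \<Rightarrow> 'a)) list. length \<phi>s \<le> 1 \<and>
         (\<forall>(V, \<phi>) \<in> set \<phi>s. finite V \<and> card V \<le> a \<and> available n m (gs @ h1) V \<phi>) \<and>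
         determined_by n (snd ` set \<phi>s) (vu j)"
        using fin available_append
        by (intro exI[of _ "[(universe A, v j)]"]) (auto simp: inp_def a_def vu_def determined_by_def)
    qed (use inp fin m vlu in \<open>auto simp: inp_def a_def\<close>)
    then obtain h2 where h2: "length h2 \<le> dnf_size a * u * card inp" "cc_ok n (d0 + 8) (gs @ h1 @ h2)"
       "\<And>j. j \<in> inp \<Longrightarrow> available n m (gs @ h1 @ h2) (universe U) (vu j)"
      by (auto simp: dnf_size_def u_def add.assoc)
    have "\<exists>hs. length hs \<le> cU * Suc S \<and> cc_ok n (d0 + 8 + dU) ((gs @ h1 @ h2) @ hs) \<and>
        (\<forall>j < S. available n m ((gs @ h1 @ h2) @ hs) (universe U) (vu j))"
    proof (rule IH[OF h2(2)], intro allI impI)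
      fix j assume j: "j < S"
      show "available n m (gs @ h1 @ h2) (universe U) (vu j) \<or>
        (\<exists>i \<in> index U. \<exists>ps. length ps = arity U i \<and> (\<forall>p \<in> set ps. p < j) \<and>
           (\<forall>bs. length bs = n \<longrightarrow> vu j bs = oper U i (map (\<lambda>p. vu p bs) ps)))"
      proof (cases "j \<in> inp")
        case True
        then show ?thesis using h2(3) by blast
      next
        case False
        have "I j \<in> index U" "length (P j) = arity U (I j)"
          using ip(1,2)[OF j False] sig by (auto simp: same_signature_def)
        then show ?thesis using ip(3)[OF j False] eqs(2)[OF j False] by blast
      qed
    qed
    then obtain h3 where h3: "length h3 \<le> cU * Suc S" "cc_ok n (d0 + 8 + dU) (gs @ h1 @ h2 @ h3)"
       "\<And>j. j < S \<Longrightarrow> available n m (gs @ h1 @ h2 @ h3) (universe U) (vu j)"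
      by auto
    have "\<exists>hs. length hs \<le> (K * u + 2 ^ Suc (K * u) + 2) * card (universe L) * card ({..<S} - inp) \<and>
      cc_ok n (d0 + 8 + dU + 4) ((gs @ h1 @ h2 @ h3) @ hs) \<and>
      (\<forall>j \<in> {..<S} - inp. available n m ((gs @ h1 @ h2 @ h3) @ hs) (universe L) (w j))"
    proof (rule cc_add_determined_values[OF h3(2)])
      fix j assume j: "j \<in> {..<S} - inp"
      have lt: "p < S" if "p \<in> set (P j)" for p using ip(3)[OF _ _ that] j by fastforce
      have "length (P j) \<le> K" using ip(1,2)[of j] j ar[of "I j"] by simp
      then show "\<exists>\<phi>s :: ('a set \<times> (bool list \<Rightarrow> 'a)) list. length \<phi>s \<le> K \<and>
         (\<forall>(V, \<phi>) \<in> set \<phi>s. finite V \<and> card V \<le> u \<and> available n m (gs @ h1 @ h2 @ h3) V \<phi>) \<and>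
         determined_by n (snd ` set \<phi>s) (w j)"
        using fin h3(3)[OF lt]
        by (intro exI[of _ "map (\<lambda>p. (universe U, vu p)) (P j)"])
          (auto simp: u_def w_def determined_by_def intro!: arg_cong[of _ _ "fhat (I j)"])
      fix bs :: "bool list" assume "length bs = n"
      then show "w j bs \<in> universe L" using eqs(3)[of j] j by auto
    qed (use fin m in \<open>auto simp: u_def\<close>)
    then obtain h4 where h4: "length h4 \<le> dnf_size (K * u) * l * card ({..<S} - inp)"
       "cc_ok n (d0 + 12 + dU) (gs @ h1 @ h2 @ h3 @ h4)"
       "\<And>j. j < S \<Longrightarrow> j \<notin> inp \<Longrightarrow> available n m (gs @ h1 @ h2 @ h3 @ h4) (universe L) (w j)"
      by (auto simp: dnf_size_def l_def algebra_simps)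
    have "\<exists>hs. length hs \<le> D * Suc S \<and> cc_ok n (d0 + 12 + dU + 10) ((gs @ h1 @ h2 @ h3 @ h4) @ hs) \<and>
        (\<forall>j < S. available n m ((gs @ h1 @ h2 @ h3 @ h4) @ hs) (universe L) (vl j))"
      unfolding D_def l_def
    proof (rule cc_add_module_layer[OF L fin(2) m(1,2) h4(2)])
      fix j assume j: "j < S"
      show "available n m (gs @ h1 @ h2 @ h3 @ h4) (universe L) (vl j) \<or>
        (\<exists>i\<in>index L. \<exists>ps w. length ps = arity L i \<and> (\<forall>p\<in>set ps. p < j) \<and>
            available n m (gs @ h1 @ h2 @ h3 @ h4) (universe L) w \<and>
            (\<forall>bs. length bs = n \<longrightarrow> vl j bs = oper L i (map (\<lambda>p. vl p bs) ps) \<oplus>\<^bsub>M\<^esub> w bs))"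
      proof (cases "j \<in> inp")
        case True
        then show ?thesis using available_append[OF h1(3), of j "h2 @ h3 @ h4"] by simp
      next
        case False
        have "I j \<in> index L" "length (P j) = arity L (I j)"
          using ip(1,2)[OF j False] sig by (auto simp: same_signature_def)
        then show ?thesis using ip(3)[OF j False] eqs(1)[OF j False] h4(3)[OF j False] by blast
      qed
    qed
    then obtain h5 where h5: "length h5 \<le> D * Suc S" "cc_ok n (d0 + 22 + dU) (gs @ h1 @ h2 @ h3 @ h4 @ h5)"
        "\<And>j. j < S \<Longrightarrow> available n m (gs @ h1 @ h2 @ h3 @ h4 @ h5) (universe L) (vl j)"
      by (auto simp: algebra_simps)
    let ?gs = "gs @ h1 @ h2 @ h3 @ h4 @ h5"
    have vu_av: "available n m ?gs (universe U) (vu j)" if "j < S" for j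
      using available_append[OF h3(3)[OF that], of "h4 @ h5"] by simp
    have "\<exists>hs. length hs \<le> (2 * (l + u) + 2 ^ Suc (2 * (l + u)) + 2) * card (universe A) * card {..<S} \<and>
      cc_ok n (d0 + 22 + dU + 4) (?gs @ hs) \<and> (\<forall>j \<in> {..<S}. available n m (?gs @ hs) (universe A) (v j))"
    proof (rule cc_add_determined_values[OF h5(2)])
      fix j assume j: "j \<in> {..<S}"
      then show "\<exists>\<phi>s :: ('a set \<times> (bool list \<Rightarrow> 'a)) list. length \<phi>s \<le> 2 \<and>
         (\<forall>(V, \<phi>) \<in> set \<phi>s. finite V \<and> card V \<le> l + u \<and> available n m ?gs V \<phi>) \<and>
         determined_by n (snd ` set \<phi>s) (v j)"
        using fin vu_av h5(3) vlu(3)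
        by (intro exI[of _ "[(universe L, vl j), (universe U, vu j)]"]) (auto simp: l_def u_def determined_by_def)
    qed (use fin m vc in \<open>auto simp: l_def u_def\<close>)
    then obtain h6 where h6: "length h6 \<le> dnf_size (2 * (l + u)) * a * S" "cc_ok n (d0 + (26 + dU)) (?gs @ h6)"
        "\<And>j. j < S \<Longrightarrow> available n m (?gs @ h6) (universe A) (v j)"
      by (auto simp: a_def dnf_size_def algebra_simps)
    let ?hs = "h1 @ h2 @ h3 @ h4 @ h5 @ h6"
    have cd: "card ({..<S} - inp) \<le> Suc S" "card inp \<le> Suc S" "S \<le> Suc S"
      using card_mono[of "{..<S}" "{..<S} - inp"] inp(2) by auto
    have "length ?hs \<le> dnf_size a * l * Suc S + dnf_size a * u * Suc S + cU * Suc S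
        + dnf_size (K * u) * l * Suc S + D * Suc S + dnf_size (2 * (l + u)) * a * Suc S"
      using order_trans[OF h1(1) mult_le_mono2[OF cd(2)]] order_trans[OF h2(1) mult_le_mono2[OF cd(2)]] h3(1)
        order_trans[OF h4(1) mult_le_mono2[OF cd(1)]] h5(1) order_trans[OF h6(1) mult_le_mono2[OF cd(3)]]
      unfolding length_append by linarith
    also have "\<dots> = E * Suc S" unfolding E_def by (simp only: add_mult_distrib)
    finally show ?thesis using h6 by (intro exI[of _ ?hs]) simp
  qed
  then show ?thesis unfolding simulable_def by blast
qed

text \<open>All levels have to share one modulus. Each level asks for divisibility by the size of
  its module and for a lower bound on \<open>m\<close>. Both pass to multiples, so quantifying over
  the multiples of \<open>m0\<close> lets the demands of several levels be combined by
  multiplication.\<close>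

theorem nilpotent_simulable:
  assumes "nilpotent_of_class c A" "finite (universe A)" "finite (index A)"
  shows "\<exists>m0 \<ge> 1. \<forall>m \<ge> 1. m0 dvd m \<longrightarrow> simulable A m"
  using assms
proof (induction rule: nilpotent_of_class.induct)
  case (abelian A)
  then obtain R M where A: "is_algebra A" "module_for A R M" by (auto simp: abelian_algebra_def)
  let ?a = "card (universe A)"
  have a: "?a \<ge> 1" using module_for_universe(3)[OF A(2)] abelian by (simp add: Suc_le_eq card_gt_0_iff)
  show ?case
  proof (intro exI[of _ "2 ^ Suc (?a * ?a) * ?a"] conjI allI impI)
    show "1 \<le> 2 ^ Suc (?a * ?a) * ?a" using a by (simp add: Suc_le_eq)
    fix m :: nat assume m: "1 \<le> m" "2 ^ Suc (?a * ?a) * ?a dvd m"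
    show "simulable A m"
      by (rule abelian_simulable[OF A abelian(2)])
        (use m power_less_multiple[OF m(2,1)] in \<open>auto dest: dvd_mult_right\<close>)
  qed
next
  case (extension A L U R M n e fhat)
  have neU: "universe U \<noteq> {}" by (rule nilpotent_universe_nonempty) fact
  have neL: "universe L \<noteq> {}" by (rule module_for_universe(3)) fact
  have "finite (universe L \<times> universe U)"
    using extension.hyps extension.prems bij_betw_finite by blast
  then have fin: "finite (universe L)" "finite (universe U)"
    using neU neL finite_cartesian_productD1 finite_cartesian_productD2 by blast+
  have "finite (index U)" using extension.hyps extension.prems by (simp add: same_signature_def)
  with extension.IH fin obtain m1 where m1: "m1 \<ge> 1" "\<And>m. m \<ge> 1 \<Longrightarrow> m1 dvd m \<Longrightarrow> simulable U m"
    by blast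
  have "finite (arity A ` index A)" using extension.prems by simp
  then obtain K where K: "\<And>i. i \<in> index A \<Longrightarrow> arity A i \<le> K"
    using finite_nat_set_iff_bounded_le by auto
  let ?a = "card (universe A)" and ?l = "card (universe L)" and ?u = "card (universe U)"
  \<comment> \<open>The sum of all exponents \<open>k\<close> for which this level requires
    \<open>2 ^ k < m\<close>, so each of them is at most \<open>B\<close>.\<close>
  define B where "B = ?l * ?l + ?a + K * ?u + 2 * (?l + ?u)"
  have l: "?l \<ge> 1" using neL fin by (simp add: Suc_le_eq card_gt_0_iff)
  show ?case
  proof (intro exI[of _ "2 ^ Suc B * (?l * m1)"] conjI allI impI)
    show "1 \<le> 2 ^ Suc B * (?l * m1)" using l m1(1) by (simp add: Suc_le_eq)
    fix m :: nat assume m: "1 \<le> m" "2 ^ Suc B * (?l * m1) dvd m"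
    have "?l * m1 dvd m" using m(2) by (rule dvd_mult_right)
    then have d: "?l dvd m" "m1 dvd m" by (auto dest: dvd_mult_left dvd_mult_right)
    have p: "2 ^ k < m" if "k \<le> B" for k using power_less_multiple[OF m(2,1) that] .
    show "simulable A m"
    proof (rule extension_simulable[where L = L and U = U and R = R and M = M and e = e and fhat = fhat and K = K])
      show "simulable U m" using m1(2)[OF m(1) d(2)] .
      show "is_algebra U" by (rule nilpotent_is_algebra) fact
      show "2 ^ (?l * ?l) < m" "2 ^ ?a < m" "2 ^ (K * ?u) < m" "2 ^ (2 * (?l + ?u)) < m"
        by (rule p, simp add: B_def)+
    qed (use extension.hyps extension.prems K d fin in \<open>assumption | blast\<close>)+
  qed
qed

section \<open>Consequences of the lower bound\<close>

text \<open>The constant gate that replaces the last input takes over its node number, so the other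
  gates are kept without renumbering. Like the input it has depth 0.\<close>

lemma and_circuit_drop_input:
  assumes C: "cc_circuit C" "circuit_depth C \<le> d" "computes_AND m (Suc k) C"
  shows "\<exists>C'. cc_circuit C' \<and> circuit_depth C' \<le> d \<and> computes_AND m k C'"
proof -
  define C' where "C' = \<lparr>inputs = k, gates = (Bool_const True, []) # gates C, output_node = output_node C\<rparr>"
  have inp: "inputs C = Suc k" using C(3) by (simp add: computes_AND_def)
  have nv: "node_values sem C' xs = node_values sem C (xs @ [sem (Bool_const True) []])"
    for sem :: "cc_gate \<Rightarrow> 'v list \<Rightarrow> 'v" and xs
    by (simp add: node_values_def C'_def)
  have "cc_circuit C'" using C(1) inp
    by (fastforce simp: wf_circuit_def C'_def num_gates_def nth_Cons split: nat.splits)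
  moreover have "circuit_depth C' = circuit_depth C"
    unfolding circuit_depth_def nv by (simp add: inp C'_def replicate_append_same)
  moreover have "computes_AND m k C'"
    using C(3) by (simp add: computes_AND_def circuit_value_def nv) (simp add: C'_def)
  ultimately show ?thesis using C(2) by (intro exI[of _ C']) simp
qed

text \<open>The lower bound is asymptotic, with constants depending on the family. A smallest
  circuit of depth at most \<open>d\<close> for each fan-in gives one family whose bound holds for
  all such circuits. If some fan-in admits no circuit of this depth, neither does a larger one, and
  \<open>k\<close> is bounded by a constant.\<close>

lemma and_fan_in_bound:
  assumes lower: "\<And>C :: nat \<Rightarrow> cc_gate circuit.
       \<exists>d. \<forall>n. cc_circuit (C n) \<and> circuit_depth (C n) \<le> d \<and> computes_AND m n (C n) \<Longrightarrow>
       \<exists>q > 0. \<exists>g :: nat \<Rightarrow> real. g \<in> \<Omega>(\<lambda>n. real n powr q) \<and>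
          (\<forall>n. real (num_gates (C n)) = 2 powr g n)"
  shows "\<exists>r. \<forall>k C L. cc_circuit C \<longrightarrow> circuit_depth C \<le> d \<longrightarrow> computes_AND m k C \<longrightarrow> 2 \<le> L \<longrightarrow>
    num_gates C \<le> 2 ^ L \<longrightarrow> k \<le> L ^ r"
proof (cases "\<forall>k. \<exists>C. cc_circuit C \<and> circuit_depth C \<le> d \<and> computes_AND m k C")
  case True
  define good where "good k C \<longleftrightarrow> cc_circuit C \<and> circuit_depth C \<le> d \<and> computes_AND m k C" for k C
  have "\<exists>C. good k C \<and> (\<forall>C'. good k C' \<longrightarrow> num_gates C \<le> num_gates C')" for k
  proof -
    obtain C0 where "good k C0" using True unfolding good_def by blast
    from ex_has_least_nat[of "good k", OF this, of num_gates] show ?thesis by blast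
  qed
  then obtain C where C: "\<And>k. good k (C k)" "\<And>k C'. good k C' \<Longrightarrow> num_gates (C k) \<le> num_gates C'"
    by metis
  from C(1) have "\<exists>d. \<forall>n. cc_circuit (C n) \<and> circuit_depth (C n) \<le> d \<and> computes_AND m n (C n)"
    unfolding good_def by blast
  from lower[OF this] obtain q g where q: "q > 0" "g \<in> \<Omega>(\<lambda>n. real n powr q)"
     "\<And>n. real (num_gates (C n)) = 2 powr g n" by blast
  from q(2) have "(\<lambda>n. real n powr q) \<in> O(g)" by (simp add: bigomega_iff_bigo)
  then obtain c where c: "c > 0" "eventually (\<lambda>n. norm (real n powr q) \<le> c * norm (g n)) sequentially"
    by (elim landau_o.bigE)
  then obtain n0 where n0: "\<And>n. n \<ge> n0 \<Longrightarrow> real n powr q \<le> c * \<bar>g n\<bar>"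
    by (auto simp: eventually_sequentially)
  \<comment> \<open>Constants become powers of \<open>L\<close>: since \<open>L \<ge> 2\<close>,
    \<open>c \<le> 2 ^ s \<le> L ^ s\<close>. So
    \<open>k powr q \<le> c * L \<le> L powr (1 + s)\<close>, and taking the \<open>q\<close>-th
    root leaves the exponent \<open>(1 + s) / q \<le> r0\<close>.\<close>
  obtain s :: nat where s: "c \<le> 2 ^ s" using real_arch_pow[of 2 c] by (auto intro: less_imp_le)
  obtain r0 :: nat where r0: "(1 + real s) / q \<le> real r0" using real_arch_simple by blast
  show ?thesis
  proof (intro exI[of _ "r0 + n0"] allI impI)
    fix k C' L assume C': "cc_circuit C'" "circuit_depth C' \<le> d" "computes_AND m k C'"
      and L: "(2 :: nat) \<le> L" "num_gates C' \<le> 2 ^ L"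
    show "k \<le> L ^ (r0 + n0)"
    proof (cases "k \<ge> n0")
      case False
      \<comment> \<open>The finitely many \<open>k\<close> below the threshold are absorbed by the
        additional exponent \<open>n0\<close>.\<close>
      have "k \<le> 2 ^ n0" using False less_exp[of n0] by linarith
      also have "\<dots> \<le> L ^ n0" using L(1) by (rule power_mono) simp
      also have "\<dots> \<le> L ^ (r0 + n0)" using L(1) by (intro power_increasing) auto
      finally show ?thesis .
    next
      case True
      have "num_gates (C k) \<le> 2 ^ L" using C(2)[of k C'] C' L(2) by (simp add: good_def)
      then have "real (num_gates (C k)) \<le> real (2 ^ L)" by (rule of_nat_mono)
      then have "2 powr g k \<le> 2 powr real L" using q(3) by (simp add: powr_realpow)
      then have gL: "g k \<le> L" by simp
      \<comment> \<open>The output node exists, so \<open>g k \<ge> 0\<close> and the absolute value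
        in the Landau bound disappears.\<close>
      have "num_gates (C k) \<ge> 1" using C(1)[of k] by (auto simp: good_def wf_circuit_def)
      then have "2 powr g k \<ge> 2 powr 0" using q(3)[of k] by simp
      then have g0: "g k \<ge> 0" by (subst (asm) powr_le_cancel_iff) auto
      have "real k powr q \<le> c * g k" using n0[OF True] g0 by simp
      also have "\<dots> \<le> 2 ^ s * real L" using s gL g0 c(1) by (intro mult_mono) auto
      also have "\<dots> \<le> real L ^ s * real L" using L(1) by (intro mult_right_mono power_mono) auto
      also have "\<dots> = real L powr (1 + real s)" using L(1) by (simp add: powr_add powr_realpow)
      finally have "(real k powr q) powr (1 / q) \<le> (real L powr (1 + real s)) powr (1 / q)"
        using q(1) by (intro powr_mono2) auto
      then have "real k \<le> real L powr ((1 + real s) / q)"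
        using q(1) by (simp add: powr_powr)
      also have "\<dots> \<le> real L powr real r0" using r0 L(1) by (intro powr_mono) auto
      also have "\<dots> = real (L ^ r0)" using L(1) by (simp add: powr_realpow)
      finally have "k \<le> L ^ r0" by linarith
      also have "\<dots> \<le> L ^ (r0 + n0)" using L(1) by (intro power_increasing) auto
      finally show ?thesis .
    qed
  qed
next
  case False
  then obtain k0 where k0: "\<not> (\<exists>C. cc_circuit C \<and> circuit_depth C \<le> d \<and> computes_AND m k0 C)" by blast
  have none: "\<not> (\<exists>C. cc_circuit C \<and> circuit_depth C \<le> d \<and> computes_AND m k C)" if "k0 \<le> k" for k
    using that
  proof (induction k rule: dec_induct)
    case (step k)
    then show ?case using and_circuit_drop_input by blast
  qed (rule k0)
  show ?thesis
  proof (intro exI[of _ k0] allI impI)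
    fix k C L assume "cc_circuit C" "circuit_depth C \<le> d" "computes_AND m k C" and L: "(2 :: nat) \<le> L"
    then have "k < k0" using none[of k] by (meson not_le)
    also have "k0 < 2 ^ k0" by simp
    also have "\<dots> \<le> L ^ k0" using L by (rule power_mono) simp
    finally show "k \<le> L ^ k0" by simp
  qed
qed

section \<open>Node equations and solutions of minimal support\<close>

lemma cc_has_input: "p < n \<Longrightarrow> cc_has n m gs (\<lambda>bs. bs ! p)"
  unfolding cc_has_def by (intro exI[of _ p]) (auto simp: eval_gates_prefix)

lemma circuit_node_equation:
  assumes C: "wf_circuit (alg_fan_in_ok A) C" and j: "j < length (gates C)" and xs: "length xs = inputs C"
  shows "(\<exists>a \<in> universe A. gates C ! j = (Elem a, []) \<and> node_values (alg_sem A) C xs ! (inputs C + j) = a) \<or>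
    (\<exists>i \<in> index A. \<exists>ps. gates C ! j = (Basic i, ps) \<and> length ps = arity A i \<and> (\<forall>p \<in> set ps. p < inputs C + j) \<and>
       node_values (alg_sem A) C xs ! (inputs C + j) = oper A i (map (\<lambda>p. node_values (alg_sem A) C xs ! p) ps))"
proof -
  obtain g ps where g: "gates C ! j = (g, ps)" by (cases "gates C ! j")
  have wf: "alg_fan_in_ok A g (length ps)" "\<forall>p \<in> set ps. p < inputs C + j"
    using C j g by (auto simp: wf_circuit_def)
  have "node_values (alg_sem A) C xs ! (inputs C + j)
      = alg_sem A g (map (\<lambda>p. node_values (alg_sem A) C xs ! p) ps)"
    using eval_gates_nth[OF j g, of xs "alg_sem A"] wf(2) xs by (simp add: node_values_def)
  then show ?thesis using wf g by (cases g) auto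
qed

text \<open>The substitution \<open>X\<close> feeds the circuit with values computed from Boolean
  inputs by gates already present, so that two circuits can be simulated one after the other on the
  same Boolean inputs.\<close>

definition simulates_within :: "('a, 'i) ualg \<Rightarrow> nat \<Rightarrow> nat \<Rightarrow> nat \<Rightarrow> bool" where
  "simulates_within A m d c \<longleftrightarrow> (\<forall>C n d0 gs X. wf_circuit (alg_fan_in_ok A) C \<longrightarrow> cc_ok n d0 gs \<longrightarrow>
     (\<forall>bs. length bs = n \<longrightarrow> length (X bs) = inputs C) \<longrightarrow>
     (\<forall>i < inputs C. available n m gs (universe A) (\<lambda>bs. X bs ! i)) \<longrightarrow>
     (\<forall>a \<in> universe A. available n m gs (universe A) (\<lambda>bs. a)) \<longrightarrow>
     (\<exists>hs. length hs \<le> c * Suc (num_gates C) \<and> cc_ok n (d0 + d) (gs @ hs) \<and>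
        available n m (gs @ hs) (universe A) (\<lambda>bs. circuit_value (alg_sem A) C (X bs))))"

text \<open>The node values solve a system as in \<open>simulable\<close>: inputs and constants are
  available, and every other node satisfies the equation of its operation.\<close>

lemma simulates_within:
  assumes sim: "simulable A m"
  shows "\<exists>d c. simulates_within A m d c"
proof -
  obtain d c where dc: "\<And>n S v d0 gs. cc_ok n d0 gs \<Longrightarrow>
     (\<forall>j < S. available n m gs (universe A) (v j) \<or>
        (\<exists>i \<in> index A. \<exists>ps. length ps = arity A i \<and> (\<forall>p \<in> set ps. p < j) \<and>
           (\<forall>bs. length bs = n \<longrightarrow> v j bs = oper A i (map (\<lambda>p. v p bs) ps)))) \<Longrightarrow>
     (\<exists>hs. length hs \<le> c * Suc S \<and> cc_ok n (d0 + d) (gs @ hs) \<and>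
        (\<forall>j < S. available n m (gs @ hs) (universe A) (v j)))"
    using sim unfolding simulable_def by metis
  have "\<exists>hs. length hs \<le> c * Suc (num_gates C) \<and> cc_ok n (d0 + d) (gs @ hs) \<and>
        available n m (gs @ hs) (universe A) (\<lambda>bs. circuit_value (alg_sem A) C (X bs))"
    if C: "wf_circuit (alg_fan_in_ok A) C" and ok: "cc_ok n d0 gs"
     and X: "\<And>bs. length bs = n \<Longrightarrow> length (X bs) = inputs C"
     "\<And>i. i < inputs C \<Longrightarrow> available n m gs (universe A) (\<lambda>bs. X bs ! i)"
     and const: "\<And>a. a \<in> universe A \<Longrightarrow> available n m gs (universe A) (\<lambda>bs. a)" for C n d0 gs X
  proof -
    define v where "v j bs = (if length bs = n then node_values (alg_sem A) C (X bs) ! j else X bs ! j)" for j bs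
    have av_cong: "available n m gs (universe A) \<phi>"
      if "available n m gs (universe A) \<psi>" "\<And>bs. length bs = n \<Longrightarrow> \<phi> bs = \<psi> bs"
      for gs and \<phi> \<psi> :: "bool list \<Rightarrow> 'a"
      unfolding available_def
    proof (intro conjI ballI allI impI)
      fix a assume "a \<in> universe A"
      then have "cc_has n m gs (\<lambda>bs. \<psi> bs = a)" using that(1) by (simp add: available_def)
      then show "cc_has n m gs (\<lambda>bs. \<phi> bs = a)" by (rule cc_has_cong) (simp add: that(2))
    next
      fix bs :: "bool list" assume "length bs = n"
      then show "\<phi> bs \<in> universe A" using that by (simp add: available_def)
    qed
    have "\<exists>hs. length hs \<le> c * Suc (num_gates C) \<and> cc_ok n (d0 + d) (gs @ hs) \<and>
        (\<forall>j < num_gates C. available n m (gs @ hs) (universe A) (v j))"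
    proof (rule dc[OF ok], intro allI impI)
      fix j assume j: "j < num_gates C"
      show "available n m gs (universe A) (v j) \<or>
        (\<exists>i \<in> index A. \<exists>ps. length ps = arity A i \<and> (\<forall>p \<in> set ps. p < j) \<and>
           (\<forall>bs. length bs = n \<longrightarrow> v j bs = oper A i (map (\<lambda>p. v p bs) ps)))"
      proof (cases "j < inputs C")
        case True
        have "available n m gs (universe A) (v j)"
          by (rule av_cong[OF X(2)[OF True]])
            (use True X(1) in \<open>simp add: v_def node_values_def eval_gates_prefix\<close>)
        then show ?thesis ..
      next
        case False
        then obtain t where t: "j = inputs C + t" "t < length (gates C)"
          using j by (metis le_Suc_ex nat_add_left_cancel_less not_less num_gates_def)
        note eq = circuit_node_equation[OF C t(2) X(1)]
        obtain g ps where g: "gates C ! t = (g, ps)" by (cases "gates C ! t")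
        show ?thesis
        proof (cases g)
          case (Elem a)
          have "ps = []" "a \<in> universe A"
            using C t(2) g Elem by (auto simp: wf_circuit_def)
          have "available n m gs (universe A) (v j)"
            by (rule av_cong[OF const[OF \<open>a \<in> universe A\<close>]])
              (use eq g Elem t(1) in \<open>fastforce simp: v_def\<close>)
          then show ?thesis ..
        next
          case (Basic i)
          have ips: "i \<in> index A" "length ps = arity A i" "\<forall>p \<in> set ps. p < j"
            using C t g Basic by (auto simp: wf_circuit_def)
          have "v j bs = oper A i (map (\<lambda>p. v p bs) ps)" if "length bs = n" for bs
            using eq[OF that] g Basic t(1) that by (auto simp: v_def)
          then show ?thesis using ips by blast
        qed
      qed
    qed
    then obtain hs where hs: "length hs \<le> c * Suc (num_gates C)" "cc_ok n (d0 + d) (gs @ hs)"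
        "\<And>j. j < num_gates C \<Longrightarrow> available n m (gs @ hs) (universe A) (v j)" by blast
    have "available n m (gs @ hs) (universe A) (\<lambda>bs. circuit_value (alg_sem A) C (X bs))"
      by (rule av_cong[OF hs(3), of "output_node C"]) (use C in \<open>auto simp: wf_circuit_def v_def circuit_value_def\<close>)
    then show ?thesis using hs by blast
  qed
  then show ?thesis unfolding simulates_within_def by blast
qed

definition support :: "'a \<Rightarrow> 'a list \<Rightarrow> nat set" where
  "support z xs = {i. i < length xs \<and> xs ! i \<noteq> z}"

lemma finite_support [simp]: "finite (support z xs)"
  by (rule finite_subset[of _ "{..<length xs}"]) (auto simp: support_def)

text \<open>Along a solution \<open>xs\<close> of minimal support, switching inputs between \<open>z\<close> and the entries of \<open>xs\<close>
  turns the predicate into the AND of as many inputs as the support has elements.\<close>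

lemma minimal_solution_and:
  assumes A: "finite (universe A)" and sim: "simulable A m" and z: "z \<in> universe A"
    and m: "2 ^ (2 * card (universe A)) < m"
  shows "\<exists>d D. \<forall>C C' b xs. (C, C') \<in> circuit_pairs A \<longrightarrow> xs \<in> tuples (inputs C) (universe A) \<longrightarrow>
     ((circuit_value (alg_sem A) C xs = circuit_value (alg_sem A) C' xs) = b) \<longrightarrow>
     (\<forall>ys \<in> tuples (inputs C) (universe A).
        ((circuit_value (alg_sem A) C ys = circuit_value (alg_sem A) C' ys) = b) \<longrightarrow>
        card (support z xs) \<le> card (support z ys)) \<longrightarrow>
     (\<exists>B. cc_circuit B \<and> circuit_depth B \<le> d \<and> computes_AND m (card (support z xs)) B \<and>
        num_gates B \<le> D * (num_gates C + num_gates C' + 1))"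
proof -
  define a where "a = card (universe A)"
  have a: "a \<ge> 1" using z A by (auto simp: a_def Suc_le_eq card_gt_0_iff)
  obtain d c where "simulates_within A m d c"
    using simulates_within[OF sim] by blast
  note dc = this[unfolded simulates_within_def, rule_format]
  \<comment> \<open>One summand each for the Boolean inputs, for the tests of \<open>X\<close> and
    of constants, for the two simulations, and for the final comparison.\<close>
  define D where "D = 1 + dnf_size 1 * (a * a) + 2 * c + dnf_size (2 * a) * 2"
  show ?thesis
  proof (rule exI[of _ "8 + 2 * d"], rule exI[of _ D], intro allI impI)
    fix C C' b xs
    assume pair: "(C, C') \<in> circuit_pairs A" and xs: "xs \<in> tuples (inputs C) (universe A)"
      and sol: "(circuit_value (alg_sem A) C xs = circuit_value (alg_sem A) C' xs) = b"
      and minimal: "\<forall>ys \<in> tuples (inputs C) (universe A).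
        ((circuit_value (alg_sem A) C ys = circuit_value (alg_sem A) C' ys) = b) \<longrightarrow>
        card (support z xs) \<le> card (support z ys)"
    have wf: "wf_circuit (alg_fan_in_ok A) C" "wf_circuit (alg_fan_in_ok A) C'" "inputs C' = inputs C"
      using pair by (auto simp: circuit_pairs_def)
    let ?n = "inputs C" and ?k = "card (support z xs)"
    have len: "length xs = ?n" using xs by (simp add: tuples_def)
    \<comment> \<open>Each element of the support gets its own input of the AND.\<close>
    obtain pos where pos: "bij_betw pos (support z xs) {..<?k}"
      using ex_bij_betw_finite_nat[of "support z xs"] by (auto simp: atLeast0LessThan)
    define X where "X bs = map (\<lambda>i. if i \<in> support z xs \<and> bs ! pos i then xs ! i else z) [0..<?n]" for bs
    have X: "length (X bs) = ?n" "X bs \<in> tuples ?n (universe A)" for bs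
      using xs z by (auto simp: X_def tuples_def)
    have pos_lt: "pos i < ?k" if "i \<in> support z xs" for i
      using pos that by (auto simp: bij_betw_def)
    \<comment> \<open>A test on an entry of \<open>X\<close> depends on at most one Boolean input,
      and a test on a constant on none, so both are functions of at most one bit.\<close>
    define G where "G = (\<lambda>(i, x) bs. X bs ! i = x) ` ({..<?n} \<times> universe A) \<union>
        (\<lambda>(y, x) (bs :: bool list). y = x) ` (universe A \<times> universe A)"
    have cG: "card G \<le> ?n * a + a * a"
      unfolding G_def a_def using A
      by (intro order_trans[OF card_Un_le] add_mono order_trans[OF card_image_le]) (auto simp: card_cartesian_product)
    have ok0: "cc_ok ?k 0 []" by (simp add: cc_ok_def)
    have "\<exists>hs. length hs \<le> (1 + 2 ^ Suc 1 + 2) * card G \<and> cc_ok ?k (0 + 4) ([] @ hs) \<and>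
        (\<forall>g \<in> G. cc_has ?k m ([] @ hs) g)"
    proof (rule cc_add_determined[OF ok0])
      have "(2 :: nat) ^ 1 \<le> 2 ^ (2 * card (universe A))" using a by (intro power_increasing) (auto simp: a_def)
      then show "2 ^ 1 < m" using m by linarith
      show "finite G" using A by (auto simp: G_def)
      fix g assume "g \<in> G"
      then consider i x where "i < ?n" "g = (\<lambda>bs. X bs ! i = x)" | y x :: 'a where "g = (\<lambda>bs. y = x)"
        unfolding G_def
      proof (elim UnE imageE)
        fix p assume "g = (case p of (i, x) \<Rightarrow> \<lambda>bs. X bs ! i = x)" "p \<in> {..<?n} \<times> universe A"
        then show thesis by (intro that(1)[of "fst p" "snd p"]) (auto simp: case_prod_beta)
      next
        fix p :: "'a \<times> 'a" assume "g = (case p of (y, x) \<Rightarrow> \<lambda>bs. y = x)"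
        then show thesis by (intro that(2)[of "fst p" "snd p"]) (auto simp: case_prod_beta)
      qed
      then show "\<exists>fs. length fs \<le> 1 \<and> (\<forall>f\<in>set fs. cc_has ?k m [] f) \<and> determined_by ?k (set fs) g"
      proof cases
        case 1
        then show ?thesis
        proof (cases "i \<in> support z xs")
          case True
          then show ?thesis using 1 cc_has_input[OF pos_lt[OF True], of m "[]"]
            by (intro exI[of _ "[\<lambda>bs. bs ! pos i]"]) (auto simp: determined_by_def X_def)
        next
          case False
          then show ?thesis using 1 by (intro exI[of _ "[]"]) (auto simp: determined_by_def X_def)
        qed
      next
        case 2
        then show ?thesis by (intro exI[of _ "[]"]) (auto simp: determined_by_def)
      qed
    qed
    then obtain h1 where h1: "length h1 \<le> dnf_size 1 * card G" "cc_ok ?k 4 h1" "\<And>g. g \<in> G \<Longrightarrow> cc_has ?k m h1 g"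
      by (auto simp: dnf_size_def)
    have avX: "available ?k m h1 (universe A) (\<lambda>bs. X bs ! i)" if "i < ?n" for i
      unfolding available_def
    proof (intro conjI ballI allI impI)
      fix x assume "x \<in> universe A"
      then have "(\<lambda>bs. X bs ! i = x) \<in> G"
        unfolding G_def by (intro UnI1 image_eqI[of _ _ "(i, x)"]) (use that in auto)
      then show "cc_has ?k m h1 (\<lambda>bs. X bs ! i = x)" by (rule h1(3))
    next
      fix bs show "X bs ! i \<in> universe A" using X(2)[of bs] that by (auto simp: tuples_def)
    qed
    have avc: "available ?k m h1 (universe A) (\<lambda>bs. y)" if "y \<in> universe A" for y
      unfolding available_def
    proof (intro conjI ballI allI impI)
      fix x assume "x \<in> universe A"
      then have "(\<lambda>bs. y = x) \<in> G"
        unfolding G_def by (intro UnI2 image_eqI[of _ _ "(y, x)"]) (use that in auto)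
      then show "cc_has ?k m h1 (\<lambda>bs. y = x)" by (rule h1(3))
    qed (rule that)
    obtain h2 where h2: "length h2 \<le> c * Suc (num_gates C)" "cc_ok ?k (4 + d) (h1 @ h2)"
        "available ?k m (h1 @ h2) (universe A) (\<lambda>bs. circuit_value (alg_sem A) C (X bs))"
      using dc[OF wf(1) h1(2) X(1) avX avc] by blast
    obtain h3 where h3: "length h3 \<le> c * Suc (num_gates C')" "cc_ok ?k (4 + d + d) (h1 @ h2 @ h3)"
        "available ?k m (h1 @ h2 @ h3) (universe A) (\<lambda>bs. circuit_value (alg_sem A) C' (X bs))"
      using dc[OF wf(2) h2(2), of X, OF _ available_append[OF avX] available_append[OF avc]] X(1) wf(3) by auto
    define P where "P bs \<longleftrightarrow> (circuit_value (alg_sem A) C (X bs) = circuit_value (alg_sem A) C' (X bs)) = b" for bs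
    have "\<exists>hs. length hs \<le> (2 * a + 2 ^ Suc (2 * a) + 2) * card (UNIV :: bool set) * card {()} \<and>
      cc_ok ?k (4 + d + d + 4) ((h1 @ h2 @ h3) @ hs) \<and>
      (\<forall>j \<in> {()}. available ?k m ((h1 @ h2 @ h3) @ hs) UNIV P)"
    proof (rule cc_add_determined_values[OF h3(2)])
      show "\<exists>\<phi>s :: ('a set \<times> (bool list \<Rightarrow> 'a)) list. length \<phi>s \<le> 2 \<and>
         (\<forall>(V, \<phi>) \<in> set \<phi>s. finite V \<and> card V \<le> a \<and> available ?k m (h1 @ h2 @ h3) V \<phi>) \<and>
         determined_by ?k (snd ` set \<phi>s) P"
        using A h3(3) available_append[OF h2(3), of h3]
        by (intro exI[of _ "[(universe A, \<lambda>bs. circuit_value (alg_sem A) C (X bs)),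
            (universe A, \<lambda>bs. circuit_value (alg_sem A) C' (X bs))]"])
          (auto simp: a_def determined_by_def P_def)
    qed (use m in \<open>auto simp: a_def\<close>)
    then obtain h4 where "length h4 \<le> (2 * a + 2 ^ Suc (2 * a) + 2) * card (UNIV :: bool set) * card {()}"
        "cc_ok ?k (4 + d + d + 4) ((h1 @ h2 @ h3) @ h4)" "available ?k m ((h1 @ h2 @ h3) @ h4) UNIV P"
      by blast
    moreover have "4 + d + d + 4 = 8 + 2 * d" by simp
    moreover have card_1: "card {()} = 1" by simp
    ultimately have h4: "length h4 \<le> dnf_size (2 * a) * 2" "cc_ok ?k (8 + 2 * d) (h1 @ h2 @ h3 @ h4)"
        "available ?k m (h1 @ h2 @ h3 @ h4) UNIV P"
      by (simp_all only: dnf_size_def append_assoc card_UNIV_bool card_1 mult_1_right)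
    let ?gs = "h1 @ h2 @ h3 @ h4"
    have "cc_has ?k m ?gs (\<lambda>bs. P bs = True)" using h4(3) unfolding available_def by blast
    then obtain out where out: "out < ?k + length ?gs"
       "\<And>bs. length bs = ?k \<Longrightarrow> eval_gates (cc_sem m) ?gs bs ! out = P bs"
      unfolding cc_has_def by auto
    define B where "B = \<lparr>inputs = ?k, gates = ?gs, output_node = out\<rparr>"
    have "cc_circuit B" using h4(2) out(1) by (auto simp: B_def wf_circuit_def cc_ok_def num_gates_def)
    moreover have "circuit_depth B \<le> 8 + 2 * d"
    proof -
      have "circuit_depth B = Max (set (eval_gates depth_sem ?gs (replicate ?k 0)))"
        by (simp add: circuit_depth_def B_def node_values_def depth_sem_def)
      moreover have "0 < length (eval_gates depth_sem ?gs (replicate ?k 0))"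
        using out(1) by (simp only: length_eval_gates length_replicate)
      then have "set (eval_gates depth_sem ?gs (replicate ?k 0)) \<noteq> {}"
        by (simp only: length_greater_0_conv set_empty not_False_eq_True)
      ultimately show ?thesis using h4(2) by (simp add: cc_ok_def)
    qed
    moreover have "computes_AND m ?k B"
      unfolding computes_AND_def
    proof (intro conjI allI impI)
      show "inputs B = ?k" by (simp add: B_def)
      fix bs :: "bool list" assume bs: "length bs = ?k"
      have "circuit_value (cc_sem m) B bs = P bs"
        using out(2)[OF bs] by (simp add: circuit_value_def node_values_def B_def)
      also have "\<dots> \<longleftrightarrow> (\<forall>b \<in> set bs. b)"
      proof
        assume all: "\<forall>b \<in> set bs. b"
        have "X bs = xs"
        proof (rule nth_equalityI)
          fix i assume "i < length (X bs)"
          then have i: "i < ?n" by (simp add: X)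
          show "X bs ! i = xs ! i"
          proof (cases "i \<in> support z xs")
            case True
            then have "bs ! pos i" using all pos_lt[OF True] bs by (metis nth_mem)
            then show ?thesis using i True by (simp add: X_def)
          next
            case False
            then show ?thesis using i len by (simp add: X_def support_def)
          qed
        qed (simp add: X len)
        then show "P bs" using sol by (simp add: P_def)
      next
        assume "P bs"
        \<comment> \<open>Minimality enters here: the support of \<open>X bs\<close> lies inside
          that of \<open>xs\<close> and is not smaller, so no entry has been switched to
          \<open>z\<close>.\<close>
        then have le: "?k \<le> card (support z (X bs))" using minimal X(2) by (auto simp: P_def)
        have sub: "support z (X bs) \<subseteq> {i \<in> support z xs. bs ! pos i}"
          using len by (auto simp: support_def X_def split: if_splits)
        then have "support z (X bs) = support z xs"
          using le by (intro card_seteq) auto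
        with sub have *: "bs ! pos i" if "i \<in> support z xs" for i using that by auto
        show "\<forall>b \<in> set bs. b"
        proof
          fix b assume "b \<in> set bs"
          then obtain p where p: "p < ?k" "b = bs ! p" by (metis bs in_set_conv_nth)
          then obtain i where "i \<in> support z xs" "pos i = p"
            using pos by (metis bij_betw_imp_surj_on imageE lessThan_iff)
          then show b using * p by auto
        qed
      qed
      finally show "circuit_value (cc_sem m) B bs = (\<forall>b \<in> set bs. b)" .
    qed
    moreover have "num_gates B \<le> D * (num_gates C + num_gates C' + 1)"
    proof -
      let ?N = "num_gates C + num_gates C' + 1"
      have nN: "?n + 1 \<le> ?N" by (simp add: num_gates_def)
      have "support z xs \<subseteq> {..<?n}" using len by (auto simp: support_def)
      then have "?k \<le> card {..<?n}" by (intro card_mono) auto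
      then have k: "?k \<le> ?N" using nN by simp
      have "?n * a + a * a \<le> ?n * (a * a) + 1 * (a * a)" using a by (intro add_mono mult_le_mono2) auto
      also have "\<dots> = (?n + 1) * (a * a)" by (simp add: algebra_simps)
      also have "\<dots> \<le> ?N * (a * a)" by (rule mult_le_mono1[OF nN])
      finally have g: "dnf_size 1 * card G \<le> dnf_size 1 * (?N * (a * a))"
        using cG by (intro mult_le_mono2) linarith
      have "num_gates B = ?k + length h1 + length h2 + length h3 + length h4"
        by (simp add: num_gates_def B_def)
      also have "\<dots> \<le> ?N + dnf_size 1 * (?N * (a * a)) + (c * Suc (num_gates C) + c * Suc (num_gates C'))
          + dnf_size (2 * a) * 2"
        using k h1(1) g h2(1) h3(1) h4(1) by linarith
      also have "\<dots> \<le> ?N + dnf_size 1 * (?N * (a * a)) + 2 * c * ?N + dnf_size (2 * a) * 2 * ?N"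
        by (intro add_mono) (auto simp: algebra_simps)
      also have "\<dots> = D * ?N" by (simp add: D_def algebra_simps)
      finally show ?thesis .
    qed
    ultimately show "\<exists>B. cc_circuit B \<and> circuit_depth B \<le> 8 + 2 * d \<and> computes_AND m ?k B \<and>
        num_gates B \<le> D * (num_gates C + num_gates C' + 1)" by blast
  qed
qed

text \<open>The number of binary digits of \<open>N\<close>, a logarithm that the machine can
  compute by repeated halving.\<close>

definition bit_length :: "nat \<Rightarrow> nat" where
  "bit_length N = (LEAST k. N < 2 ^ k)"

lemma bit_length: "N < 2 ^ bit_length N"
  unfolding bit_length_def by (rule LeastI[of _ N]) simp

lemma bit_length_le: "k < bit_length N \<Longrightarrow> 2 ^ k \<le> N"
  unfolding bit_length_def using not_less_Least by (metis not_le)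

lemma bit_length_ge_2: "2 \<le> N \<Longrightarrow> 2 \<le> bit_length N"
proof (rule ccontr)
  assume "2 \<le> N" "\<not> 2 \<le> bit_length N"
  then have "(2 :: nat) ^ bit_length N \<le> 2 ^ 1" by (intro power_increasing) auto
  then show False using bit_length[of N] \<open>2 \<le> N\<close> by simp
qed

text \<open>The exponent \<open>r\<close> is the same for all circuits. Both values of
  \<open>b\<close> are covered: solutions of the equation and counterexamples to it.\<close>

theorem sparse_solutions:
  assumes lower: "\<forall>m \<ge> 1. \<forall>C :: nat \<Rightarrow> cc_gate circuit.
       (\<exists>d. \<forall>n. cc_circuit (C n) \<and> circuit_depth (C n) \<le> d \<and> computes_AND m n (C n)) \<longrightarrow>
       (\<exists>q > 0. \<exists>g :: nat \<Rightarrow> real. g \<in> \<Omega>(\<lambda>n. real n powr q) \<and>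
          (\<forall>n. real (num_gates (C n)) = 2 powr g n))"
    and A: "finite_algebra A" "nilpotent_algebra A" and z: "z \<in> universe A"
  shows "\<exists>r. \<forall>C C' b N. (C, C') \<in> circuit_pairs A \<longrightarrow> 2 \<le> N \<longrightarrow> num_gates C + num_gates C' \<le> N \<longrightarrow>
     (\<exists>xs \<in> tuples (inputs C) (universe A).
        (circuit_value (alg_sem A) C xs = circuit_value (alg_sem A) C' xs) = b) \<longrightarrow>
     (\<exists>xs \<in> tuples (inputs C) (universe A).
        ((circuit_value (alg_sem A) C xs = circuit_value (alg_sem A) C' xs) = b) \<and>
        card (support z xs) \<le> bit_length N ^ r)"
proof -
  have fin: "finite (universe A)" "finite (index A)" using A by (auto simp: finite_algebra_def)
  obtain cl where "nilpotent_of_class cl A" using A(2) by (auto simp: nilpotent_algebra_def)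
  from nilpotent_simulable[OF this fin] obtain m0 where m0: "m0 \<ge> 1" "\<And>m. m \<ge> 1 \<Longrightarrow> m0 dvd m \<Longrightarrow> simulable A m"
    by blast
  \<comment> \<open>A multiple of \<open>m0\<close> that also exceeds
    \<open>2 ^ (2 * card (universe A))\<close>, as the comparison of two one-hot coded values
    requires.\<close>
  define m where "m = 2 ^ Suc (2 * card (universe A)) * m0"
  have m: "m \<ge> 1" "m0 dvd m" using m0(1) by (simp_all add: m_def Suc_le_eq)
  have m2: "2 ^ (2 * card (universe A)) < m"
    by (rule power_less_multiple[of _ m0]) (use m in \<open>auto simp: m_def\<close>)
  obtain d D where dD: "\<And>C C' b xs. (C, C') \<in> circuit_pairs A \<Longrightarrow> xs \<in> tuples (inputs C) (universe A) \<Longrightarrow>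
     ((circuit_value (alg_sem A) C xs = circuit_value (alg_sem A) C' xs) = b) \<Longrightarrow>
     (\<forall>ys \<in> tuples (inputs C) (universe A).
        ((circuit_value (alg_sem A) C ys = circuit_value (alg_sem A) C' ys) = b) \<longrightarrow>
        card (support z xs) \<le> card (support z ys)) \<Longrightarrow>
     (\<exists>B. cc_circuit B \<and> circuit_depth B \<le> d \<and> computes_AND m (card (support z xs)) B \<and>
        num_gates B \<le> D * (num_gates C + num_gates C' + 1))"
    using minimal_solution_and[OF fin(1) m0(2)[OF m] z m2] by blast
  obtain r where r: "\<And>k C L. cc_circuit C \<Longrightarrow> circuit_depth C \<le> d \<Longrightarrow> computes_AND m k C \<Longrightarrow> 2 \<le> L \<Longrightarrow>
      num_gates C \<le> 2 ^ L \<Longrightarrow> k \<le> L ^ r"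
    using and_fan_in_bound[of m d] lower m(1) by blast
  show ?thesis
  \<comment> \<open>With \<open>L\<close> the bit length of \<open>N\<close>, the AND circuit has at
    most \<open>D * 2 ^ L \<le> 2 ^ (L ^ Suc D)\<close> gates, so its fan-in is at most
    \<open>(L ^ Suc D) ^ r\<close>.\<close>
  proof (intro exI[of _ "Suc D * r"] allI impI)
    fix C C' b N
    let ?P = "\<lambda>xs. xs \<in> tuples (inputs C) (universe A) \<and>
        (circuit_value (alg_sem A) C xs = circuit_value (alg_sem A) C' xs) = b"
    assume pair: "(C, C') \<in> circuit_pairs A" and N: "2 \<le> N" "num_gates C + num_gates C' \<le> N"
      and ex: "\<exists>xs \<in> tuples (inputs C) (universe A).
        (circuit_value (alg_sem A) C xs = circuit_value (alg_sem A) C' xs) = b"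
    obtain xs where xs: "?P xs" "\<forall>ys. ?P ys \<longrightarrow> card (support z xs) \<le> card (support z ys)"
      using ex_has_least_nat[of ?P _ "\<lambda>xs. card (support z xs)"] ex by blast
    then obtain B where B: "cc_circuit B" "circuit_depth B \<le> d" "computes_AND m (card (support z xs)) B"
        "num_gates B \<le> D * (num_gates C + num_gates C' + 1)"
      using dD[OF pair, of xs b] by blast
    let ?L = "bit_length N"
    have L: "2 \<le> ?L" by (rule bit_length_ge_2[OF N(1)])
    have "num_gates B \<le> D * 2 ^ ?L"
      using B(4) N(2) bit_length[of N] by (elim order_trans, intro mult_le_mono2) linarith
    also have "\<dots> \<le> 2 ^ D * 2 ^ ?L" by (intro mult_le_mono1) (simp add: less_imp_le)
    also have "\<dots> = 2 ^ (D + ?L)" by (simp add: power_add)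
    also have "\<dots> \<le> 2 ^ (?L ^ Suc D)"
    proof (rule power_increasing)
      have "Suc D \<le> 2 ^ D" by (simp add: Suc_le_eq)
      also have "\<dots> \<le> ?L ^ D" using L by (rule power_mono) simp
      finally have "?L * Suc D \<le> ?L * ?L ^ D" by (rule mult_le_mono2)
      moreover have "1 * D \<le> ?L * D" using L by (intro mult_le_mono1) simp
      then have "D + ?L \<le> ?L * Suc D" by simp
      ultimately show "D + ?L \<le> ?L ^ Suc D" unfolding power_Suc by linarith
    qed simp
    finally have nB: "num_gates B \<le> 2 ^ (?L ^ Suc D)" .
    have "2 \<le> ?L ^ Suc D" using L self_le_power[of ?L "Suc D"] by linarith
    from r[OF B(1-3) this nB] have "card (support z xs) \<le> ?L ^ (Suc D * r)" by (simp only: power_mult)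
    then show "\<exists>xs \<in> tuples (inputs C) (universe A).
        ((circuit_value (alg_sem A) C xs = circuit_value (alg_sem A) C' xs) = b) \<and>
        card (support z xs) \<le> ?L ^ (Suc D * r)" using xs(1) by blast
  qed
qed

section \<open>Programs on stacks and their Turing machines\<close>

fun peek :: "'s symbol list \<Rightarrow> 's symbol" where
  "peek [] = Blank"
| "peek (x # xs) = x"

text \<open>Tests and symbol functions are arbitrary, since a transition function can tabulate them
  on a finite alphabet. Only the tops of stacks are visible, as only the cells under the heads
  are.\<close>

datatype 's com =
    Skip
  | Pop nat
  | Push nat nat "'s symbol \<Rightarrow> 's symbol"
  | Upd nat nat "'s symbol \<Rightarrow> 's symbol \<Rightarrow> 's symbol"
  | Seq "'s com" "'s com" (infixr ";;" 60)
  | Branch nat "'s symbol \<Rightarrow> bool" "'s com" "'s com"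
  | Loop nat "'s symbol \<Rightarrow> bool" "'s com"

text \<open>The number \<open>t\<close> in \<open>exec c s t s'\<close> counts the steps of the compiled program, which needs two
  of them for \<open>Push\<close>, and one for each jump of \<open>Branch\<close> and \<open>Loop\<close>.\<close>

inductive exec :: "'s com \<Rightarrow> (nat \<Rightarrow> 's symbol list) \<Rightarrow> nat \<Rightarrow> (nat \<Rightarrow> 's symbol list) \<Rightarrow> bool" where
  "exec Skip s 0 s"
| "exec (Pop i) s 1 (s(i := tl (s i)))"
| "i \<noteq> j \<Longrightarrow> exec (Push i j f) s 2 (s(i := f (peek (s j)) # s i))"
| "s i \<noteq> [] \<Longrightarrow> exec (Upd i j f) s 1 (s(i := f (peek (s i)) (peek (s j)) # tl (s i)))"
| "exec c1 s t1 s1 \<Longrightarrow> exec c2 s1 t2 s2 \<Longrightarrow> exec (c1 ;; c2) s (t1 + t2) s2"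
| "P (peek (s i)) \<Longrightarrow> exec c1 s t s' \<Longrightarrow> exec (Branch i P c1 c2) s (1 + t + 1) s'"
| "\<not> P (peek (s i)) \<Longrightarrow> exec c2 s t s' \<Longrightarrow> exec (Branch i P c1 c2) s (1 + t) s'"
| "\<not> P (peek (s i)) \<Longrightarrow> exec (Loop i P c) s 1 s"
| "P (peek (s i)) \<Longrightarrow> exec c s t s1 \<Longrightarrow> exec (Loop i P c) s1 t' s2 \<Longrightarrow> exec (Loop i P c) s (1 + t + 1 + t') s2"

datatype 's instr =
    IPop nat
  | ILeft nat
  | IWrite nat nat "'s symbol \<Rightarrow> 's symbol \<Rightarrow> 's symbol"
  | IJmpN nat "'s symbol \<Rightarrow> bool" nat
  | IJmp nat

fun csize :: "'s com \<Rightarrow> nat" where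
  "csize Skip = 0"
| "csize (Pop i) = 1"
| "csize (Push i j f) = 2"
| "csize (Upd i j f) = 1"
| "csize (c1 ;; c2) = csize c1 + csize c2"
| "csize (Branch i P c1 c2) = csize c1 + csize c2 + 2"
| "csize (Loop i P c) = csize c + 2"

text \<open>Jump targets are absolute, so the address \<open>a\<close> of the first instruction is
  passed down; \<open>csize\<close> gives lengths in advance.\<close>

fun compile :: "nat \<Rightarrow> 's com \<Rightarrow> 's instr list" where
  "compile a Skip = []"
| "compile a (Pop i) = [IPop i]"
| "compile a (Push i j f) = [ILeft i, IWrite i j (\<lambda>_. f)]"
| "compile a (Upd i j f) = [IWrite i j f]"
| "compile a (c1 ;; c2) = compile a c1 @ compile (a + csize c1) c2"
| "compile a (Branch i P c1 c2) = IJmpN i P (a + csize c1 + 2) # compile (a + 1) c1 @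
     IJmp (a + csize c1 + 2 + csize c2) # compile (a + csize c1 + 2) c2"
| "compile a (Loop i P c) = IJmpN i P (a + csize c + 2) # compile (a + 1) c @ [IJmp a]"

lemma length_compile [simp]: "length (compile a c) = csize c"
  by (induction c arbitrary: a) auto

fun wf_com :: "'s symbol set \<Rightarrow> nat \<Rightarrow> 's com \<Rightarrow> bool" where
  "wf_com \<Sigma> k Skip \<longleftrightarrow> True"
| "wf_com \<Sigma> k (Pop i) \<longleftrightarrow> i < k"
| "wf_com \<Sigma> k (Push i j f) \<longleftrightarrow> i < k \<and> j < k \<and> (\<forall>y \<in> \<Sigma>. f y \<in> \<Sigma>)"
| "wf_com \<Sigma> k (Upd i j f) \<longleftrightarrow> i < k \<and> j < k \<and> (\<forall>x \<in> \<Sigma>. \<forall>y \<in> \<Sigma>. f x y \<in> \<Sigma>)"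
| "wf_com \<Sigma> k (c1 ;; c2) \<longleftrightarrow> wf_com \<Sigma> k c1 \<and> wf_com \<Sigma> k c2"
| "wf_com \<Sigma> k (Branch i P c1 c2) \<longleftrightarrow> i < k \<and> wf_com \<Sigma> k c1 \<and> wf_com \<Sigma> k c2"
| "wf_com \<Sigma> k (Loop i P c) \<longleftrightarrow> i < k \<and> wf_com \<Sigma> k c"

fun wf_instr :: "'s symbol set \<Rightarrow> nat \<Rightarrow> 's instr \<Rightarrow> bool" where
  "wf_instr \<Sigma> k (IPop i) \<longleftrightarrow> i < k"
| "wf_instr \<Sigma> k (ILeft i) \<longleftrightarrow> i < k"
| "wf_instr \<Sigma> k (IWrite i j f) \<longleftrightarrow> i < k \<and> j < k \<and> (\<forall>x \<in> \<Sigma>. \<forall>y \<in> \<Sigma>. f x y \<in> \<Sigma>)"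
| "wf_instr \<Sigma> k (IJmpN i P a) \<longleftrightarrow> i < k"
| "wf_instr \<Sigma> k (IJmp a) \<longleftrightarrow> True"

lemma wf_compile: "wf_com \<Sigma> k c \<Longrightarrow> ins \<in> set (compile a c) \<Longrightarrow> wf_instr \<Sigma> k ins"
  by (induction c arbitrary: a) auto

section \<open>The machine of a program\<close>

definition keep :: "'s symbol list \<Rightarrow> ('s symbol \<times> move) list" where
  "keep ss = map (\<lambda>x. (x, Move_none)) ss"

fun act :: "'s instr \<Rightarrow> nat \<Rightarrow> 's symbol list \<Rightarrow> nat \<times> ('s symbol \<times> move) list" where
  "act (IPop i) q ss = (q + 1, (keep ss)[i := (Blank, Move_right)])"
| "act (ILeft i) q ss = (q + 1, (keep ss)[i := (ss ! i, Move_left)])"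
| "act (IWrite i j f) q ss = (q + 1, (keep ss)[i := (f (ss ! i) (ss ! j), Move_none)])"
| "act (IJmpN i P a) q ss = (if P (ss ! i) then q + 1 else a, keep ss)"
| "act (IJmp a) q ss = (a, keep ss)"

text \<open>States are program counters. State \<open>length prog\<close> reads the verdict from
  tape \<open>r\<close>, and the two states after it accept and reject; \<open>min\<close> keeps all
  jump targets inside the state set.\<close>

definition stack_tm :: "nat \<Rightarrow> 's symbol set \<Rightarrow> 's instr list \<Rightarrow> nat \<Rightarrow> 's symbol \<Rightarrow> 's tm" where
  "stack_tm k \<Sigma> prog r yes = \<lparr>num_tapes = k, symbols = \<Sigma>, states = {..length prog + 2},
     start_state = 0, accept_state = length prog + 1, reject_state = length prog + 2,
     transition = (\<lambda>q ss. if q < length prog then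
         (case act (prog ! q) q ss of (q', as) \<Rightarrow> (min q' (length prog), as))
       else if q = length prog then (if ss ! r = yes then length prog + 1 else length prog + 2, keep ss)
       else (q, keep ss))\<rparr>"

lemma act_wf:
  assumes "wf_instr \<Sigma> k ins" "Blank \<in> \<Sigma>" "ss \<in> tuples k \<Sigma>"
  shows "length (snd (act ins q ss)) = k" "fst ` set (snd (act ins q ss)) \<subseteq> \<Sigma>"
proof -
  have ss: "length ss = k" "set ss \<subseteq> \<Sigma>" "\<And>i. i < k \<Longrightarrow> ss ! i \<in> \<Sigma>"
    using assms(3) by (auto simp: tuples_def)
  show "length (snd (act ins q ss)) = k" using ss by (cases ins) (auto simp: keep_def)
  have keep: "fst ` set ((keep ss)[i := (x, d)]) \<subseteq> \<Sigma>" if "x \<in> \<Sigma>" for i x d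
  proof -
    have "fst ` set ((keep ss)[i := (x, d)]) \<subseteq> fst ` insert (x, d) (set (keep ss))"
      by (rule image_mono[OF set_update_subset_insert])
    also have "\<dots> \<subseteq> \<Sigma>" using ss(2) that by (auto simp: keep_def)
    finally show ?thesis .
  qed
  have "fst ` set (keep ss) \<subseteq> \<Sigma>" using ss(2) by (auto simp: keep_def)
  then show "fst ` set (snd (act ins q ss)) \<subseteq> \<Sigma>"
    using assms(1,2) ss keep by (cases ins) auto
qed

lemma stack_tm_wf:
  assumes "k \<ge> 1" "finite \<Sigma>" "Blank \<in> \<Sigma>" and wf: "\<And>ins. ins \<in> set prog \<Longrightarrow> wf_instr \<Sigma> k ins"
  shows "turing_machine (stack_tm k \<Sigma> prog r yes)"
proof -
  have "fst (transition (stack_tm k \<Sigma> prog r yes) q ss) \<le> length prog + 2 \<and>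
      length (snd (transition (stack_tm k \<Sigma> prog r yes) q ss)) = k \<and>
      fst ` set (snd (transition (stack_tm k \<Sigma> prog r yes) q ss)) \<subseteq> \<Sigma>"
    if q: "q \<le> length prog + 2" and ss: "ss \<in> tuples k \<Sigma>" for q ss
  proof (cases "q < length prog")
    case True
    then show ?thesis using act_wf[OF wf[OF nth_mem[OF True]] assms(3) ss, of q]
      by (cases "act (prog ! q) q ss") (simp add: stack_tm_def)
  next
    case False
    then show ?thesis using q ss by (auto simp: stack_tm_def keep_def tuples_def)
  qed
  then show ?thesis using assms unfolding turing_machine_def by (simp add: stack_tm_def)
qed

text \<open>The head is on the top of the stack, and the stack grows to the left. So a tape with an input
  word is a stack with its first letter on top.\<close>

definition tape_rep :: "'s tape \<Rightarrow> 's symbol list \<Rightarrow> bool" where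
  "tape_rep T xs \<longleftrightarrow> (\<forall>p. fst T p =
     (if snd T \<le> p \<and> p < snd T + int (length xs) then xs ! nat (p - snd T) else Blank))"

definition tapes_rep :: "nat \<Rightarrow> 's tape list \<Rightarrow> (nat \<Rightarrow> 's symbol list) \<Rightarrow> bool" where
  "tapes_rep k ts s \<longleftrightarrow> length ts = k \<and> (\<forall>i < k. tape_rep (ts ! i) (s i))"

lemma read_tape_rep: "tape_rep T xs \<Longrightarrow> read_tape T = peek xs"
  by (cases xs) (auto simp: tape_rep_def read_tape_def split_beta)

lemma read_tapes_rep: "tapes_rep k ts s \<Longrightarrow> i < k \<Longrightarrow> map read_tape ts ! i = peek (s i)"
  by (simp add: tapes_rep_def read_tape_rep)

lemma update_keep: "map2 update_tape (keep (map read_tape ts)) ts = ts"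
  by (rule nth_equalityI) (auto simp: keep_def update_tape_def read_tape_def split_beta)

lemma update_keep_upd:
  assumes "i < length ts"
  shows "map2 update_tape ((keep (map read_tape ts))[i := a]) ts = ts[i := update_tape a (ts ! i)]"
  by (rule nth_equalityI)
    (use assms in \<open>auto simp: keep_def update_tape_def read_tape_def split_beta nth_list_update\<close>)

lemma tapes_rep_upd:
  "tapes_rep k ts s \<Longrightarrow> i < k \<Longrightarrow> tape_rep T xs \<Longrightarrow> tapes_rep k (ts[i := T]) (s(i := xs))"
  by (auto simp: tapes_rep_def nth_list_update)

lemma tape_rep_pop: "tape_rep T xs \<Longrightarrow> tape_rep (update_tape (Blank, Move_right) T) (tl xs)"
  by (cases xs) (auto simp: tape_rep_def update_tape_def split_beta nth_Cons' nat_diff_distrib' Suc_nat_eq_nat_zadd1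
      intro!: arg_cong2[of _ _ _ _ "(!)"])

lemma tape_rep_push:
  "tape_rep T xs \<Longrightarrow> tape_rep (update_tape (x, Move_none) (update_tape (read_tape T, Move_left) T)) (x # xs)"
  by (auto simp: tape_rep_def update_tape_def read_tape_def split_beta nth_Cons'
      intro!: arg_cong2[of _ _ _ _ "(!)"])

lemma tape_rep_write:
  "tape_rep T xs \<Longrightarrow> xs \<noteq> [] \<Longrightarrow> tape_rep (update_tape (x, Move_none) T) (x # tl xs)"
  by (cases xs) (auto simp: tape_rep_def update_tape_def split_beta nth_Cons')

context
  fixes k :: nat and \<Sigma> :: "'s symbol set" and prog :: "'s instr list" and r :: nat and yes :: "'s symbol"
begin


lemma step_act:
  assumes "q < length prog" "act (prog ! q) q (map read_tape ts) = (q', as)" "q' \<le> length prog"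
  shows "tm_step (stack_tm k \<Sigma> prog r yes) (q, ts) = (q', map2 update_tape as ts)"
  using assms by (simp add: tm_step_def stack_tm_def)

lemma step_jmp:
  assumes "q < length prog" "prog ! q = IJmp a" "a \<le> length prog"
  shows "tm_step (stack_tm k \<Sigma> prog r yes) (q, ts) = (a, ts)"
  using step_act[of q ts a "keep (map read_tape ts)"] assms by (simp add: update_keep)

lemma step_jmpn:
  assumes "q < length prog" "prog ! q = IJmpN i P a" "a \<le> length prog" "tapes_rep k ts s" "i < k"
  shows "tm_step (stack_tm k \<Sigma> prog r yes) (q, ts) = (if P (peek (s i)) then Suc q else a, ts)"
  using step_act[of q ts "if P (peek (s i)) then Suc q else a" "keep (map read_tape ts)"] assms
    read_tapes_rep[OF assms(4,5)] by (simp add: update_keep)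

lemma step_change:
  assumes "q < length prog" "act (prog ! q) q (map read_tape ts) = (Suc q, (keep (map read_tape ts))[i := a])"
    "i < length ts"
  shows "tm_step (stack_tm k \<Sigma> prog r yes) (q, ts) = (Suc q, ts[i := update_tape a (ts ! i)])"
  using step_act[OF assms(1,2)] assms(1,3) by (simp add: update_keep_upd)

lemma funpow_add_apply: "(f ^^ a) x = y \<Longrightarrow> (f ^^ b) y = z \<Longrightarrow> (f ^^ (a + b)) x = z"
  by (metis add.commute comp_apply funpow_add)

text \<open>The step count is exact. The code sits between arbitrary \<open>pre\<close> and
  \<open>post\<close>, so that the induction hypotheses apply to subprograms at their own
  addresses.\<close>

lemma exec_compile:
  assumes "exec c s t s'" "wf_com \<Sigma> k c" "prog = pre @ compile (length pre) c @ post" "tapes_rep k ts s"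
  shows "\<exists>ts'. (tm_step (stack_tm k \<Sigma> prog r yes) ^^ t) (length pre, ts) = (length pre + csize c, ts') \<and> tapes_rep k ts' s'"
  using assms
proof (induction arbitrary: pre post ts rule: exec.induct)
  case (1 s)
  then show ?case by simp
next
  case (2 i s)
  have i: "i < length ts" using 2 by (simp add: tapes_rep_def)
  have "tm_step (stack_tm k \<Sigma> prog r yes) (length pre, ts) = (Suc (length pre), ts[i := update_tape (Blank, Move_right) (ts ! i)])"
    by (rule step_change) (use 2 i in \<open>auto simp: nth_append\<close>)
  moreover have "tapes_rep k (ts[i := update_tape (Blank, Move_right) (ts ! i)]) (s(i := tl (s i)))"
    using 2 by (intro tapes_rep_upd tape_rep_pop) (auto simp: tapes_rep_def)
  ultimately show ?case by (simp add: fun_upd_def)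
next
  case (3 i j f s)
  have i: "i < length ts" "length ts = k" "j < k" using 3 by (auto simp: tapes_rep_def)
  let ?T = "update_tape (read_tape (ts ! i), Move_left) (ts ! i)"
  let ?ts = "ts[i := ?T]"
  have 1: "tm_step (stack_tm k \<Sigma> prog r yes) (length pre, ts) = (Suc (length pre), ?ts)"
    by (rule step_change) (use 3 i in \<open>auto simp: nth_append\<close>)
  \<comment> \<open>Between the two steps the head of tape \<open>i\<close> stands on a cell outside
    its stack; as \<open>i \<noteq> j\<close>, tape \<open>j\<close> still shows its top.\<close>
  have rj: "map read_tape ?ts ! j = peek (s j)"
    using read_tapes_rep[OF "3.prems"(3)] i 3(1) by (simp add: nth_list_update)
  have "tm_step (stack_tm k \<Sigma> prog r yes) (Suc (length pre), ?ts) =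
      (Suc (Suc (length pre)), ?ts[i := update_tape (f (peek (s j)), Move_none) (?ts ! i)])"
    by (rule step_change) (use 3 i rj in \<open>auto simp: nth_append\<close>)
  then have 2: "tm_step (stack_tm k \<Sigma> prog r yes) (Suc (length pre), ?ts) =
      (Suc (Suc (length pre)), ts[i := update_tape (f (peek (s j)), Move_none) ?T])"
    using i by simp
  have "tapes_rep k (ts[i := update_tape (f (peek (s j)), Move_none) ?T]) (s(i := f (peek (s j)) # s i))"
    using 3 by (intro tapes_rep_upd tape_rep_push) (auto simp: tapes_rep_def)
  then show ?case using 1 2 by (simp add: numeral_2_eq_2 fun_upd_def)
next
  case (4 s i j f)
  have i: "i < length ts" "length ts = k" "j < k" using 4 by (auto simp: tapes_rep_def)
  let ?x = "f (peek (s i)) (peek (s j))"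
  have "tm_step (stack_tm k \<Sigma> prog r yes) (length pre, ts) = (Suc (length pre), ts[i := update_tape (?x, Move_none) (ts ! i)])"
    by (rule step_change)
      (use 4 i read_tapes_rep[OF "4.prems"(3)] in \<open>auto simp: nth_append\<close>)
  moreover have "tapes_rep k (ts[i := update_tape (?x, Move_none) (ts ! i)]) (s(i := ?x # tl (s i)))"
    using 4 by (intro tapes_rep_upd tape_rep_write) (auto simp: tapes_rep_def)
  ultimately show ?case by (simp add: fun_upd_def)
next
  case (5 c1 s t1 s1 c2 t2 s2)
  from 5(3)[of pre "compile (length pre + csize c1) c2 @ post" ts] 5(5-7)
  obtain ts1 where 1: "(tm_step (stack_tm k \<Sigma> prog r yes) ^^ t1) (length pre, ts) = (length pre + csize c1, ts1)" "tapes_rep k ts1 s1"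
    by auto
  from 5(4)[of "pre @ compile (length pre) c1" post ts1] 5(5-7) 1(2)
  obtain ts2 where 2: "(tm_step (stack_tm k \<Sigma> prog r yes) ^^ t2) (length pre + csize c1, ts1) = (length pre + csize c1 + csize c2, ts2)"
     "tapes_rep k ts2 s2"
    by auto
  show ?case using funpow_add_apply[OF 1(1) 2(1)] 2(2) by (auto simp: add.assoc)
next
  case (6 P s i c1 t s' c2)
  let ?a = "length pre"
  have 1: "(tm_step (stack_tm k \<Sigma> prog r yes) ^^ 1) (?a, ts) = (Suc ?a, ts)"
    using step_jmpn[of ?a i P "?a + csize c1 + 2" ts s] 6 by (simp add: nth_append)
  from 6(3)[of "pre @ [IJmpN i P (?a + csize c1 + 2)]"
      "IJmp (?a + csize c1 + 2 + csize c2) # compile (?a + csize c1 + 2) c2 @ post" ts] 6(4-6)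
  obtain ts1 where 2: "(tm_step (stack_tm k \<Sigma> prog r yes) ^^ t) (Suc ?a, ts) = (Suc ?a + csize c1, ts1)" "tapes_rep k ts1 s'"
    by auto
  have 3: "(tm_step (stack_tm k \<Sigma> prog r yes) ^^ 1) (Suc ?a + csize c1, ts1) = (?a + csize c1 + 2 + csize c2, ts1)"
    using step_jmp[of "Suc ?a + csize c1" "?a + csize c1 + 2 + csize c2" ts1] 6(5)
    by (simp add: nth_append)
  from funpow_add_apply[OF funpow_add_apply[OF 1 2(1)] 3] show ?case using 2(2)
    by (auto simp: algebra_simps)
next
  case (7 P s i c2 t s' c1)
  let ?a = "length pre"
  have 1: "(tm_step (stack_tm k \<Sigma> prog r yes) ^^ 1) (?a, ts) = (?a + csize c1 + 2, ts)"
    using step_jmpn[of ?a i P "?a + csize c1 + 2" ts s] 7 by (simp add: nth_append)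
  from 7(3)[of "pre @ IJmpN i P (?a + csize c1 + 2) # compile (Suc ?a) c1 @ [IJmp (?a + csize c1 + 2 + csize c2)]"
      post ts] 7(4-6)
  obtain ts1 where 2: "(tm_step (stack_tm k \<Sigma> prog r yes) ^^ t) (?a + csize c1 + 2, ts) = (?a + csize c1 + 2 + csize c2, ts1)"
     "tapes_rep k ts1 s'"
    by auto
  from funpow_add_apply[OF 1 2(1)] show ?case using 2(2) by (auto simp: algebra_simps)
next
  case (8 P s i c)
  let ?a = "length pre"
  have "(tm_step (stack_tm k \<Sigma> prog r yes) ^^ 1) (?a, ts) = (?a + csize c + 2, ts)"
    using step_jmpn[of ?a i P "?a + csize c + 2" ts s] 8 by (simp add: nth_append)
  then show ?case using 8 by auto
next
  case (9 P s i c t s1 t' s2)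
  let ?a = "length pre"
  have 1: "(tm_step (stack_tm k \<Sigma> prog r yes) ^^ 1) (?a, ts) = (Suc ?a, ts)"
    using step_jmpn[of ?a i P "?a + csize c + 2" ts s] 9 by (simp add: nth_append)
  from 9(4)[of "pre @ [IJmpN i P (?a + csize c + 2)]" "IJmp ?a # post" ts] 9(6-8)
  obtain ts1 where 2: "(tm_step (stack_tm k \<Sigma> prog r yes) ^^ t) (Suc ?a, ts) = (Suc ?a + csize c, ts1)" "tapes_rep k ts1 s1"
    by auto
  have 3: "(tm_step (stack_tm k \<Sigma> prog r yes) ^^ 1) (Suc ?a + csize c, ts1) = (?a, ts1)"
    using step_jmp[of "Suc ?a + csize c" ?a ts1] 9(7) by (simp add: nth_append)
  from 9(5)[of pre post ts1] 9(6-8) 2(2)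
  obtain ts2 where 4: "(tm_step (stack_tm k \<Sigma> prog r yes) ^^ t') (?a, ts1) = (?a + csize (Loop i P c), ts2)" "tapes_rep k ts2 s2"
    by auto
  from funpow_add_apply[OF funpow_add_apply[OF funpow_add_apply[OF 1 2(1)] 3] 4(1)] 4(2)
  show ?case by auto
qed

end

definition init_stacks :: "'s list \<Rightarrow> nat \<Rightarrow> 's symbol list" where
  "init_stacks w = (\<lambda>_. [])(0 := map Letter w)"

lemma tapes_rep_init:
  assumes "k \<ge> 1"
  shows "tapes_rep k (input_tape w # replicate (k - 1) ((\<lambda>_. Blank), 0)) (init_stacks w)"
  using assms
  by (auto simp: tapes_rep_def tape_rep_def input_tape_def init_stacks_def nth_Cons' nat_less_iff)

text \<open>The tapes represent the stacks throughout; \<open>Suc t\<close> includes the step that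
  turns the top of stack \<open>r\<close> into the verdict.\<close>

theorem decides_within_exec:
  assumes k: "k \<ge> 1" and \<Sigma>: "finite \<Sigma>" "Blank \<in> \<Sigma>" and wf: "wf_com \<Sigma> k c" and r: "r < k"
    and ex: "\<And>x. x \<in> X \<Longrightarrow> Letter ` set (enc x) \<subseteq> \<Sigma>"
      "\<And>x. x \<in> X \<Longrightarrow> \<exists>t s'. exec c (init_stacks (enc x)) t s' \<and> real (Suc t) \<le> T (length (enc x)) \<and>
          (peek (s' r) = yes \<longleftrightarrow> x \<in> Y)"
  shows "decides_within (stack_tm k \<Sigma> (compile 0 c) r yes) enc X Y T"
  unfolding decides_within_def
proof (intro conjI ballI)
  let ?M = "stack_tm k \<Sigma> (compile 0 c) r yes"
  show "turing_machine ?M"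
    by (rule stack_tm_wf[OF k \<Sigma>]) (rule wf_compile[OF wf])
  fix x assume x: "x \<in> X"
  show "Letter ` set (enc x) \<subseteq> symbols ?M" using ex(1)[OF x] by (simp add: stack_tm_def)
  obtain t s' where t: "exec c (init_stacks (enc x)) t s'" "real (Suc t) \<le> T (length (enc x))"
     "peek (s' r) = yes \<longleftrightarrow> x \<in> Y"
    using ex(2)[OF x] by blast
  have "tapes_rep k (snd (tm_init ?M (enc x))) (init_stacks (enc x))"
    using tapes_rep_init[OF k] by (simp add: tm_init_def stack_tm_def)
  from exec_compile[OF t(1) wf _ this, of "compile 0 c" "[]" "[]" r yes]
  obtain ts' where ts': "(tm_step ?M ^^ t) (0, snd (tm_init ?M (enc x))) = (csize c, ts')" "tapes_rep k ts' s'"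
    by auto
  have "tm_init ?M (enc x) = (0, snd (tm_init ?M (enc x)))" by (simp add: tm_init_def stack_tm_def)
  then have 1: "(tm_step ?M ^^ t) (tm_init ?M (enc x)) = (csize c, ts')" using ts'(1) by simp
  have "fst (tm_step ?M (csize c, ts')) = (if x \<in> Y then accept_state ?M else reject_state ?M)"
    using read_tapes_rep[OF ts'(2) r] t(3) by (simp add: tm_step_def stack_tm_def)
  then have "fst ((tm_step ?M ^^ Suc t) (tm_init ?M (enc x))) = (if x \<in> Y then accept_state ?M else reject_state ?M)"
    using 1 by simp
  then show "\<exists>k. real k \<le> T (length (enc x)) \<and>
           fst ((tm_step ?M ^^ k) (tm_init ?M (enc x))) = (if x \<in> Y then accept_state ?M else reject_state ?M)"
    using t(2) by blast
qed

section \<open>Running times of stack programs\<close>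

text \<open>Bounds of the form \<open>k * M ^ e\<close>, where \<open>M\<close> bounds the number of iterations of all loops, can be
  computed along the program: composition adds the \<open>k\<close> and takes the maximum of the \<open>e\<close>, a loop
  increments \<open>e\<close>. This needs \<open>M \<ge> 1\<close>.\<close>

definition runs :: "nat \<Rightarrow> 's com \<Rightarrow> (nat \<Rightarrow> 's symbol list) \<Rightarrow> nat \<Rightarrow> nat \<Rightarrow> (nat \<Rightarrow> 's symbol list) \<Rightarrow> bool" where
  "runs M c s k e s' \<longleftrightarrow> (M \<ge> 1 \<longrightarrow> (\<exists>t. t \<le> k * M ^ e \<and> exec c s t s'))"

lemma runs_bound_mono:
  assumes "(M :: nat) \<ge> 1" "t \<le> k * M ^ e" "k \<le> k'" "e \<le> e'"
  shows "t \<le> k' * M ^ e'"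
proof -
  have "k * M ^ e \<le> k' * M ^ e'" using assms by (intro mult_le_mono power_increasing) auto
  then show ?thesis using assms(2) by linarith
qed

lemma runs_conv: "runs M c s k1 e1 s1 \<Longrightarrow> s1 = s' \<Longrightarrow> k1 \<le> k \<Longrightarrow> e1 \<le> e \<Longrightarrow> runs M c s k e s'"
  unfolding runs_def using runs_bound_mono by blast

lemma runs_skip: "runs M Skip s 0 0 s"
  unfolding runs_def using exec.intros(1) by blast

lemma runs_pop: "runs M (Pop i) s 1 0 (s(i := tl (s i)))"
  unfolding runs_def using exec.intros(2)[of i s] by auto

lemma runs_push: "i \<noteq> j \<Longrightarrow> runs M (Push i j f) s 2 0 (s(i := f (peek (s j)) # s i))"
  unfolding runs_def using exec.intros(3)[of i j f s] by auto

lemma runs_upd: "s i \<noteq> [] \<Longrightarrow> runs M (Upd i j f) s 1 0 (s(i := f (peek (s i)) (peek (s j)) # tl (s i)))"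
  unfolding runs_def using exec.intros(4)[of s i j f] by auto

lemma runs_seq:
  assumes "runs M c1 s k1 e1 s1" "runs M c2 s1 k2 e2 s2"
  shows "runs M (c1 ;; c2) s (k1 + k2) (max e1 e2) s2"
  unfolding runs_def
proof
  assume M: "M \<ge> 1"
  obtain t1 t2 where t: "t1 \<le> k1 * M ^ e1" "exec c1 s t1 s1" "t2 \<le> k2 * M ^ e2" "exec c2 s1 t2 s2"
    using assms M by (auto simp: runs_def)
  have "t1 \<le> k1 * M ^ max e1 e2" "t2 \<le> k2 * M ^ max e1 e2"
    using runs_bound_mono[OF M t(1)] runs_bound_mono[OF M t(3)] by auto
  then show "\<exists>t\<le>(k1 + k2) * M ^ max e1 e2. exec (c1 ;; c2) s t s2"
    using exec.intros(5)[OF t(2,4)] by (intro exI[of _ "t1 + t2"]) (auto simp: add_mult_distrib)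
qed

lemma runs_branch:
  assumes "P (peek (s i)) \<Longrightarrow> runs M c1 s k e s'" "\<not> P (peek (s i)) \<Longrightarrow> runs M c2 s k e s'"
  shows "runs M (Branch i P c1 c2) s (k + 2) e s'"
  unfolding runs_def
proof
  assume M: "M \<ge> 1"
  then have M': "1 \<le> M ^ e" by simp
  show "\<exists>t\<le>(k + 2) * M ^ e. exec (Branch i P c1 c2) s t s'"
  proof (cases "P (peek (s i))")
    case True
    then obtain t where "t \<le> k * M ^ e" "exec c1 s t s'" using assms(1) M by (auto simp: runs_def)
    then show ?thesis using exec.intros(6)[of P s i c1 t s' c2] True M'
      by (intro exI[of _ "1 + t + 1"]) (auto simp: add_mult_distrib)
  next
    case False
    then obtain t where "t \<le> k * M ^ e" "exec c2 s t s'" using assms(2) M by (auto simp: runs_def)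
    then show ?thesis using exec.intros(7)[of P s i c2 t s' c1] False M'
      by (intro exI[of _ "1 + t"]) (auto simp: add_mult_distrib)
  qed
qed

lemma runs_branchT: "P (peek (s i)) \<Longrightarrow> runs M c1 s k e s' \<Longrightarrow> runs M (Branch i P c1 c2) s (k + 2) e s'"
  by (rule runs_branch) auto

lemma runs_branchF: "\<not> P (peek (s i)) \<Longrightarrow> runs M c2 s k e s' \<Longrightarrow> runs M (Branch i P c1 c2) s (k + 2) e s'"
  by (rule runs_branch) auto

text \<open>The state before iteration \<open>m\<close> is given explicitly as
  \<open>\<sigma> m\<close>, which replaces an invariant. Each iteration costs the test and the jump
  back besides its body, and the last test fails: \<open>n * (T + 2) + 1\<close>.\<close>

lemma exec_loop_steps:
  assumes "\<And>m. m < n \<Longrightarrow> P (peek (\<sigma> m i)) \<and> (\<exists>t \<le> T. exec c (\<sigma> m) t (\<sigma> (Suc m)))" "\<not> P (peek (\<sigma> n i))"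
  shows "\<exists>t \<le> n * (T + 2) + 1. exec (Loop i P c) (\<sigma> 0) t (\<sigma> n)"
  using assms
proof (induction n arbitrary: \<sigma>)
  case 0
  then show ?case using exec.intros(8)[of P "\<sigma> 0" i c] by auto
next
  case (Suc n)
  obtain t1 where t1: "t1 \<le> T" "exec c (\<sigma> 0) t1 (\<sigma> (Suc 0))" and P: "P (peek (\<sigma> 0 i))"
    using Suc.prems(1)[of 0] by auto
  obtain t2 where t2: "t2 \<le> n * (T + 2) + 1" "exec (Loop i P c) (\<sigma> (Suc 0)) t2 (\<sigma> (Suc n))"
    using Suc.IH[of "\<lambda>m. \<sigma> (Suc m)"] Suc.prems by auto
  show ?case using exec.intros(9)[OF P t1(2) t2(2)] t1(1) t2(1)
    by (intro exI[of _ "1 + t1 + 1 + t2"]) auto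
qed

text \<open>The two extra steps of each iteration and the final test are charged to
  \<open>M ^ Suc e\<close>, which gives the summand 3.\<close>

lemma runs_loop:
  assumes n: "n \<le> M" and step: "\<And>m. m < n \<Longrightarrow> P (peek (\<sigma> m i)) \<and> runs M c (\<sigma> m) k e (\<sigma> (Suc m))"
    and stop: "\<not> P (peek (\<sigma> n i))" and s: "s = \<sigma> 0" "s' = \<sigma> n"
  shows "runs M (Loop i P c) s (k + 3) (Suc e) s'"
  unfolding runs_def
proof
  assume M: "M \<ge> 1"
  then have M': "1 \<le> M ^ e" by simp
  obtain t where t: "t \<le> n * (k * M ^ e + 2) + 1" "exec (Loop i P c) s t s'"
    using exec_loop_steps[of n P \<sigma> i "k * M ^ e" c] step stop M s by (auto simp: runs_def)
  have "n * (k * M ^ e + 2) + 1 \<le> M * (k * M ^ e + 2 * M ^ e) + M * M ^ e"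
    using n M M' by (intro add_mono mult_le_mono) auto
  also have "\<dots> = (k + 3) * M ^ Suc e" by (simp add: algebra_simps)
  finally have "t \<le> (k + 3) * M ^ Suc e" using t(1) by (rule order_trans[rotated])
  then show "\<exists>t\<le>(k + 3) * M ^ Suc e. exec (Loop i P c) s t s'" using t(2) by blast
qed

abbreviation nonblank :: "'s symbol \<Rightarrow> bool" where
  "nonblank \<equiv> \<lambda>x. x \<noteq> Blank"

lemma peek_drop: "m < length xs \<Longrightarrow> peek (drop m xs) = xs ! m"
  by (simp add: Cons_nth_drop_Suc[symmetric])

lemma peek_append: "peek (xs @ ys) = (if xs = [] then peek ys else peek xs)"
  by (cases xs) auto

lemma nth_neq_Blank: "Blank \<notin> set xs \<Longrightarrow> m < length xs \<Longrightarrow> xs ! m \<noteq> Blank"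
  by (metis nth_mem)

text \<open>A stack is traversed by moving it, which reverses the word; a second move restores the
  order.\<close>

definition mvp :: "nat \<Rightarrow> nat \<Rightarrow> ('s symbol \<Rightarrow> bool) \<Rightarrow> ('s symbol \<Rightarrow> 's symbol) \<Rightarrow> 's com" where
  "mvp i j P f = Loop i P (Push j i f ;; Pop i)"

lemma runs_mvp:
  assumes "i \<noteq> j" "s i = xs @ ys" "\<forall>x \<in> set xs. P x" "\<not> P (peek ys)" "length xs \<le> M"
  shows "runs M (mvp i j P f) s 6 1 (s(i := ys, j := rev (map f xs) @ s j))"
proof -
  define \<sigma> where "\<sigma> m = s(i := drop m xs @ ys, j := rev (map f (take m xs)) @ s j)" for m
  have "runs M (mvp i j P f) s (3 + 3) (Suc 0) (s(i := ys, j := rev (map f xs) @ s j))"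
    unfolding mvp_def
  proof (rule runs_loop[where \<sigma> = \<sigma>, OF assms(5)], intro conjI)
    fix m assume m: "m < length xs"
    show "P (peek (\<sigma> m i))" using assms(1,3) m by (simp add: \<sigma>_def peek_append peek_drop)
    show "runs M (Push j i f ;; Pop i) (\<sigma> m) 3 0 (\<sigma> (Suc m))"
      by (rule runs_conv, rule runs_seq, rule runs_push, use assms(1) in simp, rule runs_pop)
        (use assms(1) m in \<open>auto simp: \<sigma>_def fun_eq_iff peek_drop peek_append take_Suc_conv_app_nth drop_Suc tl_drop\<close>)
  qed (use assms in \<open>auto simp: \<sigma>_def\<close>)
  then show ?thesis by simp
qed

definition mv :: "nat \<Rightarrow> nat \<Rightarrow> ('s symbol \<Rightarrow> 's symbol) \<Rightarrow> 's com" where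
  "mv i j f = mvp i j nonblank f"

lemma runs_mv:
  assumes "i \<noteq> j" "Blank \<notin> set (s i)" "length (s i) \<le> M"
  shows "runs M (mv i j f) s 6 1 (s(i := [], j := rev (map f (s i)) @ s j))"
  unfolding mv_def by (rule runs_mvp) (use assms in auto)

definition clear :: "nat \<Rightarrow> 's com" where
  "clear i = Loop i nonblank (Pop i)"

lemma runs_clear:
  assumes "Blank \<notin> set (s i)" "length (s i) \<le> M"
  shows "runs M (clear i) s 4 1 (s(i := []))"
proof -
  define \<sigma> where "\<sigma> m = s(i := drop m (s i))" for m
  have "runs M (clear i) s (1 + 3) (Suc 0) (s(i := []))"
    unfolding clear_def
  proof (rule runs_loop[where \<sigma> = \<sigma>, OF assms(2)], intro conjI)
    fix m assume m: "m < length (s i)"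
    show "peek (\<sigma> m i) \<noteq> Blank" using m nth_neq_Blank[OF assms(1) m] by (simp add: \<sigma>_def peek_drop)
    show "runs M (Pop i) (\<sigma> m) 1 0 (\<sigma> (Suc m))"
      by (rule runs_conv, rule runs_pop) (auto simp: \<sigma>_def fun_eq_iff drop_Suc tl_drop)
  qed (auto simp: \<sigma>_def)
  then show ?thesis by simp
qed

definition mv2 :: "nat \<Rightarrow> nat \<Rightarrow> nat \<Rightarrow> ('s symbol \<Rightarrow> bool) \<Rightarrow> ('s symbol \<Rightarrow> 's symbol) \<Rightarrow> ('s symbol \<Rightarrow> 's symbol) \<Rightarrow> 's com" where
  "mv2 i j l P f g = Loop i P (Push j i f ;; Push l i g ;; Pop i)"

lemma runs_mv2:
  assumes "distinct [i, j, l]" "s i = xs @ ys" "\<forall>x \<in> set xs. P x" "\<not> P (peek ys)" "length xs \<le> M"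
  shows "runs M (mv2 i j l P f g) s 8 1 (s(i := ys, j := rev (map f xs) @ s j, l := rev (map g xs) @ s l))"
proof -
  define \<sigma> where "\<sigma> m = s(i := drop m xs @ ys, j := rev (map f (take m xs)) @ s j, l := rev (map g (take m xs)) @ s l)" for m
  have "runs M (mv2 i j l P f g) s (5 + 3) (Suc 0) (s(i := ys, j := rev (map f xs) @ s j, l := rev (map g xs) @ s l))"
    unfolding mv2_def
  proof (rule runs_loop[where \<sigma> = \<sigma>, OF assms(5)], intro conjI)
    fix m assume m: "m < length xs"
    show "P (peek (\<sigma> m i))" using assms(1,3) m by (simp add: \<sigma>_def peek_append peek_drop)
    show "runs M (Push j i f ;; Push l i g ;; Pop i) (\<sigma> m) 5 0 (\<sigma> (Suc m))"
      by (rule runs_conv, rule runs_seq, rule runs_push, use assms(1) in simp, rule runs_seq, rule runs_push,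
          use assms(1) in simp, rule runs_pop)
        (use assms(1) m in \<open>auto simp: \<sigma>_def fun_eq_iff peek_drop peek_append take_Suc_conv_app_nth drop_Suc tl_drop\<close>)
  qed (use assms in \<open>auto simp: \<sigma>_def\<close>)
  then show ?thesis by simp
qed

section \<open>Reading node numbers\<close>

text \<open>Use of the stacks: 0 input, 1 the part of the input that was read, in reverse; 2 digits of the
  current tuple, 3 those moved aside; 4 remaining budget of nonzero digits (in unary); 5 values of the
  nodes, the last one on top, 6 those moved aside; 7 bits of a node number; 8, 9 unary counters; 10 gate under
  evaluation; 11 answer of the search (\<open>mark\<close> while it is running); 12 carry of the
  odometer; 13 logarithm of the input length (in unary); 14, 15 values of the two circuits.\<close>

abbreviation mark :: "'s symbol" where
  "mark \<equiv> Aux 0"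

text \<open>The value of a bit list whose most significant bit comes first. Encoded numbers start
  with the least significant bit, but moving them to stack 7 reverses them.\<close>

definition horner :: "bool list \<Rightarrow> nat" where
  "horner bs = foldl (\<lambda>n b. 2 * n + of_bool b) 0 bs"

lemma horner_snoc: "horner (bs @ [b]) = 2 * horner bs + of_bool b"
  by (simp add: horner_def)

lemma horner_binary: "horner (rev (binary p)) = p"
proof (induction p rule: less_induct)
  case (less p)
  show ?case
  proof (cases "p = 0")
    case False
    then have "horner (rev (binary p)) = 2 * horner (rev (binary (p div 2))) + of_bool (odd p)"
      by (subst binary.simps) (simp add: horner_snoc)
    also have "\<dots> = p" using False less.IH[of "p div 2"] by simp
    finally show ?thesis .
  qed (simp add: binary.simps[of 0] horner_def)
qed

text \<open>The intermediate values of the unary counter do not exceed the final one, so they stay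
  within the loop bound.\<close>

lemma horner_take: "horner (take m bs) \<le> horner bs"
proof (induction bs rule: rev_induct)
  case (snoc b bs)
  then show ?case by (cases "m \<le> length bs") (auto simp: horner_snoc)
qed simp

lemma length_binary: "length (binary p) \<le> p"
proof (induction p rule: less_induct)
  case (less p)
  show ?case
  proof (cases "p = 0")
    case False
    then have "length (binary p) = Suc (length (binary (p div 2)))" by (subst binary.simps) simp
    also have "\<dots> \<le> Suc (p div 2)" using less.IH[of "p div 2"] False by simp
    also have "\<dots> \<le> p" using False by simp
    finally show ?thesis .
  qed (simp add: binary.simps[of 0])
qed

definition double :: "'s com" where
  "double = Loop 8 nonblank (Push 9 8 (\<lambda>_. mark) ;; Push 9 8 (\<lambda>_. mark) ;; Pop 8) ;; mv 9 8 id"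

lemma runs_double:
  assumes "s 8 = replicate n mark" "s 9 = []" "2 * n \<le> M"
  shows "runs M double s 14 1 (s(8 := replicate (2 * n) mark))"
proof -
  define \<sigma> where "\<sigma> m = s(8 := replicate (n - m) mark, 9 := replicate (2 * m) mark)" for m
  have "runs M (Loop 8 nonblank (Push 9 8 (\<lambda>_. mark) ;; Push 9 8 (\<lambda>_. mark) ;; Pop 8)) s (5 + 3) (Suc 0)
      (s(8 := [], 9 := replicate (2 * n) mark))"
  proof (rule runs_loop[where \<sigma> = \<sigma> and n = n], use assms in simp, intro conjI)
    fix m assume m: "m < n"
    then obtain l where l: "n - m = Suc l" by (metis Suc_diff_Suc)
    show "peek (\<sigma> m 8) \<noteq> Blank" by (simp add: \<sigma>_def l)
    show "runs M (Push 9 8 (\<lambda>_. mark) ;; Push 9 8 (\<lambda>_. mark) ;; Pop 8) (\<sigma> m) 5 0 (\<sigma> (Suc m))"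
      by (rule runs_conv, rule runs_seq, rule runs_push, simp, rule runs_seq, rule runs_push, simp, rule runs_pop)
        (use l in \<open>auto simp: \<sigma>_def fun_eq_iff\<close>)
  qed (use assms in \<open>auto simp: \<sigma>_def fun_eq_iff\<close>)
  then show ?thesis unfolding double_def
    by (rule runs_conv[OF runs_seq[OF _ runs_mv]]) (use assms in \<open>auto simp: fun_eq_iff\<close>)
qed

text \<open>Horner's scheme with a unary accumulator. The value read is a node number, so its unary
  form is no longer than the list of nodes.\<close>

definition unary :: "('a, 'i) letter com" where
  "unary = Loop 7 nonblank (double ;;
     Branch 7 (\<lambda>x. x = Letter (Bit True)) (Push 8 7 (\<lambda>_. mark)) Skip ;; Pop 7)"

lemma runs_unary:
  assumes "s 7 = map (\<lambda>b. Letter (Bit b)) bs" "s 8 = []" "s 9 = []" "length bs \<le> M" "horner bs \<le> M"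
  shows "runs M (unary :: ('a, 'i) letter com) s 22 2 (s(7 := [], 8 := replicate (horner bs) mark))"
proof -
  define \<sigma> where "\<sigma> m = s(7 := drop m (map (\<lambda>b. Letter (Bit b)) bs), 8 := replicate (horner (take m bs)) mark)" for m
  have "runs M unary s (19 + 3) (Suc 1) (s(7 := [], 8 := replicate (horner bs) mark))"
    unfolding unary_def
  proof (rule runs_loop[where \<sigma> = \<sigma>, OF assms(4)], intro conjI)
    fix m assume m: "m < length bs"
    have pk: "peek (\<sigma> m 7) = Letter (Bit (bs ! m))" using m by (simp add: \<sigma>_def peek_drop)
    show "peek (\<sigma> m 7) \<noteq> Blank" by (simp add: pk)
    let ?h = "horner (take m bs)"
    have h: "horner (take (Suc m) bs) = 2 * ?h + of_bool (bs ! m)"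
      using m by (simp add: take_Suc_conv_app_nth horner_snoc)
    have "2 * ?h \<le> M" using horner_take[of "Suc m" bs] assms(5) h by linarith
    then have d: "runs M double (\<sigma> m) 14 1 ((\<sigma> m)(8 := replicate (2 * ?h) mark))"
      by (intro runs_double) (use assms in \<open>auto simp: \<sigma>_def\<close>)
    have b: "runs M (Branch 7 (\<lambda>x. x = Letter (Bit True)) (Push 8 7 (\<lambda>_. mark)) Skip) ((\<sigma> m)(8 := replicate (2 * ?h) mark))
        (2 + 2) 0 ((\<sigma> m)(8 := replicate (2 * ?h + of_bool (bs ! m)) mark))"
    proof (rule runs_branch)
      assume "peek (((\<sigma> m)(8 := replicate (2 * ?h) mark)) 7) = Letter (Bit True)"
      then have "bs ! m" using pk by simp
      then show "runs M (Push 8 7 (\<lambda>_. mark)) ((\<sigma> m)(8 := replicate (2 * ?h) mark)) 2 0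
          ((\<sigma> m)(8 := replicate (2 * ?h + of_bool (bs ! m)) mark))"
        by (intro runs_conv[OF runs_push]) auto
    next
      assume "peek (((\<sigma> m)(8 := replicate (2 * ?h) mark)) 7) \<noteq> Letter (Bit True)"
      then have "\<not> bs ! m" using pk by simp
      then show "runs M Skip ((\<sigma> m)(8 := replicate (2 * ?h) mark)) 2 0
          ((\<sigma> m)(8 := replicate (2 * ?h + of_bool (bs ! m)) mark))"
        by (intro runs_conv[OF runs_skip]) auto
    qed
    show "runs M (double ;; Branch 7 (\<lambda>x. x = Letter (Bit True)) (Push 8 7 (\<lambda>_. mark)) Skip ;; Pop 7) (\<sigma> m) 19 1 (\<sigma> (Suc m))"
      by (rule runs_conv[OF runs_seq[OF d runs_seq[OF b runs_pop]]])
        (auto simp: \<sigma>_def fun_eq_iff h drop_Suc tl_drop)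
  qed (use assms in \<open>auto simp: \<sigma>_def horner_def fun_eq_iff\<close>)
  then show ?thesis by (simp add: numeral_2_eq_2)
qed

definition is_bit :: "('a, 'i) letter symbol \<Rightarrow> bool" where
  "is_bit x \<longleftrightarrow> x = Letter (Bit True) \<or> x = Letter (Bit False)"

lemma is_bit_simps [simp]: "is_bit (Letter (Bit b))"
  by (cases b) (auto simp: is_bit_def)

text \<open>Afterwards, stack 6 holds the nodes from the one whose number was read onwards.\<close>

definition find_node :: "('a, 'i) letter com" where
  "find_node = mv2 0 1 7 is_bit id id ;; unary ;; mv 5 6 id ;;
     Loop 8 nonblank (Push 5 6 id ;; Pop 6 ;; Pop 8)"

abbreviation binw :: "nat \<Rightarrow> ('a, 'i) letter symbol list" where
  "binw p \<equiv> map (\<lambda>b. Letter (Bit b)) (binary p)"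

lemma runs_find_node:
  fixes s :: "nat \<Rightarrow> ('a, 'i) letter symbol list"
  assumes "s 0 = binw p @ rest" "\<not> is_bit (peek rest)" "s 5 = rev us" "Blank \<notin> set us" "p < length us" "length us \<le> M"
    "s 6 = []" "s 7 = []" "s 8 = []" "s 9 = []"
  shows "runs M find_node s 43 2 (s(0 := rest, 1 := rev (binw p) @ s 1, 5 := rev (take p us), 6 := drop p us))"
proof -
  have p: "p \<le> M" "length (binary p) \<le> M" using assms(5,6) length_binary[of p] by auto
  let ?s1 = "s(0 := rest, 1 := rev (binw p) @ s 1, 7 := rev (binw p))"
  let ?s2 = "?s1(7 := [], 8 := replicate p mark)"
  let ?s3 = "?s2(5 := [], 6 := us)"
  have 1: "runs M (mv2 0 1 7 is_bit id id) s 8 1 ?s1"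
    by (rule runs_conv[OF runs_mv2[of _ _ _ _ "binw p" rest]]) (use assms p in auto)
  have 2: "runs M unary ?s1 22 2 ?s2"
    by (rule runs_conv[OF runs_unary[of _ "rev (binary p)"]]) (use assms p in \<open>auto simp: horner_binary rev_map\<close>)
  have 3: "runs M (mv 5 6 id) ?s2 6 1 ?s3"
    by (rule runs_conv[OF runs_mv]) (use assms in \<open>auto simp: fun_eq_iff\<close>)
  define \<sigma> where "\<sigma> m = ?s3(5 := rev (take m us), 6 := drop m us, 8 := replicate (p - m) mark)" for m
  have "runs M (Loop 8 nonblank (Push 5 6 id ;; Pop 6 ;; Pop 8)) ?s3 (4 + 3) (Suc 0)
      (s(0 := rest, 1 := rev (binw p) @ s 1, 5 := rev (take p us), 6 := drop p us))"
  proof (rule runs_loop[where \<sigma> = \<sigma>, OF p(1)], intro conjI)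
    fix m assume m: "m < p"
    then obtain l where l: "p - m = Suc l" by (metis Suc_diff_Suc)
    then have l': "p - Suc m = l" by simp
    show "peek (\<sigma> m 8) \<noteq> Blank" by (simp add: \<sigma>_def l)
    show "runs M (Push 5 6 id ;; Pop 6 ;; Pop 8) (\<sigma> m) 4 0 (\<sigma> (Suc m))"
      by (rule runs_conv, rule runs_seq, rule runs_push, simp, rule runs_seq, rule runs_pop, rule runs_pop)
        (use l l' m assms in \<open>auto simp: \<sigma>_def fun_eq_iff peek_drop take_Suc_conv_app_nth drop_Suc tl_drop\<close>)
  qed (use assms in \<open>auto simp: \<sigma>_def fun_eq_iff\<close>)
  from runs_seq[OF 1 runs_seq[OF 2 runs_seq[OF 3 this]]] show ?thesis
    unfolding find_node_def by (rule runs_conv) auto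
qed

section \<open>Evaluating an encoded circuit\<close>

abbreviation opw :: "nat \<Rightarrow> ('a, 'i) letter symbol list" where
  "opw p \<equiv> Letter Comma # binw p"

definition gatew :: "('a, 'i) alg_gate \<times> nat list \<Rightarrow> ('a, 'i) letter symbol list" where
  "gatew = (\<lambda>(g, ps). Letter (Label g) # concat (map opw ps))"

lemma encode_circuit_words:
  "map Letter (encode_circuit C) = replicate (inputs C) (Letter Input_mark) @
     concat (map gatew (gates C)) @ Letter Output_mark # binw (output_node C)"
  by (auto simp: encode_circuit_def gatew_def map_concat comp_def split_beta intro!: arg_cong[of _ _ concat])

lemma num_gates_le_encode: "num_gates D \<le> length (encode_circuit D)"
proof -
  have "length gs \<le> length (concat (map (\<lambda>(g, ps). Label g # concat (map (\<lambda>p. Comma # map Bit (binary p)) ps)) gs))"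
    for gs :: "(('a, 'i) alg_gate \<times> nat list) list"
    by (induction gs) auto
  from this[of "gates D"] show ?thesis by (simp add: num_gates_def encode_circuit_def)
qed

definition is_label :: "('a, 'i) letter symbol \<Rightarrow> bool" where
  "is_label x \<longleftrightarrow> (\<exists>g. x = Letter (Label g))"

context
  fixes start finish dval :: "('a, 'i) letter symbol \<Rightarrow> ('a, 'i) letter symbol"
    and feed :: "('a, 'i) letter symbol \<Rightarrow> ('a, 'i) letter symbol \<Rightarrow> ('a, 'i) letter symbol"
begin

text \<open>The value is absorbed by the symbol on stack 10 at once, so evaluating a gate requires
  no list of argument values.\<close>

definition read_operand :: "('a, 'i) letter com" where
  "read_operand = Push 1 0 id ;; Pop 0 ;; find_node ;; Upd 10 6 feed ;; mv 6 5 id"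

lemma runs_read_operand:
  fixes s :: "nat \<Rightarrow> ('a, 'i) letter symbol list"
  assumes "s 0 = opw p @ rest" "\<not> is_bit (peek rest)" "s 5 = rev us" "Blank \<notin> set us" "p < length us" "length us \<le> M"
    "s 6 = []" "s 7 = []" "s 8 = []" "s 9 = []" "s 10 = x # g"
  shows "runs M read_operand s 53 2 (s(0 := rest, 1 := rev (opw p) @ s 1, 10 := feed x (us ! p) # g))"
proof -
  let ?s1 = "s(0 := binw p @ rest, 1 := Letter Comma # s 1)"
  let ?s2 = "?s1(0 := rest, 1 := rev (binw p) @ Letter Comma # s 1, 5 := rev (take p us), 6 := drop p us)"
  have f: "runs M find_node ?s1 43 2 ?s2"
    by (rule runs_conv[OF runs_find_node[of _ p rest us]]) (use assms in auto)
  let ?s3 = "?s2(10 := feed x (us ! p) # g)"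
  have "runs M (Push 1 0 id) s 2 0 (s(1 := Letter Comma # s 1))"
    by (rule runs_conv[OF runs_push]) (use assms in auto)
  moreover have "runs M (Pop 0) (s(1 := Letter Comma # s 1)) 1 0 ?s1"
    by (rule runs_conv[OF runs_pop]) (use assms in \<open>auto simp: fun_eq_iff\<close>)
  moreover note f
  moreover have "runs M (Upd 10 6 feed) ?s2 1 0 ?s3"
    by (rule runs_conv[OF runs_upd]) (use assms in \<open>auto simp: fun_eq_iff peek_drop\<close>)
  moreover have "runs M (mv 6 5 id) ?s3 6 1 (s(0 := rest, 1 := rev (opw p) @ s 1, 10 := feed x (us ! p) # g))"
    by (rule runs_conv[OF runs_mv])
      (use assms in \<open>auto simp: fun_eq_iff rev_append[symmetric] simp del: rev_append dest: in_set_dropD\<close>)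
  ultimately show ?thesis
    unfolding read_operand_def by (intro runs_conv[OF runs_seq[OF _ runs_seq[OF _ runs_seq[OF _ runs_seq]]]]) auto
qed

definition read_gate :: "('a, 'i) letter com" where
  "read_gate = Push 10 0 start ;; Push 1 0 id ;; Pop 0 ;; Loop 0 (\<lambda>x. x = Letter Comma) read_operand ;;
     Push 5 10 finish ;; Pop 10"

text \<open>The semantics that the symbol functions induce on gates. It has the type of
  \<open>sem\<close> in \<open>node_values\<close>, so the evaluator is specified without reference
  to an algebra.\<close>

definition gate_value :: "('a, 'i) alg_gate \<Rightarrow> ('a, 'i) letter symbol list \<Rightarrow> ('a, 'i) letter symbol" where
  "gate_value g xs = finish (foldl feed (start (Letter (Label g))) xs)"

definition blanks :: "nat set \<Rightarrow> (nat \<Rightarrow> ('a, 'i) letter symbol list) \<Rightarrow> bool" where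
  "blanks S s \<longleftrightarrow> (\<forall>i \<in> S. s i = [])"

lemma runs_read_operands:
  fixes s :: "nat \<Rightarrow> ('a, 'i) letter symbol list"
  assumes "s 0 = concat (map opw ps) @ rest" "\<not> is_bit (peek rest)" "peek rest \<noteq> Letter Comma"
    "s 5 = rev us" "Blank \<notin> set us" "\<forall>p \<in> set ps. p < length us" "length us \<le> M" "length ps \<le> M"
    "blanks {6, 7, 8, 9} s" "s 10 = x # g"
  shows "runs M (Loop 0 (\<lambda>x. x = Letter Comma) read_operand) s 56 3
     (s(0 := rest, 1 := rev (concat (map opw ps)) @ s 1, 10 := foldl feed x (map (\<lambda>p. us ! p) ps) # g))"
proof -
  define \<sigma> where "\<sigma> m = s(0 := concat (map opw (drop m ps)) @ rest, 1 := rev (concat (map opw (take m ps))) @ s 1,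
      10 := foldl feed x (map (\<lambda>p. us ! p) (take m ps)) # g)" for m
  have "runs M (Loop 0 (\<lambda>x. x = Letter Comma) read_operand) s (53 + 3) (Suc 2)
     (s(0 := rest, 1 := rev (concat (map opw ps)) @ s 1, 10 := foldl feed x (map (\<lambda>p. us ! p) ps) # g))"
  proof (rule runs_loop[where \<sigma> = \<sigma>, OF assms(8)], intro conjI)
    fix m assume m: "m < length ps"
    have d: "drop m ps = ps ! m # drop (Suc m) ps" using m by (simp add: Cons_nth_drop_Suc)
    have t: "take (Suc m) ps = take m ps @ [ps ! m]" using m by (simp add: take_Suc_conv_app_nth)
    show "peek (\<sigma> m 0) = Letter Comma" by (simp add: \<sigma>_def d)
    have "\<not> is_bit (peek (concat (map opw (drop (Suc m) ps)) @ rest))"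
      using assms(2) by (cases "drop (Suc m) ps") (auto simp: is_bit_def)
    then show "runs M read_operand (\<sigma> m) 53 2 (\<sigma> (Suc m))"
      by (intro runs_conv[OF runs_read_operand[where p = "ps ! m" and us = us
            and rest = "concat (map opw (drop (Suc m) ps)) @ rest"
            and x = "foldl feed x (map (\<lambda>p. us ! p) (take m ps))" and g = g]])
        (use assms m in \<open>auto simp: \<sigma>_def d t fun_eq_iff blanks_def\<close>)
  qed (use assms in \<open>auto simp: \<sigma>_def fun_eq_iff\<close>)
  then show ?thesis by (rule runs_conv) auto
qed

lemma runs_read_gate:
  fixes s :: "nat \<Rightarrow> ('a, 'i) letter symbol list"
  assumes "s 0 = gatew (g, ps) @ rest" "\<not> is_bit (peek rest)" "peek rest \<noteq> Letter Comma"
    "s 5 = rev us" "Blank \<notin> set us" "\<forall>p \<in> set ps. p < length us" "length us \<le> M" "length ps \<le> M"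
    "blanks {6, 7, 8, 9, 10} s"
  shows "runs M read_gate s 64 3
     (s(0 := rest, 1 := rev (gatew (g, ps)) @ s 1, 5 := rev (us @ [gate_value g (map (\<lambda>p. us ! p) ps)])))"
proof -
  let ?ops = "concat (map opw ps)" and ?l = "Letter (Label g)"
  let ?s1 = "s(10 := [start ?l])"
  let ?s2 = "?s1(1 := ?l # s 1)"
  let ?s3 = "?s2(0 := ?ops @ rest)"
  let ?a = "foldl feed (start ?l) (map (\<lambda>p. us ! p) ps)"
  let ?s4 = "?s3(0 := rest, 1 := rev ?ops @ ?l # s 1, 10 := [?a])"
  let ?s5 = "?s4(5 := finish ?a # rev us)"
  have "runs M (Push 10 0 start) s 2 0 ?s1"
    by (rule runs_conv[OF runs_push]) (use assms in \<open>auto simp: gatew_def blanks_def fun_eq_iff\<close>)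
  moreover have "runs M (Push 1 0 id) ?s1 2 0 ?s2"
    by (rule runs_conv[OF runs_push]) (use assms in \<open>auto simp: gatew_def fun_eq_iff\<close>)
  moreover have "runs M (Pop 0) ?s2 1 0 ?s3"
    by (rule runs_conv[OF runs_pop]) (use assms in \<open>auto simp: gatew_def fun_eq_iff\<close>)
  moreover have "runs M (Loop 0 (\<lambda>x. x = Letter Comma) read_operand) ?s3 56 3 ?s4"
    by (rule runs_conv[OF runs_read_operands[where ps = ps and rest = rest and us = us and x = "start ?l" and g = "[]"]])
      (use assms in \<open>auto simp: blanks_def fun_eq_iff\<close>)
  moreover have "runs M (Push 5 10 finish) ?s4 2 0 ?s5"
    by (rule runs_conv[OF runs_push]) (use assms in \<open>auto simp: fun_eq_iff\<close>)
  moreover have "runs M (Pop 10) ?s5 1 0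
     (s(0 := rest, 1 := rev (gatew (g, ps)) @ s 1, 5 := rev (us @ [gate_value g (map (\<lambda>p. us ! p) ps)])))"
    by (rule runs_conv[OF runs_pop]) (use assms in \<open>auto simp: gatew_def gate_value_def blanks_def fun_eq_iff\<close>)
  ultimately show ?thesis
    unfolding read_gate_def
    by (intro runs_conv[OF runs_seq[OF _ runs_seq[OF _ runs_seq[OF _ runs_seq[OF _ runs_seq]]]]]) auto
qed

text \<open>A \<open>Blank\<close> among the node values would stop the loops that move them too
  early.\<close>

lemma nonblank_gate_values:
  assumes "Blank \<notin> set us" "\<And>x. finish x \<noteq> Blank"
  shows "Blank \<notin> set (eval_gates gate_value gs us)"
proof (induction gs rule: rev_induct)
  case (snoc h gs)
  obtain g ps where "h = (g, ps)" by (cases h)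
  then show ?case using snoc assms(2) by (auto simp: gate_value_def dest: sym)
qed (use assms in simp)

lemma runs_read_gates:
  fixes s :: "nat \<Rightarrow> ('a, 'i) letter symbol list"
  assumes "s 0 = concat (map gatew gs) @ rest" "\<not> is_bit (peek rest)" "peek rest \<noteq> Letter Comma"
    "\<not> is_label (peek rest)" "s 5 = rev us" "Blank \<notin> set us" "\<And>x. finish x \<noteq> Blank"
    "\<forall>j < length gs. \<forall>p \<in> set (snd (gs ! j)). p < length us + j" "length us + length gs \<le> M"
    "\<forall>(g, ps) \<in> set gs. length ps \<le> M" "blanks {6, 7, 8, 9, 10} s"
  shows "runs M (Loop 0 is_label read_gate) s 67 4
     (s(0 := rest, 1 := rev (concat (map gatew gs)) @ s 1, 5 := rev (eval_gates gate_value gs us)))"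
proof -
  define u where "u m = eval_gates gate_value (take m gs) us" for m
  have lu: "length (u m) = length us + min (length gs) m" for m by (simp add: u_def min.commute)
  define \<sigma> where "\<sigma> m = s(0 := concat (map gatew (drop m gs)) @ rest, 1 := rev (concat (map gatew (take m gs))) @ s 1,
      5 := rev (u m))" for m
  have us: "u (Suc m) = u m @ [gate_value g (map (\<lambda>p. u m ! p) ps)]" if "m < length gs" "gs ! m = (g, ps)" for m g ps
    using that by (simp add: u_def take_Suc_conv_app_nth)
  have ub: "Blank \<notin> set (u m)" for m
    unfolding u_def using assms(6,7) by (rule nonblank_gate_values)
  have "runs M (Loop 0 is_label read_gate) s (64 + 3) (Suc 3)
     (s(0 := rest, 1 := rev (concat (map gatew gs)) @ s 1, 5 := rev (eval_gates gate_value gs us)))"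
  proof (rule runs_loop[where \<sigma> = \<sigma> and n = "length gs"], use assms in simp, intro conjI)
    fix m assume m: "m < length gs"
    obtain g ps where g: "gs ! m = (g, ps)" by (cases "gs ! m")
    have d: "drop m gs = (g, ps) # drop (Suc m) gs" using m g by (metis Cons_nth_drop_Suc)
    have t: "take (Suc m) gs = take m gs @ [(g, ps)]" using m g by (simp add: take_Suc_conv_app_nth)
    show "is_label (peek (\<sigma> m 0))" by (simp add: \<sigma>_def d gatew_def is_label_def)
    have "\<not> is_bit (peek (concat (map gatew (drop (Suc m) gs)) @ rest)) \<and>
        peek (concat (map gatew (drop (Suc m) gs)) @ rest) \<noteq> Letter Comma"
      using assms(2,3) by (cases "drop (Suc m) gs") (auto simp: is_bit_def gatew_def split: prod.splits)
    moreover have "length ps \<le> M" using assms(10) m g by (metis (mono_tags, lifting) case_prodD nth_mem)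
    moreover have "\<forall>p \<in> set ps. p < length (u m)" using assms(8) m g lu by auto
    ultimately show "runs M read_gate (\<sigma> m) 64 3 (\<sigma> (Suc m))"
      using us[OF m g] ub[of m] m lu[of m] assms(9,11) t
      by (intro runs_conv[OF runs_read_gate[where g = g and ps = ps and us = "u m"
            and rest = "concat (map gatew (drop (Suc m) gs)) @ rest"]])
        (auto simp: \<sigma>_def d fun_eq_iff blanks_def)
  qed (use assms in \<open>auto simp: \<sigma>_def fun_eq_iff u_def\<close>)
  then show ?thesis by (rule runs_conv) auto
qed

text \<open>Stack 3 takes a second copy of the digits, because translating them to values consumes
  stack 2.\<close>

definition read_circuit :: "nat \<Rightarrow> ('a, 'i) letter com" where
  "read_circuit q = mv2 2 5 3 nonblank dval id ;; mv 3 2 id ;; mvp 0 1 (\<lambda>x. x = Letter Input_mark) id ;;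
     Loop 0 is_label read_gate ;; Push 1 0 id ;; Pop 0 ;; find_node ;; Push q 6 id ;; clear 6 ;; clear 5"

lemma runs_read_circuit:
  fixes s :: "nat \<Rightarrow> ('a, 'i) letter symbol list"
  assumes "s 0 = map Letter (encode_circuit C) @ rest" "\<not> is_bit (peek rest)"
    "s 2 = xs" "length xs = inputs C" "Blank \<notin> set xs" "Blank \<notin> set (map dval xs)" "\<And>x. finish x \<noteq> Blank"
    "wf_circuit ok C" "num_gates C \<le> M" "\<forall>(g, ps) \<in> set (gates C). length ps \<le> M"
    "blanks {3, 5, 6, 7, 8, 9, 10} s" "q \<in> {14, 15}"
  shows "runs M (read_circuit q) s 143 4
     (s(0 := rest, 1 := rev (map Letter (encode_circuit C)) @ s 1, q := circuit_value gate_value C (map dval xs) # s q))"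
proof -
  let ?gw = "concat (map gatew (gates C))" and ?ow = "binw (output_node C)"
  let ?iw = "replicate (inputs C) (Letter Input_mark) :: ('a, 'i) letter symbol list"
  let ?us = "map dval xs"
  let ?vs = "eval_gates gate_value (gates C) ?us"
  let ?o = "output_node C"
  let ?s1 = "s(2 := [], 5 := rev ?us, 3 := rev xs)"
  let ?s2 = "s(5 := rev ?us)"
  let ?s3 = "?s2(0 := ?gw @ Letter Output_mark # ?ow @ rest, 1 := ?iw @ s 1)"
  let ?s4 = "?s3(0 := Letter Output_mark # ?ow @ rest, 1 := rev ?gw @ ?iw @ s 1, 5 := rev ?vs)"
  let ?s5 = "?s4(1 := Letter Output_mark # rev ?gw @ ?iw @ s 1)"
  let ?s6 = "?s5(0 := ?ow @ rest)"
  let ?w = "rev (map Letter (encode_circuit C)) @ s 1"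
  let ?s7 = "?s6(0 := rest, 1 := ?w, 5 := rev (take ?o ?vs), 6 := drop ?o ?vs)"
  let ?s8 = "?s7(q := circuit_value gate_value C (map dval xs) # s q)"
  have n: "length ?vs = num_gates C" "?o < num_gates C"
    using assms(4,8) by (auto simp: num_gates_def wf_circuit_def)
  have ng: "num_gates C = inputs C + length (gates C)" by (simp add: num_gates_def)
  have vb: "Blank \<notin> set ?vs"
    using assms(6,7) by (intro nonblank_gate_values) auto
  have a1: "runs M (mv2 2 5 3 nonblank dval id) s 8 1 ?s1"
    by (rule runs_conv[OF runs_mv2[of _ _ _ _ xs "[]"]]) (use assms ng in \<open>auto simp: blanks_def fun_eq_iff\<close>)
  have a2: "runs M (mv 3 2 id) ?s1 6 1 ?s2"
    by (rule runs_conv[OF runs_mv]) (use assms ng in \<open>auto simp: blanks_def fun_eq_iff\<close>)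
  have a3: "runs M (mvp 0 1 (\<lambda>x. x = Letter Input_mark) id) ?s2 6 1 ?s3"
    by (rule runs_conv[OF runs_mvp[of _ _ _ ?iw "?gw @ Letter Output_mark # ?ow @ rest"]])
      (use assms(1,9) ng in \<open>auto simp: fun_eq_iff encode_circuit_words gatew_def peek_append
        split: prod.splits list.splits intro: Nil_is_map_conv[THEN iffD1]\<close>, cases "gates C", auto simp: gatew_def)
  have a4: "runs M (Loop 0 is_label read_gate) ?s3 67 4 ?s4"
    by (rule runs_conv[OF runs_read_gates[where gs = "gates C" and us = ?us and rest = "Letter Output_mark # ?ow @ rest"]])
      (use assms ng in \<open>auto simp: is_bit_def is_label_def blanks_def fun_eq_iff wf_circuit_def split_beta\<close>)
  have a5: "runs M (Push 1 0 id) ?s4 2 0 ?s5"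
    by (rule runs_conv[OF runs_push]) (auto simp: fun_eq_iff)
  have a6: "runs M (Pop 0) ?s5 1 0 ?s6"
    by (rule runs_conv[OF runs_pop]) (auto simp: fun_eq_iff)
  have a7: "runs M find_node ?s6 43 2 ?s7"
    by (rule runs_conv[OF runs_find_node[where p = ?o and us = ?vs and rest = rest]])
      (use assms(2,9,11) n vb in \<open>auto simp: fun_eq_iff blanks_def encode_circuit_words rev_replicate\<close>)
  have a8: "runs M (Push q 6 id) ?s7 2 0 ?s8"
    by (rule runs_conv[OF runs_push])
      (use assms(12) n in \<open>auto simp: fun_eq_iff peek_drop circuit_value_def node_values_def\<close>)
  have a9: "runs M (clear 6) ?s8 4 1 (?s8(6 := []))"
    by (rule runs_conv[OF runs_clear]) (use assms(9,12) n vb in \<open>auto dest: in_set_dropD\<close>)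
  have a10: "runs M (clear 5) (?s8(6 := [])) 4 1
      (s(0 := rest, 1 := ?w, q := circuit_value gate_value C (map dval xs) # s q))"
    by (rule runs_conv[OF runs_clear])
      (use assms(9,11,12) n vb in \<open>auto simp: fun_eq_iff blanks_def dest: in_set_takeD\<close>)
  show ?thesis
    unfolding read_circuit_def
    by (rule runs_conv[OF runs_seq[OF a1 runs_seq[OF a2 runs_seq[OF a3 runs_seq[OF a4 runs_seq[OF a5 runs_seq[OF a6
        runs_seq[OF a7 runs_seq[OF a8 runs_seq[OF a9 a10]]]]]]]]]]) simp_all
qed

text \<open>The part of the word that was read collects on stack 1, so one move restores the
  instance for the next tuple. The Boolean \<open>b\<close> selects equality or inequality as the
  property tested.\<close>

definition compare_circuits :: "bool \<Rightarrow> ('a, 'i) letter com" where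
  "compare_circuits b = read_circuit 15 ;; Push 1 0 id ;; Pop 0 ;; read_circuit 14 ;; mv 1 0 id ;;
     Upd 15 14 (\<lambda>x y. Letter (Bit ((x = y) = b))) ;; Pop 14"

lemma runs_compare_circuits:
  fixes s :: "nat \<Rightarrow> ('a, 'i) letter symbol list"
  assumes "s 0 = map Letter (encode_pair (C, C'))" "s 1 = []"
    "s 2 = xs" "length xs = inputs C" "inputs C' = inputs C" "Blank \<notin> set xs" "Blank \<notin> set (map dval xs)"
    "\<And>x. finish x \<noteq> Blank" "wf_circuit ok C" "wf_circuit ok C'" "length (encode_pair (C, C')) \<le> M"
    "blanks {3, 5, 6, 7, 8, 9, 10, 14, 15} s"
  shows "runs M (compare_circuits b) s 297 4 (s(15 := [Letter (Bit
     ((circuit_value gate_value C (map dval xs) = circuit_value gate_value C' (map dval xs)) = b))]))"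
proof -
  let ?w = "map Letter (encode_circuit C)" and ?w' = "map Letter (encode_circuit C')"
  let ?v = "circuit_value gate_value C (map dval xs)" and ?v' = "circuit_value gate_value C' (map dval xs)"
  have w: "map Letter (encode_pair (C, C')) = ?w @ Letter End_mark # ?w'"
    by (simp add: encode_pair_def)
  have M: "length (encode_circuit C) \<le> M" "length (encode_circuit C') \<le> M"
      "length (encode_circuit C) + length (encode_circuit C') < M"
    using assms(11) by (auto simp: encode_pair_def)
  note ng = num_gates_le_encode
  \<comment> \<open>Every operand contributes a letter, so the length of the encoding bounds the
    loops over operands.\<close>
  have fan: "\<forall>(g, ps) \<in> set (gates D). length ps \<le> length (encode_circuit D)" for D :: "('a, 'i) alg_gate circuit"
  proof -
    have ops: "length ps \<le> length (concat (map (\<lambda>p. Comma # map Bit (binary p)) ps))" for ps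
      by (induction ps) auto
    have "\<forall>(g, ps) \<in> set gs. length ps \<le>
        length (concat (map (\<lambda>(g, ps). Label g # concat (map (\<lambda>p. Comma # map Bit (binary p)) ps)) gs))"
      for gs :: "(('a, 'i) alg_gate \<times> nat list) list"
      by (induction gs) (auto simp: le_SucI trans_le_add1[OF ops] intro: trans_le_add2)
    from this[of "gates D"] show ?thesis by (fastforce simp: encode_circuit_def)
  qed
  let ?s1 = "s(0 := Letter End_mark # ?w', 1 := rev ?w, 15 := [?v])"
  let ?s2 = "?s1(1 := Letter End_mark # rev ?w)"
  let ?s3 = "?s2(0 := ?w')"
  let ?s4 = "?s3(0 := [], 1 := rev ?w' @ Letter End_mark # rev ?w, 14 := [?v'])"
  let ?s5 = "?s4(0 := map Letter (encode_pair (C, C')), 1 := [])"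
  let ?s6 = "?s5(15 := [Letter (Bit ((?v = ?v') = b))])"
  have a1: "runs M (read_circuit 15) s 143 4 ?s1"
    by (rule runs_conv[OF runs_read_circuit[where rest = "Letter End_mark # ?w'" and ok = ok and xs = xs and C = C]])
      (use assms M ng[of C] fan[of C] in \<open>auto simp: w is_bit_def blanks_def fun_eq_iff intro: order_trans\<close>)
  have a2: "runs M (Push 1 0 id) ?s1 2 0 ?s2"
    by (rule runs_conv[OF runs_push]) (auto simp: fun_eq_iff)
  have a3: "runs M (Pop 0) ?s2 1 0 ?s3"
    by (rule runs_conv[OF runs_pop]) (auto simp: fun_eq_iff)
  have a4: "runs M (read_circuit 14) ?s3 143 4 ?s4"
    by (rule runs_conv[OF runs_read_circuit[where rest = "[]" and ok = ok and xs = xs and C = C']])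
      (use assms M ng[of C'] fan[of C'] in \<open>auto simp: is_bit_def blanks_def fun_eq_iff intro: order_trans\<close>)
  have a5: "runs M (mv 1 0 id) ?s4 6 1 ?s5"
    by (rule runs_conv[OF runs_mv]) (use M in \<open>auto simp: w fun_eq_iff\<close>)
  have a6: "runs M (Upd 15 14 (\<lambda>x y. Letter (Bit ((x = y) = b)))) ?s5 1 0 ?s6"
    by (rule runs_conv[OF runs_upd]) (auto simp: fun_eq_iff)
  have a7: "runs M (Pop 14) ?s6 1 0 (s(15 := [Letter (Bit ((?v = ?v') = b))]))"
    by (rule runs_conv[OF runs_pop]) (use assms(1,2,12) in \<open>auto simp: fun_eq_iff blanks_def\<close>)
  show ?thesis
    unfolding compare_circuits_def
    by (rule runs_conv[OF runs_seq[OF a1 runs_seq[OF a2 runs_seq[OF a3 runs_seq[OF a4 runs_seq[OF a5 runs_seq[OF a6 a7]]]]]]])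
      simp_all
qed

end

section \<open>Enumerating tuples of bounded support\<close>

text \<open>An odometer with digits \<open>0, \<dots>, a\<close>, least significant digit first, where \<open>b\<close> is the number of
  digits that may still become nonzero. A digit \<open>0\<close> is skipped if \<open>b = 0\<close>.\<close>

fun odo_next :: "nat \<Rightarrow> nat \<Rightarrow> nat list \<Rightarrow> (nat \<times> nat list) option" where
  "odo_next a b [] = None"
| "odo_next a b (d # ds) =
     (if d = 0 then (if b = 0 then map_option (\<lambda>(b', ds'). (b', 0 # ds')) (odo_next a 0 ds) else Some (b - 1, 1 # ds))
      else if d = a then map_option (\<lambda>(b', ds'). (b', 0 # ds')) (odo_next a (Suc b) ds)
      else Some (b, Suc d # ds))"

definition weight :: "nat list \<Rightarrow> nat" where
  "weight ds = length (filter (\<lambda>d. d \<noteq> 0) ds)"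

lemma weight_simps [simp]: "weight [] = 0" "weight (d # ds) = (if d = 0 then weight ds else Suc (weight ds))"
  by (simp_all add: weight_def)

text \<open>The number with digits \<open>ds\<close> in base \<open>a + 1\<close>. The odometer
  skips numbers but never goes down, so this measures its progress.\<close>

definition odo_value :: "nat \<Rightarrow> nat list \<Rightarrow> nat" where
  "odo_value a ds = foldr (\<lambda>d v. d + Suc a * v) ds 0"

lemma odo_value_simps [simp]: "odo_value a [] = 0" "odo_value a (d # ds) = d + Suc a * odo_value a ds"
  by (simp_all add: odo_value_def)

definition sparse :: "nat \<Rightarrow> nat \<Rightarrow> nat \<Rightarrow> nat list set" where
  "sparse a n K = {ds. length ds = n \<and> set ds \<subseteq> {..a} \<and> weight ds \<le> K}"

text \<open>Spent and remaining budget have a constant sum, which bounds the weight of all tuples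
  visited; the growing value excludes repetitions.\<close>

lemma odo_next_props:
  assumes "a \<ge> 1" "odo_next a b ds = Some (b', ds')" "set ds \<subseteq> {..a}"
  shows "length ds' = length ds \<and> set ds' \<subseteq> {..a} \<and> b' + weight ds' = b + weight ds \<and>
    odo_value a ds < odo_value a ds'"
  using assms(2,3)
proof (induction ds arbitrary: b b' ds')
  case (Cons d ds)
  \<comment> \<open>Resetting the first digit loses at most \<open>a\<close>, while an increase of
    the rest gains at least \<open>a + 1\<close>.\<close>
  have lift: "odo_value a (d # ds) < odo_value a (0 # es)" if "odo_value a ds < odo_value a es" for es
  proof -
    have "Suc a * Suc (odo_value a ds) \<le> Suc a * odo_value a es" using that by (intro mult_le_mono2) simp
    moreover have "d \<le> a" using Cons.prems(2) by simp
    ultimately show ?thesis by simp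
  qed
  consider "d = 0" "b = 0" | "d = 0" "b \<noteq> 0" | "d \<noteq> 0" "d = a" | "d \<noteq> 0" "d \<noteq> a" by blast
  then show ?case
  proof cases
    case 1
    then obtain es where "odo_next a 0 ds = Some (b', es)" "ds' = 0 # es" using Cons.prems(1) by auto
    then show ?thesis using Cons.IH[of 0 b' es] Cons.prems(2) lift[of es] 1 by simp
  next
    case 2
    then show ?thesis using Cons.prems assms(1) by auto
  next
    case 3
    then obtain es where "odo_next a (Suc b) ds = Some (b', es)" "ds' = 0 # es" using Cons.prems(1) by auto
    then show ?thesis using Cons.IH[of "Suc b" b' es] Cons.prems(2) lift[of es] 3 by simp
  next
    case 4
    then show ?thesis using Cons.prems by auto
  qed
qed simp

definition odo_step :: "nat \<Rightarrow> nat \<times> nat list \<Rightarrow> nat \<times> nat list \<Rightarrow> bool" where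
  "odo_step a p q \<longleftrightarrow> odo_next a (fst p) (snd p) = Some q"

lemma odo_reach_digit:
  assumes "1 \<le> d" "d \<le> a"
  shows "(odo_step a)\<^sup>*\<^sup>* (b, 1 # ds) (b, d # ds)"
  using assms
proof (induction d rule: dec_induct)
  case (step d)
  then have "odo_step a (b, d # ds) (b, Suc d # ds)" by (simp add: odo_step_def)
  with step show ?case by (meson Suc_leD rtranclp.rtrancl_into_rtrancl)
qed simp

text \<open>A step of the rest is a carry out of the first digit. Without budget it happens at once,
  since the leading 0 is skipped; otherwise the first digit takes one unit of budget, runs from 1 to
  \<open>a\<close>, and gives the unit back.\<close>

lemma odo_reach_lift:
  assumes "a \<ge> 1" "(odo_step a)\<^sup>*\<^sup>* (b, ds) (b', ds')"
  shows "(odo_step a)\<^sup>*\<^sup>* (b, 0 # ds) (b', 0 # ds')"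
  using assms(2)
proof (induction "(b', ds')" arbitrary: b' ds' rule: rtranclp_induct)
  case (step q)
  obtain c es where q: "q = (c, es)" by (cases q)
  have n: "odo_next a c es = Some (b', ds')" using step.hyps(2) by (simp add: q odo_step_def)
  have "(odo_step a)\<^sup>*\<^sup>* (c, 0 # es) (b', 0 # ds')"
  proof (cases "c = 0")
    case True
    then have "odo_step a (c, 0 # es) (b', 0 # ds')" using n by (simp add: odo_step_def)
    then show ?thesis by simp
  next
    case False
    then have "odo_step a (c, 0 # es) (c - 1, 1 # es)" by (simp add: odo_step_def)
    moreover have "(odo_step a)\<^sup>*\<^sup>* (c - 1, 1 # es) (c - 1, a # es)" by (rule odo_reach_digit) (use assms(1) in auto)
    moreover have "odo_step a (c - 1, a # es) (b', 0 # ds')"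
      using n False assms(1) by (simp add: odo_step_def)
    ultimately show ?thesis by (meson converse_rtranclp_into_rtranclp rtranclp.rtrancl_into_rtrancl)
  qed
  then show ?case using step.hyps(3)[OF q] by (rule rtranclp_trans[rotated])
qed simp

text \<open>The rest of the tuple is first reached behind a leading 0; then the leading digit is
  raised, for which budget is left because \<open>weight ds < K\<close>.\<close>

lemma odo_reach:
  assumes "a \<ge> 1" "set ds \<subseteq> {..a}" "weight ds \<le> K"
  shows "(odo_step a)\<^sup>*\<^sup>* (K, replicate (length ds) 0) (K - weight ds, ds)"
  using assms(2,3)
proof (induction ds)
  case (Cons d ds)
  have w: "weight ds \<le> K" using Cons.prems(2) by (simp split: if_splits)
  have 1: "(odo_step a)\<^sup>*\<^sup>* (K, 0 # replicate (length ds) 0) (K - weight ds, 0 # ds)"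
    by (rule odo_reach_lift[OF assms(1)]) (use Cons w in auto)
  show ?case
  proof (cases "d = 0")
    case True
    then show ?thesis using 1 by simp
  next
    case False
    then have "weight ds < K" using Cons.prems(2) by simp
    then have "odo_step a (K - weight ds, 0 # ds) (K - weight ds - 1, 1 # ds)" by (simp add: odo_step_def)
    moreover have "(odo_step a)\<^sup>*\<^sup>* (K - weight ds - 1, 1 # ds) (K - weight ds - 1, d # ds)"
      by (rule odo_reach_digit) (use False Cons.prems in auto)
    moreover have "K - weight ds - 1 = K - weight (d # ds)" using False by simp
    ultimately have "(odo_step a)\<^sup>*\<^sup>* (K - weight ds, 0 # ds) (K - weight (d # ds), d # ds)"
      by (metis converse_rtranclp_into_rtranclp)
    from rtranclp_trans[OF 1 this] show ?thesis by simp
  qed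
qed simp

lemma odo_reach_sparse:
  assumes "a \<ge> 1" "(odo_step a)\<^sup>*\<^sup>* (b, ds) (b', ds')" "length ds = n" "set ds \<subseteq> {..a}" "b + weight ds = K"
  shows "length ds' = n \<and> set ds' \<subseteq> {..a} \<and> b' + weight ds' = K"
  using assms(2)
proof (induction "(b', ds')" arbitrary: b' ds' rule: rtranclp_induct)
  case base
  then show ?case using assms by simp
next
  case (step q)
  obtain c es where q: "q = (c, es)" by (cases q)
  have n: "odo_next a c es = Some (b', ds')" using step.hyps(2) by (simp add: q odo_step_def)
  show ?case using odo_next_props[OF assms(1) n] step.hyps(3)[OF q] by auto
qed

text \<open>So skipping loses nothing: the tuples visited are exactly those of weight at most
  \<open>K\<close>.\<close>

lemma odo_reach_iff:
  assumes "a \<ge> 1"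
  shows "(\<exists>b. (odo_step a)\<^sup>*\<^sup>* (K, replicate n 0) (b, ds)) \<longleftrightarrow> ds \<in> sparse a n K"
proof
  assume "\<exists>b. (odo_step a)\<^sup>*\<^sup>* (K, replicate n 0) (b, ds)"
  then obtain b where "(odo_step a)\<^sup>*\<^sup>* (K, replicate n 0) (b, ds)" ..
  moreover have "set (replicate n 0) \<subseteq> {..a}" "weight (replicate n 0) = 0" by (auto simp: weight_def)
  ultimately show "ds \<in> sparse a n K"
    using odo_reach_sparse[OF assms, of K "replicate n 0" b ds n K] by (auto simp: sparse_def)
next
  assume "ds \<in> sparse a n K"
  then show "\<exists>b. (odo_step a)\<^sup>*\<^sup>* (K, replicate n 0) (b, ds)"
    using odo_reach[OF assms, of ds K] by (auto simp: sparse_def)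
qed

lemma finite_sparse: "finite (sparse a n K)"
  by (rule finite_subset[OF _ finite_lists_length_eq[of "{..a}" n]]) (auto simp: sparse_def)

text \<open>Recursion on the first digit: after one of the \<open>a\<close> nonzero digits a budget
  of \<open>K - 1\<close> remains. The bound is polynomial in \<open>n\<close> for fixed
  \<open>K\<close>, so quasipolynomial for polylogarithmic \<open>K\<close>.\<close>

lemma card_sparse: "card (sparse a n K) \<le> (n * a + 1) ^ K"
proof (induction n arbitrary: K)
  case 0
  have "sparse a 0 K \<subseteq> {[]}" by (auto simp: sparse_def)
  then have "card (sparse a 0 K) \<le> card {[] :: nat list}" by (intro card_mono) auto
  then show ?case by simp
next
  case (Suc n)
  let ?x = "n * a + 1"
  show ?case
  proof (cases K)
    case 0
    have "sparse a (Suc n) 0 \<subseteq> Cons 0 ` sparse a n 0"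
    proof
      fix ds assume "ds \<in> sparse a (Suc n) 0"
      then show "ds \<in> Cons 0 ` sparse a n 0" by (cases ds) (auto simp: sparse_def split: if_splits)
    qed
    then have "card (sparse a (Suc n) 0) \<le> card (Cons 0 ` sparse a n 0)" by (intro card_mono finite_imageI finite_sparse)
    also have "\<dots> \<le> card (sparse a n 0)" by (rule card_image_le[OF finite_sparse])
    finally show ?thesis using Suc[of 0] 0 by simp
  next
    case (Suc L)
    have "sparse a (Suc n) K \<subseteq> Cons 0 ` sparse a n K \<union> (\<lambda>(d, ds). d # ds) ` ({1..a} \<times> sparse a n L)"
    proof
      fix ds assume ds: "ds \<in> sparse a (Suc n) K"
      then obtain d es where d: "ds = d # es" by (cases ds) (auto simp: sparse_def)
      show "ds \<in> Cons 0 ` sparse a n K \<union> (\<lambda>(d, ds). d # ds) ` ({1..a} \<times> sparse a n L)"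
        using ds d Suc by (cases "d = 0") (auto simp: sparse_def image_iff Suc_le_eq)
    qed
    then have "card (sparse a (Suc n) K) \<le> card (Cons 0 ` sparse a n K \<union> (\<lambda>(d, ds). d # ds) ` ({1..a} \<times> sparse a n L))"
      by (intro card_mono finite_UnI finite_imageI finite_cartesian_product finite_sparse) auto
    also have "\<dots> \<le> card (sparse a n K) + card ({1..a} \<times> sparse a n L)"
      by (intro order_trans[OF card_Un_le] add_mono card_image_le finite_cartesian_product finite_sparse) auto
    also have "\<dots> \<le> ?x ^ K + a * ?x ^ L"
      using Suc.IH[of K] Suc.IH[of L] by (intro add_mono) (auto simp: card_cartesian_product)
    also have "\<dots> = (?x + a) * ?x ^ L" by (simp add: Suc algebra_simps)
    also have "\<dots> \<le> (?x + a) * (?x + a) ^ L" by (intro mult_le_mono2 power_mono) auto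
    also have "\<dots> = (Suc n * a + 1) ^ K" by (simp add: Suc algebra_simps)
    finally show ?thesis .
  qed
qed

section \<open>The odometer as a stack program\<close>

definition dig :: "nat \<Rightarrow> 's symbol" where
  "dig j = Aux (2 * j + 1)"

definition dnext :: "nat \<Rightarrow> 's symbol \<Rightarrow> 's symbol" where
  "dnext a x = (case x of Aux n \<Rightarrow> if odd n \<and> n div 2 < a then Aux (n + 2) else mark | _ \<Rightarrow> mark)"

lemma dig_simps [simp]: "dig j \<noteq> Blank" "Blank \<noteq> dig j" "dig i = dig j \<longleftrightarrow> i = j" "j < a \<Longrightarrow> dnext a (dig j) = dig (Suc j)"
  by (auto simp: dig_def dnext_def)

abbreviation flag :: "bool \<Rightarrow> ('a, 'i) letter symbol" where
  "flag b \<equiv> Letter (Bit b)"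

text \<open>Stack 12 tells the state of the carry: \<open>mark\<close> while it travels,
  \<open>flag True\<close> once a digit has absorbed it, \<open>flag False\<close> when the digits
  are exhausted.\<close>

definition odo_digit :: "nat \<Rightarrow> ('a, 'i) letter com" where
  "odo_digit a = Branch 2 (\<lambda>x. x = Blank) (Upd 12 0 (\<lambda>_ _. flag False))
     (Branch 2 (\<lambda>x. x = dig 0)
       (Branch 4 (\<lambda>x. x = Blank) (Push 3 2 id ;; Pop 2)
          (Pop 4 ;; Upd 2 0 (\<lambda>x _. dnext a x) ;; Upd 12 0 (\<lambda>_ _. flag True)))
       (Branch 2 (\<lambda>x. x = dig a) (Push 3 2 (\<lambda>_. dig 0) ;; Pop 2 ;; Push 4 2 (\<lambda>_. mark))
          (Upd 2 0 (\<lambda>x _. dnext a x) ;; Upd 12 0 (\<lambda>_ _. flag True))))"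

lemma runs_odo_digit:
  fixes s :: "nat \<Rightarrow> ('a, 'i) letter symbol list"
  assumes "s 12 = [mark]"
  shows "s 2 = [] \<Longrightarrow> runs M (odo_digit a) s 11 0 (s(12 := [flag False]))"
    and "s 2 = dig 0 # xs \<Longrightarrow> s 4 = [] \<Longrightarrow> runs M (odo_digit a) s 11 0 (s(2 := xs, 3 := dig 0 # s 3))"
    and "s 2 = dig 0 # xs \<Longrightarrow> s 4 = mark # bs \<Longrightarrow> a \<ge> 1 \<Longrightarrow>
      runs M (odo_digit a) s 11 0 (s(2 := dig 1 # xs, 4 := bs, 12 := [flag True]))"
    and "s 2 = dig d # xs \<Longrightarrow> d \<noteq> 0 \<Longrightarrow> d = a \<Longrightarrow>
      runs M (odo_digit a) s 11 0 (s(2 := xs, 3 := dig 0 # s 3, 4 := mark # s 4))"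
    and "s 2 = dig d # xs \<Longrightarrow> d \<noteq> 0 \<Longrightarrow> d < a \<Longrightarrow>
      runs M (odo_digit a) s 11 0 (s(2 := dig (Suc d) # xs, 12 := [flag True]))"
proof -
  assume "s 2 = []"
  with assms show "runs M (odo_digit a) s 11 0 (s(12 := [flag False]))"
    unfolding odo_digit_def
    by (intro runs_conv[OF runs_branchT[OF _ runs_upd]]) auto
next
  assume *: "s 2 = dig 0 # xs" "s 4 = []"
  have "runs M (Push 3 2 id) s 2 0 (s(3 := dig 0 # s 3))"
    by (rule runs_conv[OF runs_push]) (use * in auto)
  moreover have "runs M (Pop 2) (s(3 := dig 0 # s 3)) 1 0 (s(2 := xs, 3 := dig 0 # s 3))"
    by (rule runs_conv[OF runs_pop]) (use * in \<open>auto simp: fun_eq_iff\<close>)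
  ultimately have "runs M (Push 3 2 id ;; Pop 2) s 3 0 (s(2 := xs, 3 := dig 0 # s 3))"
    by (intro runs_conv[OF runs_seq]) auto
  with * show "runs M (odo_digit a) s 11 0 (s(2 := xs, 3 := dig 0 # s 3))"
    unfolding odo_digit_def
    by (intro runs_conv[OF runs_branchF[OF _ runs_branchT[OF _ runs_branchT]]]) auto
next
  assume *: "s 2 = dig 0 # xs" "s 4 = mark # bs" "a \<ge> 1"
  let ?s1 = "s(4 := bs)" let ?s2 = "?s1(2 := dig 1 # xs)"
  have 1: "runs M (Pop 4) s 1 0 ?s1"
    by (rule runs_conv[OF runs_pop]) (use * in auto)
  have 2: "runs M (Upd 2 0 (\<lambda>x _. dnext a x)) ?s1 1 0 ?s2"
    by (rule runs_conv[OF runs_upd]) (use * in \<open>auto simp: fun_eq_iff\<close>)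
  have 3: "runs M (Upd 12 0 (\<lambda>_ _. flag True)) ?s2 1 0 (s(2 := dig 1 # xs, 4 := bs, 12 := [flag True]))"
    by (rule runs_conv[OF runs_upd]) (use * assms in \<open>auto simp: fun_eq_iff\<close>)
  from runs_seq[OF 1 runs_seq[OF 2 3]] * show "runs M (odo_digit a) s 11 0 (s(2 := dig 1 # xs, 4 := bs, 12 := [flag True]))"
    unfolding odo_digit_def
    by (intro runs_conv[OF runs_branchF[OF _ runs_branchT[OF _ runs_branchF]]]) auto
next
  assume *: "s 2 = dig d # xs" "d \<noteq> 0" "d = a"
  let ?s1 = "s(3 := dig 0 # s 3)" let ?s2 = "?s1(2 := xs)"
  have 1: "runs M (Push 3 2 (\<lambda>_. dig 0)) s 2 0 ?s1"
    by (rule runs_conv[OF runs_push]) (use * in auto)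
  have 2: "runs M (Pop 2) ?s1 1 0 ?s2"
    by (rule runs_conv[OF runs_pop]) (use * in \<open>auto simp: fun_eq_iff\<close>)
  have 3: "runs M (Push 4 2 (\<lambda>_. mark)) ?s2 2 0 (s(2 := xs, 3 := dig 0 # s 3, 4 := mark # s 4))"
    by (rule runs_conv[OF runs_push]) (use * in \<open>auto simp: fun_eq_iff\<close>)
  from runs_seq[OF 1 runs_seq[OF 2 3]] * show "runs M (odo_digit a) s 11 0 (s(2 := xs, 3 := dig 0 # s 3, 4 := mark # s 4))"
    unfolding odo_digit_def
    by (intro runs_conv[OF runs_branchF[OF _ runs_branchF[OF _ runs_branchT]]]) auto
next
  assume *: "s 2 = dig d # xs" "d \<noteq> 0" "d < a"
  let ?s2 = "s(2 := dig (Suc d) # xs)"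
  have 2: "runs M (Upd 2 0 (\<lambda>x _. dnext a x)) s 1 0 ?s2"
    by (rule runs_conv[OF runs_upd]) (use * in \<open>auto simp: fun_eq_iff\<close>)
  have 3: "runs M (Upd 12 0 (\<lambda>_ _. flag True)) ?s2 1 0 (s(2 := dig (Suc d) # xs, 12 := [flag True]))"
    by (rule runs_conv[OF runs_upd]) (use * assms in \<open>auto simp: fun_eq_iff\<close>)
  from runs_seq[OF 2 3] * show "runs M (odo_digit a) s 11 0 (s(2 := dig (Suc d) # xs, 12 := [flag True]))"
    unfolding odo_digit_def
    by (intro runs_conv[OF runs_branchF[OF _ runs_branchF[OF _ runs_branchF]]]) auto
qed

text \<open>With loop bound 1 and exponent 0, \<open>runs\<close> just says that \<open>c\<close>
  takes at most \<open>k\<close> steps.\<close>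

lemma exec_loop_first:
  assumes "P (peek (s i))" "runs 1 c s k 0 s1" "\<exists>t \<le> T. exec (Loop i P c) s1 t s2"
  shows "\<exists>t \<le> T + k + 2. exec (Loop i P c) s t s2"
proof -
  obtain t1 where t1: "t1 \<le> k" "exec c s t1 s1" using assms(2) by (auto simp: runs_def)
  obtain t2 where t2: "t2 \<le> T" "exec (Loop i P c) s1 t2 s2" using assms(3) by blast
  show ?thesis using exec.intros(9)[where P = P, OF assms(1) t1(2) t2(2)] t1(1) t2(1)
    by (intro exI[of _ "1 + t1 + 1 + t2"]) auto
qed

lemma exec_loop_stop: "\<not> P (peek (s i)) \<Longrightarrow> \<exists>t \<le> 1. exec (Loop i P c) s t s"
  using exec.intros(8)[of P s i c] by blast

abbreviation odo_loop :: "nat \<Rightarrow> ('a, 'i) letter com" where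
  "odo_loop a \<equiv> Loop 12 (\<lambda>x. x = mark) (odo_digit a)"

text \<open>There are at most 11 + 2 steps for each digit and for the end of the word, and 1 for the
  last test. If there is no next tuple the search is over, so no claim is made about the remaining
  digits.\<close>

lemma exec_odo_loop:
  fixes s :: "nat \<Rightarrow> ('a, 'i) letter symbol list"
  assumes "a \<ge> 1" "s 2 = map dig ds" "s 4 = replicate b mark" "s 12 = [mark]" "set ds \<subseteq> {..a}" "Blank \<notin> set (s 3)"
  shows "\<exists>s'. (\<exists>t \<le> 13 * length ds + 14. exec (odo_loop a) s t s') \<and>
    Blank \<notin> set (s' 3) \<and> length (s' 3) \<le> length (s 3) + length ds \<and>
    (case odo_next a b ds of None \<Rightarrow> s' 12 = [flag False] \<and> s' 11 = s 11
     | Some (b', ds') \<Rightarrow> \<exists>zs xs. s' = s(2 := xs, 3 := zs, 4 := replicate b' mark, 12 := [flag True]) \<and>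
         rev zs @ xs = rev (s 3) @ map dig ds')"
  using assms(2-)
proof (induction ds arbitrary: s b)
  case Nil
  have "\<exists>t \<le> 1 + 11 + 2. exec (odo_loop a) s t (s(12 := [flag False]))"
    by (rule exec_loop_first[OF _ runs_odo_digit(1)]) (use Nil in \<open>auto intro!: exec_loop_stop[of "\<lambda>x. x = mark", simplified]\<close>)
  then show ?case using Nil by (intro exI[of _ "s(12 := [flag False])"]) (auto simp: fun_upd_def)
next
  case (Cons d ds)
  have d: "d \<le> a" using Cons.prems by simp
  have stop: "\<exists>t \<le> 1. exec (odo_loop a) s t s" if "s 12 = [flag True]" for s
    using exec_loop_stop[of "\<lambda>x. x = mark" s 12] that by simp
  \<comment> \<open>The carry moves on: the digit goes to stack 3 as a 0, and the induction
    hypothesis applies with budget \<open>c\<close>.\<close>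
  have skip: ?case if runs: "runs 1 (odo_digit a) s 11 0 s1"
    and s1: "s1 = s(2 := map dig ds, 3 := dig 0 # s 3, 4 := replicate c mark)"
    and nx: "odo_next a b (d # ds) = map_option (\<lambda>(b', ds'). (b', 0 # ds')) (odo_next a c ds)" for s1 c
  proof -
    have "s1 2 = map dig ds" "s1 4 = replicate c mark" "s1 12 = [mark]" "set ds \<subseteq> {..a}" "Blank \<notin> set (s1 3)"
      using Cons.prems by (auto simp: s1)
    from Cons.IH[OF this] obtain s' where s': "\<exists>t \<le> 13 * length ds + 14. exec (odo_loop a) s1 t s'"
      "Blank \<notin> set (s' 3)" "length (s' 3) \<le> length (s1 3) + length ds"
      "case odo_next a c ds of None \<Rightarrow> s' 12 = [flag False] \<and> s' 11 = s1 11
       | Some (b', ds') \<Rightarrow> \<exists>zs xs. s' = s1(2 := xs, 3 := zs, 4 := replicate b' mark, 12 := [flag True]) \<and>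
           rev zs @ xs = rev (s1 3) @ map dig ds'"
      by blast
    have "\<exists>t \<le> (13 * length ds + 14) + 11 + 2. exec (odo_loop a) s t s'"
      by (rule exec_loop_first[OF _ runs s'(1)]) (use Cons.prems in simp)
    then have 1: "\<exists>t \<le> 13 * length (d # ds) + 14. exec (odo_loop a) s t s'" by simp
    have 2: "case odo_next a b (d # ds) of None \<Rightarrow> s' 12 = [flag False] \<and> s' 11 = s 11
       | Some (b', ds') \<Rightarrow> \<exists>zs xs. s' = s(2 := xs, 3 := zs, 4 := replicate b' mark, 12 := [flag True]) \<and>
           rev zs @ xs = rev (s 3) @ map dig ds'"
    proof (cases "odo_next a c ds")
      case None
      then show ?thesis using s'(4) unfolding nx by (simp add: s1)
    next
      case (Some p)
      obtain b' ds' where p: "p = (b', ds')" by (cases p)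
      obtain zs xs where zx: "s' = s1(2 := xs, 3 := zs, 4 := replicate b' mark, 12 := [flag True])"
           "rev zs @ xs = rev (s1 3) @ map dig ds'"
        using s'(4) Some p by auto
      have "s' = s(2 := xs, 3 := zs, 4 := replicate b' mark, 12 := [flag True])"
        unfolding zx(1) s1 by (auto simp: fun_eq_iff)
      then show ?thesis unfolding nx using Some p zx(2) by (auto simp: s1)
    qed
    show ?thesis using 1 2 s'(2,3) by (intro exI[of _ s']) (auto simp: s1)
  qed
  \<comment> \<open>The carry is absorbed and the loop ends, with stack 3 as it was.\<close>
  have final: ?case if runs: "runs 1 (odo_digit a) s 11 0 s1"
    and s1: "s1 = s(2 := map dig es, 4 := replicate c mark, 12 := [flag True])"
    and nx: "odo_next a b (d # ds) = Some (c, es)" for s1 c es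
  proof -
    have "\<exists>t \<le> 1 + 11 + 2. exec (odo_loop a) s t s1"
      by (rule exec_loop_first[OF _ runs stop]) (use Cons.prems s1 in auto)
    then obtain t where "t \<le> 14" "exec (odo_loop a) s t s1" by auto
    then have "\<exists>t \<le> 13 * length (d # ds) + 14. exec (odo_loop a) s t s1" by (intro exI[of _ t]) simp
    moreover have "s1 = s(2 := map dig es, 3 := s 3, 4 := replicate c mark, 12 := [flag True])"
      by (auto simp: s1 fun_eq_iff)
    then have "\<exists>zs xs. s1 = s(2 := xs, 3 := zs, 4 := replicate c mark, 12 := [flag True]) \<and>
         rev zs @ xs = rev (s 3) @ map dig es" by blast
    moreover have "s1 3 = s 3" by (simp add: s1)
    ultimately show ?thesis unfolding nx using Cons.prems(5) by (intro exI[of _ s1]) simp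
  qed
  have s2: "s 2 = dig d # map dig ds" using Cons.prems by simp
  consider "d = 0" "b = 0" | c where "d = 0" "b = Suc c" | "d \<noteq> 0" "d = a" | "d \<noteq> 0" "d < a"
    using d by (cases b) force+
  then show ?case
  proof cases
    case 1
    have "runs 1 (odo_digit a) s 11 0 (s(2 := map dig ds, 3 := dig 0 # s 3, 4 := replicate 0 mark))"
      by (rule runs_conv[OF runs_odo_digit(2)]) (use Cons.prems s2 1 in \<open>auto simp: fun_eq_iff\<close>)
    then show ?thesis by (rule skip[OF _ refl]) (use 1 in simp)
  next
    case (2 c)
    have "runs 1 (odo_digit a) s 11 0 (s(2 := map dig (1 # ds), 4 := replicate c mark, 12 := [flag True]))"
      by (rule runs_conv[OF runs_odo_digit(3)]) (use Cons.prems s2 2 assms(1) in auto)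
    then show ?thesis by (rule final[OF _ refl]) (use 2 in simp)
  next
    case 3
    have "runs 1 (odo_digit a) s 11 0 (s(2 := map dig ds, 3 := dig 0 # s 3, 4 := replicate (Suc b) mark))"
      by (rule runs_conv[OF runs_odo_digit(4)]) (use Cons.prems s2 3 in auto)
    then show ?thesis by (rule skip[OF _ refl]) (use 3 in simp)
  next
    case 4
    have "runs 1 (odo_digit a) s 11 0 (s(2 := map dig (Suc d # ds), 4 := replicate b mark, 12 := [flag True]))"
      by (rule runs_conv[OF runs_odo_digit(5)]) (use Cons.prems s2 4 in \<open>auto simp: fun_eq_iff\<close>)
    then show ?thesis by (rule final[OF _ refl]) (use 4 in simp)
  qed
qed

text \<open>The digits passed by the carry return from stack 3. The answer on stack 11 is written
  only when the enumeration has ended.\<close>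

definition advance :: "nat \<Rightarrow> bool \<Rightarrow> ('a, 'i) letter com" where
  "advance a b = Push 12 0 (\<lambda>_. mark) ;; odo_loop a ;; mv 3 2 id ;;
     Branch 12 (\<lambda>x. x = flag False) (Upd 11 0 (\<lambda>_ _. flag (\<not> b))) Skip ;; Pop 12"

lemma runs_advance:
  fixes s :: "nat \<Rightarrow> ('a, 'i) letter symbol list"
  assumes "a \<ge> 1" "s 2 = map dig ds" "s 3 = []" "s 4 = replicate c mark" "s 11 = [mark]" "s 12 = []"
    "set ds \<subseteq> {..a}" "length ds \<le> M"
  shows "case odo_next a c ds of None \<Rightarrow> \<exists>s'. runs M (advance a b) s 39 1 s' \<and> s' 11 = [flag (\<not> b)]
    | Some (c', ds') \<Rightarrow> runs M (advance a b) s 39 1 (s(2 := map dig ds', 4 := replicate c' mark))"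
proof -
  let ?s1 = "s(12 := [mark])"
  have a1: "runs M (Push 12 0 (\<lambda>_. mark)) s 2 0 ?s1"
    by (rule runs_conv[OF runs_push]) (use assms in auto)
  have "?s1 2 = map dig ds" "?s1 4 = replicate c mark" "?s1 12 = [mark]" "Blank \<notin> set (?s1 3)"
    using assms by auto
  from exec_odo_loop[OF assms(1) this(1-3) assms(7) this(4)] obtain s2 where
    r2: "\<exists>t \<le> 13 * length ds + 14. exec (odo_loop a) ?s1 t s2" "Blank \<notin> set (s2 3)"
      "length (s2 3) \<le> length (?s1 3) + length ds"
      "case odo_next a c ds of None \<Rightarrow> s2 12 = [flag False] \<and> s2 11 = ?s1 11
        | Some (b', ds') \<Rightarrow> \<exists>zs xs. s2 = ?s1(2 := xs, 3 := zs, 4 := replicate b' mark, 12 := [flag True]) \<and>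
         rev zs @ xs = rev (?s1 3) @ map dig ds'"
    by blast
  have s13: "?s1 3 = []" "?s1 11 = s 11" using assms(3) by simp_all
  have s2: "\<exists>t \<le> 13 * length ds + 14. exec (odo_loop a) ?s1 t s2" "Blank \<notin> set (s2 3)" "length (s2 3) \<le> length ds"
      "case odo_next a c ds of None \<Rightarrow> s2 12 = [flag False] \<and> s2 11 = s 11
        | Some (b', ds') \<Rightarrow> \<exists>zs xs. s2 = ?s1(2 := xs, 3 := zs, 4 := replicate b' mark, 12 := [flag True]) \<and>
         rev zs @ xs = map dig ds'"
    using r2 unfolding s13 rev.simps(1) append_Nil list.size(3) add_0 by blast+
  \<comment> \<open>The linear bound fits the format of \<open>runs\<close> because
    \<open>length ds \<le> M\<close> and \<open>1 \<le> M\<close>; 27 is 13 + 14.\<close>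
  have a2: "runs M (odo_loop a) ?s1 27 1 s2"
    unfolding runs_def
  proof
    assume "1 \<le> M"
    then have "13 * length ds + 14 \<le> 27 * M ^ 1" using assms(8) by simp
    then show "\<exists>t\<le>27 * M ^ 1. exec (odo_loop a) ?s1 t s2" using s2(1) by (meson order_trans)
  qed
  let ?s3 = "s2(3 := [], 2 := rev (s2 3) @ s2 2)"
  have a3: "runs M (mv 3 2 id) s2 6 1 ?s3"
    by (rule runs_conv[OF runs_mv]) (use s2 assms(8) in \<open>auto simp: fun_eq_iff\<close>)
  show ?thesis
  proof (cases "odo_next a c ds")
    case None
    then have s12: "s2 12 = [flag False]" "s2 11 = [mark]" using s2(4) assms(5) by auto
    let ?s4 = "?s3(11 := [flag (\<not> b)])"
    have a4: "runs M (Branch 12 (\<lambda>x. x = flag False) (Upd 11 0 (\<lambda>_ _. flag (\<not> b))) Skip) ?s3 3 0 ?s4"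
      by (rule runs_conv[OF runs_branchT[OF _ runs_upd]]) (use s12 in auto)
    have "runs M (advance a b) s 39 1 (?s4(12 := tl (?s4 12)))"
      unfolding advance_def
      by (rule runs_conv[OF runs_seq[OF a1 runs_seq[OF a2 runs_seq[OF a3 runs_seq[OF a4 runs_pop]]]]]) simp_all
    moreover have "(?s4(12 := tl (?s4 12))) 11 = [flag (\<not> b)]" by simp
    ultimately show ?thesis unfolding None option.case by blast
  next
    case (Some p)
    obtain c' ds' where p: "p = (c', ds')" by (cases p)
    obtain zs xs where zx: "s2 = ?s1(2 := xs, 3 := zs, 4 := replicate c' mark, 12 := [flag True])"
         "rev zs @ xs = map dig ds'"
      using s2(4) Some p by auto
    have a4: "runs M (Branch 12 (\<lambda>x. x = flag False) (Upd 11 0 (\<lambda>_ _. flag (\<not> b))) Skip) ?s3 3 0 ?s3"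
      by (rule runs_conv[OF runs_branchF[OF _ runs_skip]]) (use zx in auto)
    have "runs M (advance a b) s 39 1 (?s3(12 := tl (?s3 12)))"
      unfolding advance_def
      by (rule runs_conv[OF runs_seq[OF a1 runs_seq[OF a2 runs_seq[OF a3 runs_seq[OF a4 runs_pop]]]]]) simp_all
    moreover have "?s3(12 := tl (?s3 12)) = s(2 := map dig ds', 4 := replicate c' mark)"
      using zx assms(3,6) by (auto simp: fun_eq_iff)
    ultimately show ?thesis using Some p by simp
  qed
qed

section \<open>The search\<close>

text \<open>The answer is \<open>b\<close> at the first hit and \<open>\<not> b\<close> after the
  last tuple, which is the truth value of \<open>b\<close> being equivalent to the existence of a
  hit. The odometer never repeats a tuple, so the number of sparse tuples bounds the
  iterations.\<close>

lemma exec_search: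
  fixes \<sigma> :: "nat \<Rightarrow> nat list \<Rightarrow> nat \<Rightarrow> ('a, 'i) letter symbol list"
  assumes a: "a \<ge> 1" and go: "\<And>c ds. \<sigma> c ds 11 = [mark]"
    and hit: "\<And>c ds. length ds = n \<Longrightarrow> set ds \<subseteq> {..a} \<Longrightarrow> hit ds \<Longrightarrow>
        \<exists>s'. (\<exists>t \<le> T. exec body (\<sigma> c ds) t s') \<and> s' 11 = [flag b]"
    and stop: "\<And>c ds. length ds = n \<Longrightarrow> set ds \<subseteq> {..a} \<Longrightarrow> \<not> hit ds \<Longrightarrow> odo_next a c ds = None \<Longrightarrow>
        \<exists>s'. (\<exists>t \<le> T. exec body (\<sigma> c ds) t s') \<and> s' 11 = [flag (\<not> b)]"
    and step: "\<And>c ds c' ds'. length ds = n \<Longrightarrow> set ds \<subseteq> {..a} \<Longrightarrow> \<not> hit ds \<Longrightarrow> odo_next a c ds = Some (c', ds') \<Longrightarrow>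
        \<exists>t \<le> T. exec body (\<sigma> c ds) t (\<sigma> c' ds')"
  shows "\<exists>t s'. t \<le> (n * a + 1) ^ K * (T + 2) + 1 \<and>
    exec (Loop 11 (\<lambda>x. x = mark) body) (\<sigma> K (replicate n 0)) t s' \<and>
    s' 11 = [flag (b = (\<exists>ds \<in> sparse a n K. hit ds))]"
proof -
  let ?L = "Loop 11 (\<lambda>x. x = mark) body"
  \<comment> \<open>The variant: the number of sparse tuples of greater value.\<close>
  define rem where "rem ds = card {es \<in> sparse a n K. odo_value a es > odo_value a ds}" for ds
  have last: "\<exists>t\<le>Suc k * (T + 2) + 1. exec ?L s t s'"
    if e: "exec body s t s'" "t \<le> T" "s' 11 = [flag x]" "s 11 = [mark]" for s t s' x k
  proof -
    have "exec ?L s (1 + t + 1 + 1) s'"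
      by (rule exec.intros(9)[OF _ e(1) exec.intros(8)]) (use e in auto)
    then show ?thesis using e(2) by (intro exI[of _ "1 + t + 1 + 1"]) auto
  qed
  have main: "\<exists>t s'. t \<le> Suc (rem ds) * (T + 2) + 1 \<and> exec ?L (\<sigma> c ds) t s' \<and>
     s' 11 = [flag (b = (\<exists>es. (\<exists>c'. (odo_step a)\<^sup>*\<^sup>* (c, ds) (c', es)) \<and> hit es))]"
    if "length ds = n" "set ds \<subseteq> {..a}" "c + weight ds = K" for c ds
    using that
  proof (induction "rem ds" arbitrary: c ds rule: less_induct)
    case less
    show ?case
    proof (cases "hit ds")
      case True
      obtain s' t where s': "exec body (\<sigma> c ds) t s'" "t \<le> T" "s' 11 = [flag b]"
        using hit[OF less.prems(1,2) True] by blast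
      have "\<exists>es. (\<exists>c'. (odo_step a)\<^sup>*\<^sup>* (c, ds) (c', es)) \<and> hit es" using True by blast
      then have "s' 11 = [flag (b = (\<exists>es. (\<exists>c'. (odo_step a)\<^sup>*\<^sup>* (c, ds) (c', es)) \<and> hit es))]" using s'(3) by simp
      then show ?thesis using last[OF s' go, of "rem ds"] by blast
    next
      case False
      show ?thesis
      proof (cases "odo_next a c ds")
        case None
        obtain s' t where s': "exec body (\<sigma> c ds) t s'" "t \<le> T" "s' 11 = [flag (\<not> b)]"
          using stop[OF less.prems(1,2) False None] by blast
        have "es = ds" if "(odo_step a)\<^sup>*\<^sup>* (c, ds) (c', es)" for c' es
          using that None by (cases rule: converse_rtranclpE) (auto simp: odo_step_def)
        then have "\<not> (\<exists>es. (\<exists>c'. (odo_step a)\<^sup>*\<^sup>* (c, ds) (c', es)) \<and> hit es)" using False by blast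
        then have nex: "(\<exists>es. (\<exists>c'. (odo_step a)\<^sup>*\<^sup>* (c, ds) (c', es)) \<and> hit es) \<longleftrightarrow> False" by blast
        have "s' 11 = [flag (b = (\<exists>es. (\<exists>c'. (odo_step a)\<^sup>*\<^sup>* (c, ds) (c', es)) \<and> hit es))]"
          unfolding nex using s'(3) by simp
        then show ?thesis using last[OF s' go, of "rem ds"] by blast
      next
        case (Some p)
        obtain c' ds' where p: "odo_next a c ds = Some (c', ds')" using Some by (cases p) auto
        note pr = odo_next_props[OF a p less.prems(2)]
        obtain t where t: "t \<le> T" "exec body (\<sigma> c ds) t (\<sigma> c' ds')"
          using step[OF less.prems(1,2) False p] by blast
        have sp: "ds' \<in> sparse a n K" using pr less.prems by (auto simp: sparse_def)
        have rem: "rem ds' < rem ds"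
          unfolding rem_def
        proof (rule psubset_card_mono)
          show "finite {es \<in> sparse a n K. odo_value a ds < odo_value a es}" using finite_sparse by simp
          show "{es \<in> sparse a n K. odo_value a ds' < odo_value a es} \<subset> {es \<in> sparse a n K. odo_value a ds < odo_value a es}"
            using pr sp by auto
        qed
        have pr': "length ds' = n" "set ds' \<subseteq> {..a}" "c' + weight ds' = K" using pr less.prems by auto
        obtain t' s' where t': "t' \<le> Suc (rem ds') * (T + 2) + 1" "exec ?L (\<sigma> c' ds') t' s'"
           "s' 11 = [flag (b = (\<exists>es. (\<exists>c''. (odo_step a)\<^sup>*\<^sup>* (c', ds') (c'', es)) \<and> hit es))]"
          using less.hyps[OF rem pr'] by blast
        have "odo_step a (c, ds) (c', ds')" using p by (simp add: odo_step_def)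
        \<comment> \<open>The odometer is deterministic, so what is reachable is the present tuple
          or reachable from its only successor.\<close>
        then have reach: "(odo_step a)\<^sup>*\<^sup>* (c, ds) (c'', es) \<longleftrightarrow> (c'', es) = (c, ds) \<or> (odo_step a)\<^sup>*\<^sup>* (c', ds') (c'', es)" for c'' es
          using p by (auto simp: odo_step_def intro: converse_rtranclp_into_rtranclp elim: converse_rtranclpE)
        have eqv: "(\<exists>es. (\<exists>c''. (odo_step a)\<^sup>*\<^sup>* (c, ds) (c'', es)) \<and> hit es) \<longleftrightarrow>
            (\<exists>es. (\<exists>c''. (odo_step a)\<^sup>*\<^sup>* (c', ds') (c'', es)) \<and> hit es)"
          unfolding reach using False by blast
        have "s' 11 = [flag (b = (\<exists>es. (\<exists>c''. (odo_step a)\<^sup>*\<^sup>* (c, ds) (c'', es)) \<and> hit es))]"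
          unfolding eqv by (rule t'(3))
        moreover have "exec ?L (\<sigma> c ds) (1 + t + 1 + t') s'"
          by (rule exec.intros(9)[OF _ t(2) t'(2)]) (simp add: go)
        moreover have "1 + t + 1 + t' \<le> Suc (rem ds) * (T + 2) + 1"
        proof -
          have "Suc (rem ds') * (T + 2) \<le> rem ds * (T + 2)" using rem by (intro mult_le_mono1) simp
          then show ?thesis using t(1) t'(1) by simp
        qed
        ultimately show ?thesis by blast
      qed
    qed
  qed
  have z: "replicate n 0 \<in> sparse a n K" "weight (replicate n 0) = 0" by (auto simp: sparse_def weight_def)
  have "rem (replicate n 0) < card (sparse a n K)"
    unfolding rem_def by (rule psubset_card_mono[OF finite_sparse]) (use z in auto)
  then have r: "Suc (rem (replicate n 0)) \<le> (n * a + 1) ^ K"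
    using card_sparse[of a n K] by linarith
  obtain t s' where t: "t \<le> Suc (rem (replicate n 0)) * (T + 2) + 1" "exec ?L (\<sigma> K (replicate n 0)) t s'"
     "s' 11 = [flag (b = (\<exists>es. (\<exists>c'. (odo_step a)\<^sup>*\<^sup>* (K, replicate n 0) (c', es)) \<and> hit es))]"
    using main[of "replicate n 0" K] z by (auto simp: sparse_def)
  have "t \<le> (n * a + 1) ^ K * (T + 2) + 1"
    using t(1) mult_le_mono1[OF r, of "T + 2"] by linarith
  then show ?thesis using t(2,3) unfolding odo_reach_iff[OF a] by (auto simp: Bex_def)
qed

section \<open>Setting up the search\<close>

text \<open>As \<open>Pop\<close> does nothing on an empty stack, the loop turns \<open>n\<close> marks into \<open>(n + 1) div 2\<close>, where \<open>n\<close> is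
  the number of marks after the first \<open>Pop\<close>.\<close>

definition halve :: "'s com" where
  "halve = Pop 8 ;; Loop 8 nonblank (Pop 8 ;; Pop 8 ;; Push 9 8 (\<lambda>_. mark)) ;; mv 9 8 id"

lemma runs_halve:
  assumes "s 8 = replicate (Suc n) mark" "s 9 = []" "n \<le> M"
  shows "runs M halve s 14 1 (s(8 := replicate (Suc n div 2) mark))"
proof -
  define h where "h = Suc n div 2"
  have hM: "h \<le> M" using assms(3) by (simp add: h_def)
  let ?s1 = "s(8 := replicate n mark)"
  define \<sigma> where "\<sigma> m = s(8 := replicate (n - 2 * m) mark, 9 := replicate m mark)" for m
  have a1: "runs M (Pop 8) s 1 0 ?s1"
    by (rule runs_conv[OF runs_pop]) (use assms in auto)
  have a2: "runs M (Loop 8 nonblank (Pop 8 ;; Pop 8 ;; Push 9 8 (\<lambda>_. mark))) ?s1 (4 + 3) (Suc 0)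
      (s(8 := [], 9 := replicate h mark))"
  proof (rule runs_loop[where \<sigma> = \<sigma>, OF hM], intro conjI)
    fix m assume m: "m < h"
    then obtain l where l: "n - 2 * m = Suc l" by (cases "n - 2 * m") (auto simp: h_def)
    then have l': "n - 2 * Suc m = l - 1" by simp
    show "peek (\<sigma> m 8) \<noteq> Blank" by (simp add: \<sigma>_def l)
    show "runs M (Pop 8 ;; Pop 8 ;; Push 9 8 (\<lambda>_. mark)) (\<sigma> m) 4 0 (\<sigma> (Suc m))"
      by (rule runs_conv, rule runs_seq, rule runs_pop, rule runs_seq, rule runs_pop, rule runs_push)
        (use l l' in \<open>auto simp: \<sigma>_def fun_eq_iff\<close>)
  next
    show "\<not> peek (\<sigma> h 8) \<noteq> Blank" "s(8 := [], 9 := replicate h mark) = \<sigma> h"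
      by (auto simp: \<sigma>_def h_def)
  qed (use assms in \<open>auto simp: \<sigma>_def fun_eq_iff\<close>)
  have a3: "runs M (mv 9 8 id) (s(8 := [], 9 := replicate h mark)) 6 1 (s(8 := replicate h mark))"
    by (rule runs_conv[OF runs_mv]) (use assms hM in \<open>auto simp: fun_eq_iff\<close>)
  show ?thesis unfolding halve_def h_def[symmetric]
    by (rule runs_conv[OF runs_seq[OF a1 runs_seq[OF a2 a3]]]) simp_all
qed

definition log_marks :: "'s com" where
  "log_marks = Loop 8 nonblank (halve ;; Push 13 8 (\<lambda>_. mark))"

text \<open>After \<open>m\<close> rounds \<open>N div 2 ^ m\<close> marks are left, and this is 0
  for the first time at \<open>m = bit_length N\<close>.\<close>

lemma runs_log_marks:
  assumes "s 8 = replicate N mark" "s 9 = []" "s 13 = []" "N \<le> M"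
  shows "runs M log_marks s 19 2 (s(8 := [], 13 := replicate (bit_length N) mark))"
proof -
  define \<sigma> where "\<sigma> m = s(8 := replicate (N div 2 ^ m) mark, 13 := replicate m mark)" for m
  have z: "N div 2 ^ bit_length N = 0" using bit_length[of N] by simp
  have bl: "bit_length N \<le> N" unfolding bit_length_def by (rule Least_le) simp
  have "runs M log_marks s (16 + 3) (Suc 1) (s(8 := [], 13 := replicate (bit_length N) mark))"
    unfolding log_marks_def
  proof (rule runs_loop[where \<sigma> = \<sigma> and n = "bit_length N"], use bl assms in simp, intro conjI)
    fix m assume m: "m < bit_length N"
    have "N div 2 ^ m > 0" using bit_length_le[OF m] by (simp add: div_greater_zero_iff)
    then obtain l where l: "N div 2 ^ m = Suc l" by (cases "N div 2 ^ m") auto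
    have l2: "N div 2 ^ Suc m = Suc l div 2"
      unfolding l[symmetric] power_Suc2 div_mult2_eq ..
    have lM: "l \<le> M" using l assms(4) div_le_dividend[of N "2 ^ m"] by linarith
    show "peek (\<sigma> m 8) \<noteq> Blank" by (simp add: \<sigma>_def l)
    have h: "runs M halve (\<sigma> m) 14 1 ((\<sigma> m)(8 := replicate (Suc l div 2) mark))"
      by (rule runs_halve) (use lM assms l in \<open>auto simp: \<sigma>_def\<close>)
    have p: "runs M (Push 13 8 (\<lambda>_. mark)) ((\<sigma> m)(8 := replicate (Suc l div 2) mark)) 2 0 (\<sigma> (Suc m))"
      by (rule runs_conv[OF runs_push]) (use l2 in \<open>auto simp: \<sigma>_def fun_eq_iff simp del: power_Suc\<close>)
    show "runs M (halve ;; Push 13 8 (\<lambda>_. mark)) (\<sigma> m) 16 1 (\<sigma> (Suc m))"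
      by (rule runs_conv[OF runs_seq[OF h p]]) auto
  qed (use assms z in \<open>auto simp: \<sigma>_def fun_eq_iff\<close>)
  then show ?thesis by (rule runs_conv) auto
qed

text \<open>Every mark on stack 4 is traded for a copy of stack 13, which holds the other factor and
  is restored through stack 14.\<close>

definition mult_marks :: "'s com" where
  "mult_marks = Loop 4 nonblank (Pop 4 ;; mv2 13 14 8 nonblank id id ;; mv 14 13 id) ;; mv 8 4 id"

lemma runs_mult_marks:
  assumes "s 4 = replicate K mark" "s 13 = replicate L mark" "s 8 = []" "s 14 = []" "K \<le> M" "L \<le> M" "K * L \<le> M"
  shows "runs M mult_marks s 24 2 (s(4 := replicate (K * L) mark))"
proof -
  define \<sigma> where "\<sigma> m = s(4 := replicate (K - m) mark, 8 := replicate (m * L) mark)" for m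
  have a1: "runs M (Loop 4 nonblank (Pop 4 ;; mv2 13 14 8 nonblank id id ;; mv 14 13 id)) s (15 + 3) (Suc 1)
      (s(4 := [], 8 := replicate (K * L) mark))"
  proof (rule runs_loop[where \<sigma> = \<sigma>, OF assms(5)], intro conjI)
    fix m assume m: "m < K"
    then obtain l where l: "K - m = Suc l" by (metis Suc_diff_Suc)
    then have l': "K - Suc m = l" by simp
    show "peek (\<sigma> m 4) \<noteq> Blank" by (simp add: \<sigma>_def l)
    let ?s1 = "(\<sigma> m)(4 := replicate l mark)"
    let ?s2 = "?s1(13 := [], 14 := replicate L mark, 8 := replicate (Suc m * L) mark)"
    have 1: "runs M (Pop 4) (\<sigma> m) 1 0 ?s1"
      by (rule runs_conv[OF runs_pop]) (auto simp: \<sigma>_def l)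
    have 2: "runs M (mv2 13 14 8 nonblank id id) ?s1 8 1 ?s2"
      by (rule runs_conv[OF runs_mv2[of _ _ _ _ "replicate L mark" "[]"]])
        (use assms in \<open>auto simp: \<sigma>_def fun_eq_iff replicate_add\<close>)
    have 3: "runs M (mv 14 13 id) ?s2 6 1 (\<sigma> (Suc m))"
      by (rule runs_conv[OF runs_mv]) (use assms l' in \<open>auto simp: \<sigma>_def fun_eq_iff\<close>)
    show "runs M (Pop 4 ;; mv2 13 14 8 nonblank id id ;; mv 14 13 id) (\<sigma> m) 15 1 (\<sigma> (Suc m))"
      by (rule runs_conv[OF runs_seq[OF 1 runs_seq[OF 2 3]]]) auto
  qed (use assms in \<open>auto simp: \<sigma>_def fun_eq_iff\<close>)
  have a2: "runs M (mv 8 4 id) (s(4 := [], 8 := replicate (K * L) mark)) 6 1 (s(4 := replicate (K * L) mark))"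
    by (rule runs_conv[OF runs_mv]) (use assms in \<open>auto simp: fun_eq_iff\<close>)
  show ?thesis unfolding mult_marks_def by (rule runs_conv[OF runs_seq[OF a1 a2]]) auto
qed

fun power_marks :: "nat \<Rightarrow> 's com" where
  "power_marks 0 = Skip"
| "power_marks (Suc r) = power_marks r ;; mult_marks"

lemma runs_power_marks:
  assumes "s 4 = [mark]" "s 13 = replicate L mark" "s 8 = []" "s 14 = []" "1 \<le> L" "L ^ Suc r \<le> M"
  shows "runs M (power_marks r) s (24 * r) 2 (s(4 := replicate (L ^ r) mark))"
  using assms(6)
proof (induction r)
  case 0
  then show ?case by (auto intro!: runs_conv[OF runs_skip] simp: assms fun_eq_iff)
next
  case (Suc r)
  have le: "L ^ Suc r \<le> M" "L ^ r \<le> M" "L ^ 1 \<le> M"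
    using Suc.prems assms(5) power_increasing[of "Suc r" "Suc (Suc r)" L] power_increasing[of r "Suc (Suc r)" L]
      power_increasing[of 1 "Suc (Suc r)" L] by linarith+
  have "runs M mult_marks (s(4 := replicate (L ^ r) mark)) 24 2 (s(4 := replicate (L ^ Suc r) mark))"
    by (rule runs_conv[OF runs_mult_marks[of _ "L ^ r" L]]) (use assms le in \<open>auto simp: mult.commute fun_eq_iff\<close>)
  note seq = runs_seq[OF Suc.IH[OF le(1)] this]
  show ?case unfolding power_marks.simps by (rule runs_conv[OF seq]) (auto simp: fun_eq_iff)
qed

text \<open>The budget is a power of the bit length of the input length, which is at least the
  number of gates of both circuits, as \<open>sparse_solutions\<close> requires. The leading input
  marks of the first circuit become the initial tuple of zeros.\<close>

definition setup_search :: "nat \<Rightarrow> ('a, 'i) letter com" where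
  "setup_search r = mv2 0 1 8 nonblank id (\<lambda>_. mark) ;; mv 1 0 id ;; log_marks ;; Push 4 0 (\<lambda>_. mark) ;;
     power_marks r ;; mv2 0 1 2 (\<lambda>x. x = Letter Input_mark) id (\<lambda>_. dig 0) ;; mv 1 0 id ;; Push 11 0 (\<lambda>_. mark)"

lemma runs_setup_search:
  fixes w :: "('a, 'i) letter list"
  assumes w: "w = replicate n Input_mark @ v" "peek (map Letter v) \<noteq> Letter Input_mark" and N: "length w = N" "1 \<le> N"
    and M: "Suc N ^ Suc r \<le> M"
  shows "runs M (setup_search r) (init_stacks w) (51 + 24 * r) 2 ((init_stacks w)
     (2 := map dig (replicate n 0), 4 := replicate (bit_length N ^ r) mark, 11 := [mark], 13 := replicate (bit_length N) mark))"
proof -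
  let ?s = "init_stacks w" and ?L = "bit_length N"
  have L1: "1 \<le> ?L" using N(2) bit_length[of N] by (cases ?L) auto
  have LN: "?L \<le> N" unfolding bit_length_def by (rule Least_le) simp
  have "?L ^ Suc r \<le> Suc N ^ Suc r" using LN by (intro power_mono) auto
  then have LM: "?L ^ Suc r \<le> M" using M by linarith
  have "Suc N ^ 1 \<le> Suc N ^ Suc r" by (intro power_increasing) auto
  then have NM: "N \<le> M" using M by simp
  have nN: "n \<le> N" using w(1) N(1) by auto
  have s: "?s 0 = map Letter w" "\<And>i. i \<noteq> 0 \<Longrightarrow> ?s i = []" by (auto simp: init_stacks_def)
  let ?s1 = "?s(0 := [], 1 := rev (map Letter w), 8 := replicate N mark)"
  let ?s2 = "?s(8 := replicate N mark)"
  let ?s3 = "?s(13 := replicate ?L mark)"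
  let ?s4 = "?s3(4 := [mark])"
  let ?s5 = "?s3(4 := replicate (?L ^ r) mark)"
  let ?s6 = "?s5(0 := map Letter v, 1 := replicate n (Letter Input_mark), 2 := replicate n (dig 0))"
  let ?s7 = "?s5(2 := replicate n (dig 0))"
  have a1: "runs M (mv2 0 1 8 nonblank id (\<lambda>_. mark)) ?s 8 1 ?s1"
    by (rule runs_conv[OF runs_mv2[of _ _ _ _ "map Letter w" "[]"]])
      (use s NM N in \<open>auto simp: fun_eq_iff map_replicate_const\<close>)
  have a2: "runs M (mv 1 0 id) ?s1 6 1 ?s2"
    by (rule runs_conv[OF runs_mv]) (use s NM N in \<open>auto simp: fun_eq_iff\<close>)
  have a3: "runs M log_marks ?s2 19 2 ?s3"
    by (rule runs_conv[OF runs_log_marks]) (use s NM in \<open>auto simp: fun_eq_iff\<close>)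
  have a4: "runs M (Push 4 0 (\<lambda>_. mark)) ?s3 2 0 ?s4"
    by (rule runs_conv[OF runs_push]) (use s in \<open>auto simp: fun_eq_iff\<close>)
  have a5: "runs M (power_marks r) ?s4 (24 * r) 2 ?s5"
    by (rule runs_conv[OF runs_power_marks]) (use s L1 LM in \<open>auto simp: fun_eq_iff\<close>)
  have a6: "runs M (mv2 0 1 2 (\<lambda>x. x = Letter Input_mark) id (\<lambda>_. dig 0)) ?s5 8 1 ?s6"
    by (rule runs_conv[OF runs_mv2[of _ _ _ _ "replicate n (Letter Input_mark)" "map Letter v"]])
      (use s NM nN w in \<open>auto simp: fun_eq_iff map_replicate_const\<close>)
  have a7: "runs M (mv 1 0 id) ?s6 6 1 ?s7"
    by (rule runs_conv[OF runs_mv]) (use s NM nN w in \<open>auto simp: fun_eq_iff\<close>)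
  have a8: "runs M (Push 11 0 (\<lambda>_. mark)) ?s7 2 0 (?s
     (2 := map dig (replicate n 0), 4 := replicate (?L ^ r) mark, 11 := [mark], 13 := replicate ?L mark))"
    by (rule runs_conv[OF runs_push]) (use s in \<open>auto simp: fun_eq_iff\<close>)
  show ?thesis unfolding setup_search_def
    by (rule runs_conv[OF runs_seq[OF a1 runs_seq[OF a2 runs_seq[OF a3 runs_seq[OF a4 runs_seq[OF a5 runs_seq[OF a6 runs_seq[OF a7 a8]]]]]]]])
      simp_all
qed

section \<open>The machine for an algebra\<close>

abbreviation elem_symbol :: "'a \<Rightarrow> ('a, 'i) letter symbol" where
  "elem_symbol x \<equiv> Letter (Label (Elem x))"

text \<open>A gate whose first arguments have been read is stored in a single symbol.\<close>

definition partial_gates :: "('a, 'i) ualg \<Rightarrow> (('a, 'i) alg_gate \<times> 'a list) set" where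
  "partial_gates A = {(g, vs). set vs \<subseteq> universe A \<and>
     (\<exists>k. alg_fan_in_ok A g k \<and> length vs \<le> k)}"

definition gate_code :: "('a, 'i) ualg \<Rightarrow> ('a, 'i) alg_gate \<times> 'a list \<Rightarrow> nat" where
  "gate_code A = (SOME f. inj_on f (partial_gates A))"

text \<open>The numbers are even and positive, so gate symbols are neither digits, whose numbers are
  odd, nor \<open>mark\<close>.\<close>

definition gate_symbol :: "('a, 'i) ualg \<Rightarrow> ('a, 'i) alg_gate \<times> 'a list \<Rightarrow> ('a, 'i) letter symbol" where
  "gate_symbol A p = Aux (2 * gate_code A p + 2)"

definition add_argument :: "('a, 'i) ualg \<Rightarrow> 'a \<Rightarrow> ('a, 'i) alg_gate \<times> 'a list \<Rightarrow> ('a, 'i) letter symbol" where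
  "add_argument A v p = (if (fst p, snd p @ [v]) \<in> partial_gates A then gate_symbol A (fst p, snd p @ [v]) else mark)"

text \<open>Symbol functions have to map the whole alphabet into itself, so \<open>mark\<close> is
  returned on symbols that do not occur here; likewise for the functions below and for
  \<open>dnext\<close>.\<close>

definition start_gate :: "('a, 'i) ualg \<Rightarrow> ('a, 'i) letter symbol \<Rightarrow> ('a, 'i) letter symbol" where
  "start_gate A x = (case x of Letter (Label g) \<Rightarrow>
     if (g, []) \<in> partial_gates A then gate_symbol A (g, []) else mark | _ \<Rightarrow> mark)"

definition feed_gate :: "('a, 'i) ualg \<Rightarrow> ('a, 'i) letter symbol \<Rightarrow> ('a, 'i) letter symbol \<Rightarrow> ('a, 'i) letter symbol" where
  "feed_gate A x y = (if x \<in> gate_symbol A ` partial_gates A then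
     (case y of Letter (Label (Elem v)) \<Rightarrow> add_argument A v (inv_into (partial_gates A) (gate_symbol A) x)
      | _ \<Rightarrow> mark) else mark)"

definition finish_gate :: "('a, 'i) ualg \<Rightarrow> ('a, 'i) letter symbol \<Rightarrow> ('a, 'i) letter symbol" where
  "finish_gate A x = (if x \<in> gate_symbol A ` partial_gates A then
     (let p = inv_into (partial_gates A) (gate_symbol A) x; v = alg_sem A (fst p) (snd p)
      in if v \<in> universe A then elem_symbol v else mark) else mark)"

text \<open>The digit \<open>0\<close> stands for \<open>z\<close>; the digits \<open>1, 2, \<dots>\<close> run through all elements, \<open>z\<close> included.\<close>

definition digit_elem :: "'a list \<Rightarrow> 'a \<Rightarrow> nat \<Rightarrow> 'a" where
  "digit_elem es z j = (if j = 0 then z else es ! (j - 1))"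

definition digit_value :: "'a list \<Rightarrow> 'a \<Rightarrow> ('a, 'i) letter symbol \<Rightarrow> ('a, 'i) letter symbol" where
  "digit_value es z x = (case x of Aux n \<Rightarrow>
     if odd n \<and> n div 2 \<le> length es then elem_symbol (digit_elem es z (n div 2)) else mark | _ \<Rightarrow> mark)"

definition alphabet :: "('a, 'i) ualg \<Rightarrow> nat \<Rightarrow> ('a, 'i) letter symbol set" where
  "alphabet A a = {Blank, mark} \<union>
     Letter ` ({Bit True, Bit False, Comma, Output_mark, End_mark, Input_mark} \<union>
       Label ` (Basic ` index A \<union> Elem ` universe A)) \<union>
     dig ` {..a} \<union> gate_symbol A ` partial_gates A"

lemma finite_partial_gates:
  assumes "finite (universe A)" "finite (index A)"
  shows "finite (partial_gates A)"
proof -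
  let ?B = "Basic ` index A :: ('a, 'b) alg_gate set"
  have "partial_gates A \<subseteq> (\<Union>i \<in> index A. {Basic i} \<times> {vs. set vs \<subseteq> universe A \<and> length vs \<le> arity A i}) \<union>
      (Elem ` universe A) \<times> {[]}"
  proof
    fix p assume "p \<in> partial_gates A"
    then obtain g vs k where "p = (g, vs)" "set vs \<subseteq> universe A" "alg_fan_in_ok A g k" "length vs \<le> k"
      by (auto simp: partial_gates_def)
    then show "p \<in> (\<Union>i \<in> index A. {Basic i} \<times> {vs. set vs \<subseteq> universe A \<and> length vs \<le> arity A i}) \<union>
      (Elem ` universe A) \<times> {[]}"
      by (cases g) auto
  qed
  then show ?thesis
    by (rule finite_subset) (use assms finite_lists_length_le in blast)
qed

context
  fixes A :: "('a, 'i) ualg" and es :: "'a list" and z :: 'a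
  assumes A: "is_algebra A" "finite (index A)" and es: "set es = universe A" and z: "z \<in> universe A"
begin

lemma finite_universe: "finite (universe A)"
  using es by (metis List.finite_set)

lemma inj_gate_symbol: "inj_on (gate_symbol A) (partial_gates A)"
proof -
  obtain f :: "('a, 'i) alg_gate \<times> 'a list \<Rightarrow> nat" where "inj_on f (partial_gates A)"
    using finite_imp_inj_to_nat_seg[OF finite_partial_gates[OF finite_universe A(2)]] by blast
  then have "inj_on (gate_code A) (partial_gates A)"
    unfolding gate_code_def by (rule someI[of "\<lambda>f. inj_on f (partial_gates A)"])
  then show ?thesis by (auto simp: inj_on_def gate_symbol_def)
qed

text \<open>Induction on the number of arguments read: every prefix of a legal argument list is a
  partial gate and has a symbol of its own.\<close>

lemma gate_fold:
  assumes "alg_fan_in_ok A g (length vs)" "set vs \<subseteq> universe A"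
  shows "foldl (feed_gate A) (start_gate A (Letter (Label g))) (map elem_symbol vs) = gate_symbol A (g, vs)"
proof -
  have pg: "(g, take m vs) \<in> partial_gates A" for m
  proof -
    have "set (take m vs) \<subseteq> universe A" using assms(2) set_take_subset by fast
    then show ?thesis using assms(1) by (auto simp: partial_gates_def intro!: exI[of _ "length vs"])
  qed
  have "m \<le> length vs \<Longrightarrow> foldl (feed_gate A) (start_gate A (Letter (Label g))) (map elem_symbol (take m vs)) =
      gate_symbol A (g, take m vs)" for m
  proof (induction m)
    case 0
    then show ?case using pg[of 0] by (simp add: start_gate_def)
  next
    case (Suc m)
    then have m: "m < length vs" by simp
    have t: "take (Suc m) vs = take m vs @ [vs ! m]" using m by (simp add: take_Suc_conv_app_nth)
    have "feed_gate A (gate_symbol A (g, take m vs)) (elem_symbol (vs ! m)) = gate_symbol A (g, take (Suc m) vs)"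
      using pg[of m] pg[of "Suc m"] inj_gate_symbol by (simp add: feed_gate_def add_argument_def t)
    then show ?case using Suc.IH m by (simp add: t)
  qed
  from this[of "length vs"] show ?thesis by simp
qed

abbreviation sym_value :: "('a, 'i) alg_gate \<Rightarrow> ('a, 'i) letter symbol list \<Rightarrow> ('a, 'i) letter symbol" where
  "sym_value \<equiv> gate_value (start_gate A) (finish_gate A) (feed_gate A)"

lemma sym_value:
  assumes "alg_fan_in_ok A g (length vs)" "set vs \<subseteq> universe A"
  shows "sym_value g (map elem_symbol vs) = elem_symbol (alg_sem A g vs) \<and> alg_sem A g vs \<in> universe A"
proof -
  have u: "alg_sem A g vs \<in> universe A"
    using assms A(1) by (cases g) (auto simp: is_algebra_def tuples_def)
  have "(g, vs) \<in> partial_gates A" using assms by (auto simp: partial_gates_def)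
  then show ?thesis
    using inj_gate_symbol u by (simp add: gate_value_def gate_fold[OF assms] finish_gate_def)
qed

text \<open>\<open>elem_symbol\<close> carries the evaluation over \<open>A\<close> to the
  evaluation on symbols, node by node. Being injective, it also preserves and reflects equality of
  the two outputs.\<close>

lemma sym_circuit_value:
  assumes C: "wf_circuit (alg_fan_in_ok A) C" and xs: "xs \<in> tuples (inputs C) (universe A)"
  shows "circuit_value sym_value C (map elem_symbol xs) = elem_symbol (circuit_value (alg_sem A) C xs)"
proof -
  let ?v = "eval_gates (alg_sem A) (gates C) xs" and ?w = "eval_gates sym_value (gates C) (map elem_symbol xs)"
  have len: "length xs = inputs C" using xs by (simp add: tuples_def)
  have "?w ! j = elem_symbol (?v ! j) \<and> ?v ! j \<in> universe A" if "j < num_gates C" for j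
    using that
  proof (induction j rule: less_induct)
    case (less j)
    show ?case
    proof (cases "j < inputs C")
      case True
      then show ?thesis
        using eval_gates_prefix[of j xs "alg_sem A" "gates C"] eval_gates_prefix[of j "map elem_symbol xs" sym_value "gates C"]
          xs len by (auto simp: tuples_def)
    next
      case False
      then obtain t where t: "j = inputs C + t" "t < length (gates C)"
        using less.prems by (metis le_Suc_ex nat_add_left_cancel_less not_less num_gates_def)
      obtain g ps where g: "gates C ! t = (g, ps)" by (cases "gates C ! t")
      have wf: "alg_fan_in_ok A g (length ps)" "\<forall>p \<in> set ps. p < inputs C + t"
        using C t(2) g by (auto simp: wf_circuit_def)
      have IH: "?w ! p = elem_symbol (?v ! p) \<and> ?v ! p \<in> universe A" if "p \<in> set ps" for p
        using less.IH[of p] less.prems wf(2) that t(1) by auto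
      have v: "?v ! j = alg_sem A g (map (\<lambda>p. ?v ! p) ps)"
        using eval_gates_nth[OF t(2) g, of xs "alg_sem A"] wf(2) len t(1) by simp
      have "?w ! j = sym_value g (map (\<lambda>p. ?w ! p) ps)"
        using eval_gates_nth[OF t(2) g, of "map elem_symbol xs" sym_value] wf(2) len t(1) by simp
      also have "map (\<lambda>p. ?w ! p) ps = map elem_symbol (map (\<lambda>p. ?v ! p) ps)" using IH by simp
      finally show ?thesis
        using sym_value[of g "map (\<lambda>p. ?v ! p) ps"] wf(1) IH unfolding v by auto
    qed
  qed
  moreover have "output_node C < num_gates C" using C by (simp add: wf_circuit_def)
  ultimately show ?thesis by (simp add: circuit_value_def node_values_def)
qed

lemma digit_value_dig: "j \<le> length es \<Longrightarrow> digit_value es z (dig j) = elem_symbol (digit_elem es z j)"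
  by (simp add: digit_value_def dig_def)

lemma digit_elem_universe: "j \<le> length es \<Longrightarrow> digit_elem es z j \<in> universe A"
  using z es nth_mem[of "j - 1" es] by (auto simp: digit_elem_def)

text \<open>Among the digits for each element, 0 is chosen for \<open>z\<close> and only for
  \<open>z\<close>, so that the weight equals the size of the support.\<close>

lemma digits_of_tuple:
  assumes "xs \<in> tuples n (universe A)"
  shows "\<exists>ds. ds \<in> sparse (length es) n (card (support z xs)) \<and> map (digit_elem es z) ds = xs"
proof -
  have "\<exists>j \<le> length es. digit_elem es z j = x \<and> (j \<noteq> 0 \<longleftrightarrow> x \<noteq> z)" if "x \<in> universe A" for x
  proof (cases "x = z")
    case True
    then show ?thesis by (intro exI[of _ 0]) (simp add: digit_elem_def)
  next
    case False
    have "x \<in> set es" using that es by simp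
    then obtain i where "i < length es" "es ! i = x" unfolding in_set_conv_nth by blast
    then show ?thesis using False by (intro exI[of _ "Suc i"]) (simp add: digit_elem_def)
  qed
  then have "\<forall>x \<in> universe A. \<exists>j. j \<le> length es \<and> digit_elem es z j = x \<and> (j \<noteq> 0 \<longleftrightarrow> x \<noteq> z)" by blast
  from bchoice[OF this] obtain f where
    f: "\<And>x. x \<in> universe A \<Longrightarrow> f x \<le> length es \<and> digit_elem es z (f x) = x \<and> (f x \<noteq> 0 \<longleftrightarrow> x \<noteq> z)"
    by blast
  have u: "x \<in> set xs \<Longrightarrow> x \<in> universe A" for x using assms by (auto simp: tuples_def)
  have "weight (map f xs) = length (filter (\<lambda>x. x \<noteq> z) xs)"
    using f u by (auto simp: weight_def filter_map comp_def intro!: arg_cong[of _ _ length] filter_cong)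
  also have "\<dots> = card (support z xs)" by (simp add: length_filter_conv_card support_def)
  finally have "map f xs \<in> sparse (length es) n (card (support z xs))"
    using assms f u by (auto simp: sparse_def tuples_def)
  moreover have "map (digit_elem es z) (map f xs) = xs" using f u by (auto intro: map_idI)
  ultimately show ?thesis by blast
qed

definition search_body :: "bool \<Rightarrow> ('a, 'i) letter com" where
  "search_body b = compare_circuits (start_gate A) (finish_gate A) (digit_value es z) (feed_gate A) b ;;
     Branch 15 (\<lambda>x. x = flag True) (Upd 11 0 (\<lambda>_ _. flag b)) (advance (length es) b) ;; Pop 15"

definition search_program :: "nat \<Rightarrow> bool \<Rightarrow> ('a, 'i) letter com" where
  "search_program r b = setup_search r ;; Loop 11 (\<lambda>x. x = mark) (search_body b)"

lemma runs_imp_exec: "runs M c s k e s' \<Longrightarrow> 1 \<le> M \<Longrightarrow> \<exists>t \<le> k * M ^ e. exec c s t s'"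
  unfolding runs_def by blast

text \<open>Two loop bounds are in use: the set-up computes a power in unary and runs with
  \<open>Suc N ^ Suc r\<close>, while a single round runs with \<open>N\<close>. The constant 339 is
  297 for the comparison, 41 for the branch and 1 for \<open>Pop\<close>.\<close>

lemma exec_search_program:
  assumes pair: "(C, C') \<in> circuit_pairs A"
  defines "N \<equiv> length (encode_pair (C, C'))"
  shows "\<exists>t s'. exec (search_program r b) (init_stacks (encode_pair (C, C'))) t s' \<and>
     t \<le> (51 + 24 * r) * (Suc N ^ Suc r) ^ 2 + (N * length es + 1) ^ (bit_length N ^ r) * (339 * N ^ 4 + 2) + 1 \<and>
     s' 11 = [flag (b = (\<exists>ds \<in> sparse (length es) (inputs C) (bit_length N ^ r).
        (circuit_value (alg_sem A) C (map (digit_elem es z) ds) =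
         circuit_value (alg_sem A) C' (map (digit_elem es z) ds)) = b))]"
proof -
  let ?a = "length es" and ?n = "inputs C"
  have wf: "wf_circuit (alg_fan_in_ok A) C" "wf_circuit (alg_fan_in_ok A) C'" "inputs C' = ?n"
    using pair by (auto simp: circuit_pairs_def)
  have a: "?a \<ge> 1" using z es by (cases es) auto
  have N1: "1 \<le> N" by (simp add: N_def encode_pair_def)
  have lw: "length (encode_pair (C, C')) = N" by (simp add: N_def)
  have nN: "?n \<le> N" by (simp add: N_def encode_pair_def encode_circuit_def)
  let ?M = "Suc N ^ Suc r" and ?w = "encode_pair (C, C')" and ?K = "bit_length N ^ r"
  define \<sigma> where "\<sigma> c ds = (init_stacks ?w)(2 := map dig ds, 4 := replicate c mark, 11 := [mark],
      13 := replicate (bit_length N) mark)" for c ds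
  define v where "v = concat (map (\<lambda>(g, ps). Label g # concat (map (\<lambda>p. Comma # map Bit (binary p)) ps)) (gates C)) @
     Output_mark # map Bit (binary (output_node C)) @ End_mark # encode_circuit C'"
  have w: "?w = replicate ?n Input_mark @ v" by (simp add: v_def encode_pair_def encode_circuit_def)
  have pv: "peek (map Letter v) \<noteq> Letter Input_mark"
    by (cases "gates C") (auto simp: v_def)
  have "1 \<le> ?M" by (rule one_le_power) simp
  obtain t1 where t1: "t1 \<le> (51 + 24 * r) * ?M ^ 2" "exec (setup_search r) (init_stacks ?w) t1 (\<sigma> ?K (replicate ?n 0))"
    using runs_imp_exec[OF runs_setup_search[OF w pv lw N1 order_refl, of r] \<open>1 \<le> ?M\<close>] unfolding \<sigma>_def by blast
  define hit where "hit ds \<longleftrightarrow> (circuit_value (alg_sem A) C (map (digit_elem es z) ds) =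
         circuit_value (alg_sem A) C' (map (digit_elem es z) ds)) = b" for ds
  have cmp: "runs N (compare_circuits (start_gate A) (finish_gate A) (digit_value es z) (feed_gate A) b) (\<sigma> c ds) 297 4
      ((\<sigma> c ds)(15 := [flag (hit ds)]))" if ds: "length ds = ?n" "set ds \<subseteq> {..?a}" for c ds
  proof -
    have dv: "map (digit_value es z) (map dig ds) = (map elem_symbol (map (digit_elem es z) ds) :: ('a, 'i) letter symbol list)"
      using ds(2) digit_value_dig by auto
    have tup: "map (digit_elem es z) ds \<in> tuples ?n (universe A)"
      using ds digit_elem_universe by (auto simp: tuples_def)
    have h: "((circuit_value sym_value C (map (digit_value es z) (map dig ds)) =
        circuit_value sym_value C' (map (digit_value es z) (map dig ds))) = b) = hit ds"
      unfolding dv using sym_circuit_value[OF wf(1) tup] sym_circuit_value[OF wf(2), of "map (digit_elem es z) ds"] tup wf(3)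
      by (simp add: hit_def)
    have "runs N (compare_circuits (start_gate A) (finish_gate A) (digit_value es z) (feed_gate A) b) (\<sigma> c ds) 297 4
        ((\<sigma> c ds)(15 := [Letter (Bit ((circuit_value sym_value C (map (digit_value es z) (map dig ds)) =
        circuit_value sym_value C' (map (digit_value es z) (map dig ds))) = b))]))"
    proof (rule runs_compare_circuits[where ok = "alg_fan_in_ok A"])
      show "Blank \<notin> set (map (digit_value es z) (map dig ds) :: ('a, 'i) letter symbol list)" unfolding dv by auto
      show "finish_gate A x \<noteq> Blank" for x :: "('a, 'i) letter symbol" by (simp add: finish_gate_def Let_def)
      show "length ?w \<le> N" by (simp add: N_def)
    qed (use wf ds in \<open>auto simp: \<sigma>_def init_stacks_def blanks_def\<close>)
    then show ?thesis unfolding h .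
  qed
  have p15: "tl (\<sigma> c ds 15) = []" "\<sigma> c ds 15 = []" for c ds by (auto simp: \<sigma>_def init_stacks_def)
  have "\<exists>t s'. t \<le> (?n * ?a + 1) ^ ?K * (339 * N ^ 4 + 2) + 1 \<and>
    exec (Loop 11 (\<lambda>x. x = mark) (search_body b)) (\<sigma> ?K (replicate ?n 0)) t s' \<and>
    s' 11 = [flag (b = (\<exists>ds \<in> sparse ?a ?n ?K. hit ds))]"
  proof (rule exec_search[OF a])
    show "\<sigma> c ds 11 = [mark]" for c ds by (simp add: \<sigma>_def)
    fix c ds assume ds: "length ds = ?n" "set ds \<subseteq> {..?a}"
    let ?s1 = "(\<sigma> c ds)(15 := [flag (hit ds)])"
    {
      assume h: "hit ds"
      have "runs N (Branch 15 (\<lambda>x. x = flag True) (Upd 11 0 (\<lambda>_ _. flag b)) (advance ?a b)) ?s1 3 0 (?s1(11 := [flag b]))"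
        by (rule runs_conv[OF runs_branchT[OF _ runs_upd]]) (use h in \<open>auto simp: \<sigma>_def\<close>)
      note seq = runs_seq[OF cmp[OF ds] runs_seq[OF this runs_pop]]
      let ?s' = "(?s1(11 := [flag b]))(15 := tl ((?s1(11 := [flag b])) 15))"
      have "runs N (search_body b) (\<sigma> c ds) 339 4 ?s'"
        unfolding search_body_def by (rule runs_conv[OF seq]) simp_all
      from runs_imp_exec[OF this N1]
      have "\<exists>t \<le> 339 * N ^ 4. exec (search_body b) (\<sigma> c ds) t ?s'" .
      moreover have "?s' 11 = [flag b]" by simp
      ultimately show "\<exists>s'. (\<exists>t \<le> 339 * N ^ 4. exec (search_body b) (\<sigma> c ds) t s') \<and> s' 11 = [flag b]"
        by blast
    next
      assume h: "\<not> hit ds"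
      have adv: "case odo_next ?a c ds of None \<Rightarrow> \<exists>s'. runs N (advance ?a b) ?s1 39 1 s' \<and> s' 11 = [flag (\<not> b)]
        | Some (c', ds') \<Rightarrow> runs N (advance ?a b) ?s1 39 1 (?s1(2 := map dig ds', 4 := replicate c' mark))"
        by (rule runs_advance[OF a]) (use ds nN in \<open>auto simp: \<sigma>_def init_stacks_def\<close>)
      have body: "runs N (search_body b) (\<sigma> c ds) 339 4 (s'(15 := tl (s' 15)))" if "runs N (advance ?a b) ?s1 39 1 s'" for s'
      proof -
        have "runs N (Branch 15 (\<lambda>x. x = flag True) (Upd 11 0 (\<lambda>_ _. flag b)) (advance ?a b)) ?s1 41 1 s'"
          by (rule runs_conv[OF runs_branchF[OF _ that]]) (use h in auto)
        note seq = runs_seq[OF cmp[OF ds] runs_seq[OF this runs_pop]]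
        show ?thesis unfolding search_body_def by (rule runs_conv[OF seq]) simp_all
      qed
      {
        assume "odo_next ?a c ds = None"
        then obtain s' where s': "runs N (advance ?a b) ?s1 39 1 s'" "s' 11 = [flag (\<not> b)]" using adv by auto
        have "(s'(15 := tl (s' 15))) 11 = [flag (\<not> b)]" using s'(2) by simp
        then show "\<exists>s'. (\<exists>t \<le> 339 * N ^ 4. exec (search_body b) (\<sigma> c ds) t s') \<and> s' 11 = [flag (\<not> b)]"
          using runs_imp_exec[OF body[OF s'(1)] N1] by blast
      next
        fix c' ds' assume "odo_next ?a c ds = Some (c', ds')"
        then have "runs N (advance ?a b) ?s1 39 1 (?s1(2 := map dig ds', 4 := replicate c' mark))" using adv by simp
        from runs_conv[OF body[OF this], of "\<sigma> c' ds'" 339 4]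
        have "runs N (search_body b) (\<sigma> c ds) 339 4 (\<sigma> c' ds')"
          by (auto simp: \<sigma>_def init_stacks_def fun_eq_iff)
        from runs_imp_exec[OF this N1]
        show "\<exists>t \<le> 339 * N ^ 4. exec (search_body b) (\<sigma> c ds) t (\<sigma> c' ds')" .
      }
    }
  qed
  then obtain t2 s' where t2: "t2 \<le> (?n * ?a + 1) ^ ?K * (339 * N ^ 4 + 2) + 1"
    "exec (Loop 11 (\<lambda>x. x = mark) (search_body b)) (\<sigma> ?K (replicate ?n 0)) t2 s'"
    "s' 11 = [flag (b = (\<exists>ds \<in> sparse ?a ?n ?K. hit ds))]" by blast
  have "(?n * ?a + 1) ^ ?K \<le> (N * ?a + 1) ^ ?K" using nN by (intro power_mono) auto
  then have "(?n * ?a + 1) ^ ?K * (339 * N ^ 4 + 2) \<le> (N * ?a + 1) ^ ?K * (339 * N ^ 4 + 2)" by (rule mult_le_mono1)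
  then have "t1 + t2 \<le> (51 + 24 * r) * ?M ^ 2 + (N * ?a + 1) ^ ?K * (339 * N ^ 4 + 2) + 1"
    using t1(1) t2(1) by linarith
  moreover have "exec (search_program r b) (init_stacks ?w) (t1 + t2) s'"
    unfolding search_program_def by (rule exec.intros(5)[OF t1(2) t2(2)])
  ultimately show ?thesis using t2(3) unfolding hit_def by blast
qed

lemma alphabet_closed:
  fixes x y :: "('a, 'i) letter symbol"
  shows "mark \<in> alphabet A (length es)" "Blank \<in> alphabet A (length es)" "flag b \<in> alphabet A (length es)"
    "dig 0 \<in> alphabet A (length es)" "dnext (length es) x \<in> alphabet A (length es)"
    "digit_value es z x \<in> alphabet A (length es)" "start_gate A x \<in> alphabet A (length es)"
    "feed_gate A x y \<in> alphabet A (length es)" "finish_gate A x \<in> alphabet A (length es)"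
proof -
  have elem: "elem_symbol u \<in> alphabet A (length es)" if "u \<in> universe A" for u
    using that by (auto simp: alphabet_def)
  have gate: "gate_symbol A p \<in> alphabet A (length es)" if "p \<in> partial_gates A" for p
    using that by (auto simp: alphabet_def)
  show m: "mark \<in> alphabet A (length es)" "Blank \<in> alphabet A (length es)" by (auto simp: alphabet_def)
  show "flag b \<in> alphabet A (length es)" by (cases b) (auto simp: alphabet_def)
  have dig: "dig j \<in> alphabet A (length es)" if "j \<le> length es" for j using that by (auto simp: alphabet_def)
  show "dig 0 \<in> alphabet A (length es)" by (rule dig) simp
  show "dnext (length es) x \<in> alphabet A (length es)"
  proof (cases "\<exists>n. x = Aux n \<and> odd n \<and> n div 2 < length es")
    case True
    then obtain n where n: "x = Aux n" "odd n" "n div 2 < length es" by blast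
    then have "dnext (length es) x = dig (Suc (n div 2))" by (auto simp: dnext_def dig_def elim!: oddE)
    then show ?thesis using dig[of "Suc (n div 2)"] n(3) by simp
  next
    case False
    then have "dnext (length es) x = mark" by (auto simp: dnext_def split: symbol.splits)
    then show ?thesis using m by simp
  qed
  show "digit_value es z x \<in> alphabet A (length es)"
    using m elem digit_elem_universe by (auto simp: digit_value_def split: symbol.splits)
  show "start_gate A x \<in> alphabet A (length es)"
    using m gate by (auto simp: start_gate_def split: symbol.splits letter.splits)
  show "feed_gate A x y \<in> alphabet A (length es)"
    using m gate by (auto simp: feed_gate_def add_argument_def split: symbol.splits letter.splits alg_gate.splits)
  show "finish_gate A x \<in> alphabet A (length es)"
    using m elem by (auto simp: finish_gate_def Let_def)
qed

lemma wf_search_program: "wf_com (alphabet A (length es)) 16 (search_program r b)"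
proof -
  have "wf_com (alphabet A (length es)) 16 (power_marks r)"
    by (induction r) (auto simp: mult_marks_def mv2_def mv_def mvp_def)
  then show ?thesis
    using alphabet_closed
    by (simp add: search_program_def setup_search_def search_body_def compare_circuits_def read_circuit_def
        read_gate_def read_operand_def find_node_def unary_def double_def advance_def odo_digit_def
        log_marks_def halve_def mv_def mv2_def mvp_def clear_def)
qed

lemma encode_pair_alphabet:
  assumes "(C, C') \<in> circuit_pairs A"
  shows "Letter ` set (encode_pair (C, C')) \<subseteq> alphabet A (length es)"
proof -
  have enc: "Letter ` set (encode_circuit D) \<subseteq> alphabet A (length es)" if D: "wf_circuit (alg_fan_in_ok A) D" for D
  proof -
    have label: "g \<in> Basic ` index A \<union> Elem ` universe A" if "(g, ps) \<in> set (gates D)" for g ps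
    proof -
      have "\<exists>j < length (gates D). gates D ! j = (g, ps)" using that unfolding in_set_conv_nth .
      then have "alg_fan_in_ok A g (length ps)" using D unfolding wf_circuit_def by fastforce
      then show ?thesis by (cases g) auto
    qed
    have "set (encode_circuit D) \<subseteq> {Bit True, Bit False, Comma, Output_mark, Input_mark} \<union>
        Label ` (Basic ` index A \<union> Elem ` universe A)"
    proof
      fix l assume "l \<in> set (encode_circuit D)"
      then consider "l \<in> {Input_mark, Output_mark, Comma}" | c where "l = Bit c" | g ps where "l = Label g" "(g, ps) \<in> set (gates D)"
        by (auto simp: encode_circuit_def split: if_splits)
      then show "l \<in> {Bit True, Bit False, Comma, Output_mark, Input_mark} \<union> Label ` (Basic ` index A \<union> Elem ` universe A)"
      proof cases
        case (2 c)
        then show ?thesis by (cases c) auto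
      next
        case (3 g ps)
        have "g \<in> Basic ` index A \<union> Elem ` universe A" by (rule label[OF 3(2)])
        then show ?thesis unfolding 3(1) by (rule UnI2[OF imageI])
      qed auto
    qed
    then show ?thesis by (auto simp: alphabet_def)
  qed
  have "wf_circuit (alg_fan_in_ok A) C" "wf_circuit (alg_fan_in_ok A) C'"
    using assms by (auto simp: circuit_pairs_def)
  from enc[OF this(1)] enc[OF this(2)] show ?thesis
    by (simp add: encode_pair_def image_Un) (simp add: alphabet_def)
qed

lemma finite_alphabet: "finite (alphabet A (length es))"
  using finite_partial_gates[OF finite_universe A(2)] finite_universe A(2) by (simp add: alphabet_def)

section \<open>Correctness and running time of the search\<close>

definition search_time :: "nat \<Rightarrow> nat \<Rightarrow> nat" where
  "search_time r N = (51 + 24 * r) * (Suc N ^ Suc r) ^ 2 +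
     (N * length es + 1) ^ (bit_length N ^ r) * (339 * N ^ 4 + 2) + 2"

text \<open>For \<open>b = True\<close> the condition on \<open>Y\<close> asks for a tuple with
  equal values, for \<open>b = False\<close> for the absence of one with different values. The bound
  on supports makes the restricted search complete.\<close>

lemma search_decides:
  assumes Y: "\<And>C C'. (C, C') \<in> circuit_pairs A \<Longrightarrow>
     (C, C') \<in> Y \<longleftrightarrow> (b = (\<exists>xs \<in> tuples (inputs C) (universe A).
        (circuit_value (alg_sem A) C xs = circuit_value (alg_sem A) C' xs) = b))"
    and r: "\<And>C C' b N. (C, C') \<in> circuit_pairs A \<Longrightarrow> 2 \<le> N \<Longrightarrow> num_gates C + num_gates C' \<le> N \<Longrightarrow>
     \<exists>xs \<in> tuples (inputs C) (universe A).
        (circuit_value (alg_sem A) C xs = circuit_value (alg_sem A) C' xs) = b \<Longrightarrow>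
     \<exists>xs \<in> tuples (inputs C) (universe A).
        ((circuit_value (alg_sem A) C xs = circuit_value (alg_sem A) C' xs) = b) \<and>
        card (support z xs) \<le> bit_length N ^ r"
  shows "decides_within (stack_tm 16 (alphabet A (length es)) (compile 0 (search_program r b)) 11 (flag True))
    encode_pair (circuit_pairs A) Y (\<lambda>N. real (search_time r N))"
proof (rule decides_within_exec)
  show "finite (alphabet A (length es))" by (rule finite_alphabet)
  show "Blank \<in> alphabet A (length es)" by (rule alphabet_closed)
  show "wf_com (alphabet A (length es)) 16 (search_program r b)" by (rule wf_search_program)
  fix x assume x: "x \<in> circuit_pairs A"
  obtain C C' where xC: "x = (C, C')" by (cases x)
  note pair = x[unfolded xC]
  show "Letter ` set (encode_pair x) \<subseteq> alphabet A (length es)"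
    unfolding xC by (rule encode_pair_alphabet[OF pair])
  let ?N = "length (encode_pair (C, C'))"
  obtain t s' where t: "exec (search_program r b) (init_stacks (encode_pair (C, C'))) t s'"
    "Suc t \<le> search_time r ?N"
    "s' 11 = [flag (b = (\<exists>ds \<in> sparse (length es) (inputs C) (bit_length ?N ^ r).
        (circuit_value (alg_sem A) C (map (digit_elem es z) ds) =
         circuit_value (alg_sem A) C' (map (digit_elem es z) ds)) = b))]"
    using exec_search_program[OF pair, of r b] unfolding search_time_def by fastforce
  have N: "num_gates C + num_gates C' \<le> ?N" using num_gates_le_encode[of C] num_gates_le_encode[of C'] by (simp add: encode_pair_def)
  have N2: "2 \<le> ?N" by (simp add: encode_pair_def encode_circuit_def)
  have "(\<exists>ds \<in> sparse (length es) (inputs C) (bit_length ?N ^ r).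
        (circuit_value (alg_sem A) C (map (digit_elem es z) ds) =
         circuit_value (alg_sem A) C' (map (digit_elem es z) ds)) = b) \<longleftrightarrow>
     (\<exists>xs \<in> tuples (inputs C) (universe A).
        (circuit_value (alg_sem A) C xs = circuit_value (alg_sem A) C' xs) = b)" (is "?L \<longleftrightarrow> ?R")
  proof
    assume ?L
    then obtain ds where ds: "ds \<in> sparse (length es) (inputs C) (bit_length ?N ^ r)"
       "(circuit_value (alg_sem A) C (map (digit_elem es z) ds) =
         circuit_value (alg_sem A) C' (map (digit_elem es z) ds)) = b" by blast
    have "map (digit_elem es z) ds \<in> tuples (inputs C) (universe A)"
      using ds(1) digit_elem_universe by (auto simp: sparse_def tuples_def)
    then show ?R using ds(2) by blast
  next
    assume ?R
    from r[OF pair N2 N this] obtain xs where xs: "xs \<in> tuples (inputs C) (universe A)"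
       "(circuit_value (alg_sem A) C xs = circuit_value (alg_sem A) C' xs) = b" "card (support z xs) \<le> bit_length ?N ^ r"
      by blast
    obtain ds where ds: "ds \<in> sparse (length es) (inputs C) (card (support z xs))" "map (digit_elem es z) ds = xs"
      using digits_of_tuple[OF xs(1)] by blast
    have "ds \<in> sparse (length es) (inputs C) (bit_length ?N ^ r)" using ds(1) xs(3) by (auto simp: sparse_def)
    then show ?L using ds(2) xs(2) by blast
  qed
  then have "peek (s' 11) = flag True \<longleftrightarrow> x \<in> Y"
    using t(3) Y[OF pair] by (simp add: xC)
  then show "\<exists>t s'. exec (search_program r b) (init_stacks (encode_pair x)) t s' \<and>
      real (Suc t) \<le> real (search_time r (length (encode_pair x))) \<and> (peek (s' 11) = flag True \<longleftrightarrow> x \<in> Y)"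
    using t(1,2) unfolding xC by (metis of_nat_mono)
qed auto

text \<open>With \<open>l = log 2 N\<close> the bit length is at most \<open>2 * l\<close>, so the
  number of tuples is at most 2 to the power of a constant times \<open>l ^ (r + 1)\<close>. One
  more power of \<open>l\<close> absorbs the constant once \<open>l \<ge> c\<close>, hence the
  exponent \<open>r + 2\<close>.\<close>

lemma search_time_quasipolynomial:
  "(\<lambda>N. real (search_time r N)) \<in> O(\<lambda>N. 2 powr (log 2 (real N) powr (real r + 2)))"
proof -
  \<comment> \<open>Exponents to base 2: \<open>N * length es + 1\<close> is at most
    \<open>2 powr (l + la)\<close>, the set-up is bounded by a constant times
    \<open>2 powr (c1 * l)\<close>, the tuples by \<open>2 powr (c2 * E)\<close> with
    \<open>E = l ^ Suc r\<close>, and 4 comes from \<open>N ^ 4\<close>.\<close>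
  define la where "la = log 2 (real (length es) + 1)"
  define c1 where "c1 = 4 * (real r + 1)"
  define c2 where "c2 = (1 + la) * 2 ^ r"
  define c where "c = c1 + c2 + 4"
  \<comment> \<open>Of 343, the part 341 covers \<open>339 * N ^ 4 + 2\<close>, and 2 is the last
    summand of \<open>search_time\<close>.\<close>
  define k where "k = real (51 + 24 * r) + 343"
  have la: "la \<ge> 0" by (simp add: la_def)
  have c: "c1 \<ge> 0" "c2 \<ge> 0" "c \<ge> 0" using la by (auto simp: c_def c1_def c2_def)
  have "real (search_time r N) \<le> k * 2 powr (log 2 (real N) powr (real r + 2))"
    if N: "N \<ge> 2" "log 2 (real N) \<ge> c" for N
  proof -
    define l where "l = log 2 (real N)"
    define E where "E = l ^ Suc r"
    have l1: "l \<ge> 1" using N(1) by (simp add: l_def)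
    have Nl: "real N = 2 powr l" using N(1) by (simp add: l_def)
    have "l * 1 \<le> l * l ^ r" using l1 one_le_power[OF l1, of r] by (intro mult_left_mono) auto
    then have E: "E \<ge> l" "E \<ge> 1" using l1 one_le_power[OF l1, of "Suc r"] by (simp_all add: E_def)
    have pp: "(2 powr y) ^ j = 2 powr (y * real j)" for y :: real and j :: nat
      using powr_powr[of 2 y "real j"] by (simp add: powr_realpow)
    have pw: "2 powr (x * l) \<le> 2 powr (x * E)" if "x \<ge> 0" for x :: real
      using that E(1) by (intro powr_mono mult_left_mono) auto
    have "Suc N \<le> N * N" using N(1) by (cases N) auto
    then have "real (Suc N) \<le> real N ^ 2" by (metis of_nat_mono of_nat_mult power2_eq_square)
    then have "real ((Suc N ^ Suc r) ^ 2) \<le> ((real N ^ 2) ^ Suc r) ^ 2"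
      unfolding of_nat_power by (intro power_mono) auto
    also have "\<dots> = real N ^ (2 * Suc r * 2)" by (simp only: power_mult)
    also have "\<dots> = 2 powr (c1 * l)"
      unfolding Nl pp by (simp add: c1_def algebra_simps)
    finally have T1: "real ((Suc N ^ Suc r) ^ 2) \<le> 2 powr (c1 * E)" using pw[OF c(1)] by linarith
    have "bit_length N \<ge> 1" using bit_length_ge_2[OF N(1)] by simp
    then have "2 ^ (bit_length N - 1) \<le> N" by (intro bit_length_le) simp
    then have "real (2 ^ (bit_length N - 1)) \<le> real N" by (rule of_nat_mono)
    then have "2 powr real (bit_length N - 1) \<le> 2 powr l" using Nl by (simp add: powr_realpow)
    then have "real (bit_length N) \<le> 2 * l" using l1 \<open>bit_length N \<ge> 1\<close> by simp
    then have K: "real (bit_length N ^ r) \<le> 2 ^ r * l ^ r"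
      unfolding of_nat_power power_mult_distrib[symmetric] by (intro power_mono) auto
    have "real (N * length es + 1) \<le> real N * (real (length es) + 1)" using N(1) by (simp add: algebra_simps)
    also have "\<dots> = 2 powr (l + la)" by (simp add: powr_add Nl la_def)
    also have "\<dots> \<le> 2 powr (l * (1 + la))" using mult_right_mono[OF l1 la] by (intro powr_mono) (auto simp: algebra_simps)
    finally have "real ((N * length es + 1) ^ (bit_length N ^ r)) \<le> (2 powr (l * (1 + la))) ^ (bit_length N ^ r)"
      unfolding of_nat_power by (intro power_mono) auto
    also have "\<dots> = 2 powr (l * (1 + la) * real (bit_length N ^ r))"
      by (rule pp)
    also have "\<dots> \<le> 2 powr (l * (1 + la) * (2 ^ r * l ^ r))"
      using K l1 la by (intro powr_mono mult_left_mono) auto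
    also have "l * (1 + la) * (2 ^ r * l ^ r) = c2 * E" by (simp add: c2_def E_def algebra_simps)
    finally have T2: "real ((N * length es + 1) ^ (bit_length N ^ r)) \<le> 2 powr (c2 * E)" .
    have "real (339 * N ^ 4 + 2) \<le> 341 * real N ^ 4" using N(1) one_le_power[of "real N" 4] by simp
    also have "real N ^ 4 = 2 powr (4 * l)" unfolding Nl pp by (simp add: mult.commute)
    finally have T3: "real (339 * N ^ 4 + 2) \<le> 341 * 2 powr (4 * E)" using pw[of 4] by linarith
    have le: "2 powr (c1 * E) \<le> 2 powr (c * E)" "1 \<le> 2 powr (c * E)" "2 powr (c2 * E) * 2 powr (4 * E) \<le> 2 powr (c * E)"
      using c E by (auto simp: c_def powr_add[symmetric] algebra_simps intro!: powr_mono ge_one_powr_ge_zero)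
    have "real (search_time r N) = real (51 + 24 * r) * real ((Suc N ^ Suc r) ^ 2) +
       real ((N * length es + 1) ^ (bit_length N ^ r)) * real (339 * N ^ 4 + 2) + 2"
      unfolding search_time_def of_nat_add of_nat_mult by simp
    also have "\<dots> \<le> real (51 + 24 * r) * 2 powr (c1 * E) + 2 powr (c2 * E) * (341 * 2 powr (4 * E)) + 2"
      using T1 T2 T3 by (intro add_mono mult_mono) auto
    also have "\<dots> \<le> real (51 + 24 * r) * 2 powr (c * E) + 341 * 2 powr (c * E) + 2 * 2 powr (c * E)"
      using le by (intro add_mono mult_left_mono) auto
    also have "\<dots> = k * 2 powr (c * E)" by (simp add: k_def algebra_simps)
    also have "\<dots> \<le> k * 2 powr (l powr (real r + 2))"
    proof -
      have "c * E \<le> l * E" using N(2) E by (intro mult_right_mono) (auto simp: l_def)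
      also have "\<dots> = l ^ (r + 2)" by (simp add: E_def)
      also have "\<dots> = l powr real (r + 2)" using l1 by (intro powr_realpow[symmetric]) simp
      also have "real (r + 2) = real r + 2" by simp
      finally show ?thesis by (intro mult_left_mono powr_mono) (auto simp: k_def)
    qed
    finally show ?thesis by (simp add: l_def)
  qed
  moreover have "eventually (\<lambda>N. N \<ge> 2 \<and> log 2 (real N) \<ge> c) sequentially"
  proof -
    have "eventually (\<lambda>N. real N \<ge> 2 powr c) sequentially"
      using filterlim_real_sequentially by (simp add: filterlim_at_top)
    then show ?thesis
      using eventually_ge_at_top[of "2 :: nat"]
    proof eventually_elim
      case (elim N)
      then have "log 2 (2 powr c) \<le> log 2 (real N)" by (subst log_le_cancel_iff) auto
      then show ?case using elim by simp
    qed
  qed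
  ultimately have "eventually (\<lambda>N. norm (real (search_time r N)) \<le> k * norm (2 powr (log 2 (real N) powr (real r + 2)))) sequentially"
    by (auto elim!: eventually_mono)
  then show ?thesis by (rule bigoI)
qed

end

theorem theorem4p1:
  fixes A :: "('a, 'i) ualg"
  assumes lower_bound:
    "\<forall>m \<ge> 1. \<forall>C :: nat \<Rightarrow> cc_gate circuit.
       (\<exists>d. \<forall>n. cc_circuit (C n) \<and> circuit_depth (C n) \<le> d \<and> computes_AND m n (C n)) \<longrightarrow>
       (\<exists>q > 0. \<exists>g :: nat \<Rightarrow> real. g \<in> \<Omega>(\<lambda>n. real n powr q) \<and>
          (\<forall>n. real (num_gates (C n)) = 2 powr g n))"
    and "finite_algebra A"
    and "in_congruence_modular_variety A"
    and "nilpotent_algebra A"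
  shows "\<exists>t > 0.
    solvable_in_time encode_pair (circuit_pairs A) (CSAT A)
      (\<lambda>n. 2 powr (log 2 (real n) powr t)) \<and>
    solvable_in_time encode_pair (circuit_pairs A) (CEQV A)
      (\<lambda>n. 2 powr (log 2 (real n) powr t))"
proof -
  have A: "is_algebra A" "finite (universe A)" "finite (index A)"
    using \<open>finite_algebra A\<close> by (auto simp: finite_algebra_def)
  \<comment> \<open>Every level is built on a module, which contains a zero; so there is an element
    \<open>z\<close> to measure supports against.\<close>
  have "universe A \<noteq> {}"
    using \<open>nilpotent_algebra A\<close> nilpotent_universe_nonempty by (auto simp: nilpotent_algebra_def)
  then obtain z where z: "z \<in> universe A" by blast
  obtain es where es: "set es = universe A" using finite_list[OF A(2)] by blast
  obtain r where r: "\<And>C C' b N. (C, C') \<in> circuit_pairs A \<Longrightarrow> 2 \<le> N \<Longrightarrow> num_gates C + num_gates C' \<le> N \<Longrightarrow>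
     \<exists>xs \<in> tuples (inputs C) (universe A).
        (circuit_value (alg_sem A) C xs = circuit_value (alg_sem A) C' xs) = b \<Longrightarrow>
     \<exists>xs \<in> tuples (inputs C) (universe A).
        ((circuit_value (alg_sem A) C xs = circuit_value (alg_sem A) C' xs) = b) \<and>
        card (support z xs) \<le> bit_length N ^ r"
    using sparse_solutions[OF lower_bound \<open>finite_algebra A\<close> \<open>nilpotent_algebra A\<close> z] by blast
  let ?M = "\<lambda>b. stack_tm 16 (alphabet A (length es)) (compile 0 (search_program A es z r b)) 11 (flag True)"
  let ?T = "\<lambda>N. real (search_time es r N)"
  have sat: "decides_within (?M True) encode_pair (circuit_pairs A) (CSAT A) ?T"
    by (rule search_decides[OF A(1,3) es z _ r]) (auto simp: CSAT_def)
  \<comment> \<open>With \<open>b = False\<close> the search looks for a tuple with different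
    values, and the verdict is the negation of its success.\<close>
  have eqv: "decides_within (?M False) encode_pair (circuit_pairs A) (CEQV A) ?T"
    by (rule search_decides[OF A(1,3) es z _ r]) (auto simp: CEQV_def)
  have T: "?T \<in> O(\<lambda>n. 2 powr (log 2 (real n) powr (real r + 2)))"
    by (rule search_time_quasipolynomial[OF A(1,3) es z])
  show ?thesis
    unfolding solvable_in_time_def using sat eqv T by (intro exI[of _ "real r + 2"]) auto
qed

end
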